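(* There is a reduction, running in $O(N\,\mathrm{poly}(D))$ time, from BP-Satisfying-Pair on a branching program of length $T$ and width $W$ and two sets of $N$ strings to Gap-Max-TropSim$_\epsilon$ on two sets of $N$ tensors of size $D=2^{O(\log^2W\log^2T(\log\log W+\log\log T+\log\epsilon^{-1}))}$; yes-instances map to the completeness case and no-instances to the soundness case. Here $\epsilon$ is a threshold value that may depend on $N$.
   Context: A (nondeterministic) branching program (BP) of length $T$ and width $W$ on Boolean inputs $x_1,\dots,x_n$ is a layered directed graph with $T$ layers of $W$ nodes; all nodes of layer $i<T$ are labelled by one variable $x_{f(i)}$; edges go between consecutive layers and are marked $0$ or $1$; it accepts $x$ iff there is a path from the first node of layer $1$ to the first node of layer $T$ using only edges whose mark equals the value of the variable labelling their starting node. BP-Satisfying-Pair: given a BP $P$ on $n$ inputs and $A,B\subseteq\{0,1\}^{n/2}$ of $N$ strings each, decide whether $P$ accepts the concatenation of some $a\in A$, $b\in B$. For even $t$, tensors $u,v\in\{0,1\}^{2\times\cdots\times2}$ ($t$ factors, size $D=2^t$) indexed by $i\in\{0,1\}^t$ have tropical similarity $s(u,v)=\mathbb{E}_{i_1}\max_{i_2}\mathbb{E}_{i_3}\cdots\max_{i_t}(u_i\cdot v_i)$, where $\mathbb{E}$ denotes averaging over $\{0,1\}$. Gap-Max-TropSim$_\epsilon$: given two sets $A,B$ of $N$ such tensors, distinguish the completeness case (some $(a,b)\in A\times B$ has $s(a,b)=1$) from the soundness case (every pair has $s(a,b)<\epsilon$). *)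

theory Defs
  imports Complex_Main
begin

section \<open>Branching programs\<close>

text \<open>
  Layers and nodes are numbered from 0: the layers are \<open>0, \<dots>, T - 1\<close> and the nodes of each layer
  are \<open>0, \<dots>, W - 1\<close>. An edge \<open>(i, u, b, v)\<close> with mark \<open>b\<close> leads from node \<open>u\<close> of layer \<open>i\<close> to
  node \<open>v\<close> of layer \<open>i + 1\<close>; the two nodes may be joined by both a 0-edge and a 1-edge.
\<close>

record bp =
  bp_inputs :: nat
  bp_length :: nat
  bp_width :: nat
  bp_label :: "nat \<Rightarrow> nat"
  bp_edges :: "(nat \<times> nat \<times> bool \<times> nat) set"

definition branching_program :: "bp \<Rightarrow> bool" where
  "branching_program P \<longleftrightarrow>
     1 \<le> bp_length P \<and> 1 \<le> bp_width P \<and>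
     (\<forall>i < bp_length P - 1. bp_label P i < bp_inputs P) \<and>
     (\<forall>(i, u, b, v) \<in> bp_edges P. i < bp_length P - 1 \<and> u < bp_width P \<and> v < bp_width P)"

definition bp_accepts :: "bp \<Rightarrow> bool list \<Rightarrow> bool" where
  "bp_accepts P x \<longleftrightarrow>
     (\<exists>p :: nat \<Rightarrow> nat.
        p 0 = 0 \<and> p (bp_length P - 1) = 0 \<and>
        (\<forall>i < bp_length P - 1. (i, p i, x ! bp_label P i, p (Suc i)) \<in> bp_edges P))"

text \<open>
  A collection of \<open>N\<close> strings is a list of length \<open>N\<close>, repetitions allowed; likewise for tensors.
  (For tensors this is unavoidable: there are only \<open>2 ^ D\<close> different tensors of size \<open>D\<close>, and
  \<open>D\<close> may be far smaller than \<open>log N\<close>.)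
\<close>

definition bp_pair_instance :: "nat \<Rightarrow> bp \<Rightarrow> bool list list \<Rightarrow> bool list list \<Rightarrow> bool" where
  "bp_pair_instance N P A B \<longleftrightarrow>
     branching_program P \<and> even (bp_inputs P) \<and> length A = N \<and> length B = N \<and>
     (\<forall>x \<in> set A \<union> set B. length x = bp_inputs P div 2)"

definition bp_satisfying_pair :: "bp \<Rightarrow> bool list list \<Rightarrow> bool list list \<Rightarrow> bool" where
  "bp_satisfying_pair P A B \<longleftrightarrow> (\<exists>a \<in> set A. \<exists>b \<in> set B. bp_accepts P (a @ b))"


section \<open>Tropical similarity\<close>

text \<open>
  A 0/1 tensor with \<open>t\<close> binary factors is a function on bit lists, of which only the values at
  lists of length \<open>t\<close> matter. The flag of \<open>mean_max\<close> tells whether the first remaining index is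
  averaged (\<open>True\<close>) or maximized (\<open>False\<close>).
\<close>

type_synonym tensor = "bool list \<Rightarrow> bool"

fun mean_max :: "bool \<Rightarrow> nat \<Rightarrow> (bool list \<Rightarrow> real) \<Rightarrow> real" where
  "mean_max _ 0 g = g []"
| "mean_max True (Suc t) g =
     (mean_max False t (\<lambda>i. g (False # i)) + mean_max False t (\<lambda>i. g (True # i))) / 2"
| "mean_max False (Suc t) g =
     max (mean_max True t (\<lambda>i. g (False # i))) (mean_max True t (\<lambda>i. g (True # i)))"

definition trop_sim :: "nat \<Rightarrow> tensor \<Rightarrow> tensor \<Rightarrow> real" where
  "trop_sim t u v = mean_max True t (\<lambda>i. of_bool (u i) * of_bool (v i))"

definition tropsim_complete :: "nat \<Rightarrow> tensor list \<Rightarrow> tensor list \<Rightarrow> bool" where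
  "tropsim_complete t U V \<longleftrightarrow> (\<exists>u \<in> set U. \<exists>v \<in> set V. trop_sim t u v = 1)"

definition tropsim_sound :: "real \<Rightarrow> nat \<Rightarrow> tensor list \<Rightarrow> tensor list \<Rightarrow> bool" where
  "tropsim_sound \<epsilon> t U V \<longleftrightarrow> (\<forall>u \<in> set U. \<forall>v \<in> set V. trop_sim t u v < \<epsilon>)"


section \<open>A word RAM\<close>

text \<open>
  Running time is measured on a word RAM, presented as a structured language with finitely many
  scalar registers and random-access arrays of words per program. Words are the naturals below \<open>M\<close>;
  a program that produces a larger value (even an intermediate one) is stuck. Every operation on
  words and every memory access costs one unit.
\<close>

datatype binop = Add | Sub | Mul | Div | Mod | Less | Equal

fun apply_op :: "binop \<Rightarrow> nat \<Rightarrow> nat \<Rightarrow> nat" where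
  "apply_op Add a b = a + b"
| "apply_op Sub a b = a - b"
| "apply_op Mul a b = a * b"
| "apply_op Div a b = a div b"
| "apply_op Mod a b = a mod b"
| "apply_op Less a b = of_bool (a < b)"
| "apply_op Equal a b = of_bool (a = b)"

datatype expr =
    Const nat
  | Reg string
  | Read string expr
  | Op binop expr expr

datatype com =
    Skip
  | Assign string expr
  | Write string expr expr
  | Seq com com
  | Cond expr com com
  | While expr com

record mem =
  regs :: "string \<Rightarrow> nat"
  arrs :: "string \<Rightarrow> nat \<Rightarrow> nat"

fun val :: "expr \<Rightarrow> mem \<Rightarrow> nat" where
  "val (Const k) s = k"
| "val (Reg x) s = regs s x"
| "val (Read a e) s = arrs s a (val e s)"
| "val (Op f e1 e2) s = apply_op f (val e1 s) (val e2 s)"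

fun cost :: "expr \<Rightarrow> nat" where
  "cost (Const k) = 1"
| "cost (Reg x) = 1"
| "cost (Read a e) = cost e + 1"
| "cost (Op f e1 e2) = cost e1 + cost e2 + 1"

fun fits :: "nat \<Rightarrow> expr \<Rightarrow> mem \<Rightarrow> bool" where
  "fits M (Const k) s \<longleftrightarrow> k < M"
| "fits M (Reg x) s \<longleftrightarrow> regs s x < M"
| "fits M (Read a e) s \<longleftrightarrow> fits M e s \<and> val (Read a e) s < M"
| "fits M (Op f e1 e2) s \<longleftrightarrow> fits M e1 s \<and> fits M e2 s \<and> val (Op f e1 e2) s < M"

text \<open>\<open>exec M c s \<tau> s'\<close>: with words below \<open>M\<close>, \<open>c\<close> started in \<open>s\<close> halts in \<open>s'\<close> after time \<open>\<tau>\<close>.\<close>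

inductive exec :: "nat \<Rightarrow> com \<Rightarrow> mem \<Rightarrow> nat \<Rightarrow> mem \<Rightarrow> bool" for M where
  Skip: "exec M Skip s 1 s"
| Assign: "fits M e s \<Longrightarrow>
    exec M (Assign x e) s (cost e + 1) (s\<lparr>regs := (regs s)(x := val e s)\<rparr>)"
| Write: "fits M e1 s \<Longrightarrow> fits M e2 s \<Longrightarrow>
    exec M (Write a e1 e2) s (cost e1 + cost e2 + 1)
      (s\<lparr>arrs := (arrs s)(a := (arrs s a)(val e1 s := val e2 s))\<rparr>)"
| Seq: "exec M c1 s1 \<tau>1 s2 \<Longrightarrow> exec M c2 s2 \<tau>2 s3 \<Longrightarrow> exec M (Seq c1 c2) s1 (\<tau>1 + \<tau>2) s3"
| CondTrue: "fits M e s \<Longrightarrow> val e s \<noteq> 0 \<Longrightarrow> exec M c1 s \<tau> s' \<Longrightarrow>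
    exec M (Cond e c1 c2) s (cost e + 1 + \<tau>) s'"
| CondFalse: "fits M e s \<Longrightarrow> val e s = 0 \<Longrightarrow> exec M c2 s \<tau> s' \<Longrightarrow>
    exec M (Cond e c1 c2) s (cost e + 1 + \<tau>) s'"
| WhileFalse: "fits M e s \<Longrightarrow> val e s = 0 \<Longrightarrow> exec M (While e c) s (cost e + 1) s"
| WhileTrue: "fits M e s1 \<Longrightarrow> val e s1 \<noteq> 0 \<Longrightarrow> exec M c s1 \<tau>1 s2 \<Longrightarrow>
    exec M (While e c) s2 \<tau>2 s3 \<Longrightarrow> exec M (While e c) s1 (cost e + 1 + \<tau>1 + \<tau>2) s3"

inductive_cases SkipE: "exec M Skip s \<tau> s'"
inductive_cases AssignE: "exec M (Assign x e) s \<tau> s'"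
inductive_cases WriteE: "exec M (Write a e1 e2) s \<tau> s'"
inductive_cases SeqE: "exec M (Seq c1 c2) s \<tau> s'"
inductive_cases CondE: "exec M (Cond e c1 c2) s \<tau> s'"
inductive_cases WhileE: "exec M (While e c) s \<tau> s'"

lemma exec_deterministic:
  "exec M c s \<tau> s' \<Longrightarrow> exec M c s \<tau>' s'' \<Longrightarrow> \<tau>' = \<tau> \<and> s'' = s'"
proof (induction arbitrary: \<tau>' s'' rule: exec.induct)
  case (Skip s) from Skip.prems show ?case by (rule SkipE) simp
next
  case (Assign e s x) from Assign.prems show ?case by (rule AssignE) simp
next
  case (Write e1 s e2 a) from Write.prems show ?case by (rule WriteE) simp
next
  case (Seq c1 s1 \<tau>1 s2 c2 \<tau>2 s3)
  from Seq.prems obtain \<tau>a \<tau>b r where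
    r: "exec M c1 s1 \<tau>a r" "exec M c2 r \<tau>b s''" "\<tau>' = \<tau>a + \<tau>b"
    by (rule SeqE)
  from Seq.IH(1)[OF r(1)] have "\<tau>a = \<tau>1" "r = s2" by simp_all
  with Seq.IH(2)[of \<tau>b s''] r show ?case by simp
next
  case (CondTrue e s c1 \<tau> s' c2)
  from CondTrue.prems obtain \<tau>a where
    "exec M c1 s \<tau>a s''" "\<tau>' = cost e + 1 + \<tau>a"
    by (rule CondE) (use CondTrue.hyps(2) in simp_all)
  with CondTrue.IH[of \<tau>a s''] show ?case by simp
next
  case (CondFalse e s c2 \<tau> s' c1)
  from CondFalse.prems obtain \<tau>a where
    "exec M c2 s \<tau>a s''" "\<tau>' = cost e + 1 + \<tau>a"
    by (rule CondE) (use CondFalse.hyps(2) in simp_all)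
  with CondFalse.IH[of \<tau>a s''] show ?case by simp
next
  case (WhileFalse e s c)
  from WhileFalse.prems show ?case
    by (rule WhileE) (use WhileFalse.hyps(2) in simp_all)
next
  case (WhileTrue e s1 c \<tau>1 s2 \<tau>2 s3)
  from WhileTrue.prems obtain \<tau>a \<tau>b r where
    r: "exec M c s1 \<tau>a r" "exec M (While e c) r \<tau>b s''" "\<tau>' = cost e + 1 + \<tau>a + \<tau>b"
    by (rule WhileE) (use WhileTrue.hyps(2) in simp_all)
  from WhileTrue.IH(1)[OF r(1)] have "\<tau>a = \<tau>1" "r = s2" by simp_all
  with WhileTrue.IH(2)[of \<tau>b s''] r show ?case by simp
qed


section \<open>Encoding of instances\<close>

text \<open>
  The threshold, an arbitrary real, is presented to the machine as the integer \<open>\<lceil>1 / \<epsilon>\<rceil>\<close>. The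
  edges are given by adjacency tables and the strings of a collection are stored one after the
  other. Memory not mentioned here may have arbitrary contents.
\<close>

definition encodes_input ::
    "real \<Rightarrow> bp \<Rightarrow> bool list list \<Rightarrow> bool list list \<Rightarrow> mem \<Rightarrow> bool" where
  "encodes_input \<epsilon> P A B s \<longleftrightarrow>
     regs s ''N'' = length A \<and>
     regs s ''n'' = bp_inputs P \<and>
     regs s ''T'' = bp_length P \<and>
     regs s ''W'' = bp_width P \<and>
     regs s ''inveps'' = nat \<lceil>1 / \<epsilon>\<rceil> \<and>
     (\<forall>i < bp_length P - 1. arrs s ''label'' i = bp_label P i) \<and>
     (\<forall>i < bp_length P - 1. \<forall>u < bp_width P. \<forall>b. \<forall>v < bp_width P.
        arrs s ''edge'' (((i * bp_width P + u) * 2 + of_bool b) * bp_width P + v)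
          = of_bool ((i, u, b, v) \<in> bp_edges P)) \<and>
     (\<forall>k < length A. \<forall>j < bp_inputs P div 2.
        arrs s ''A'' (k * (bp_inputs P div 2) + j) = of_bool (A ! k ! j)) \<and>
     (\<forall>k < length B. \<forall>j < bp_inputs P div 2.
        arrs s ''B'' (k * (bp_inputs P div 2) + j) = of_bool (B ! k ! j))"

text \<open>Tensors are stored one after the other, each in row-major order.\<close>

definition stores_tensors :: "string \<Rightarrow> nat \<Rightarrow> tensor list \<Rightarrow> mem \<Rightarrow> bool" where
  "stores_tensors a t U s \<longleftrightarrow>
     (\<forall>k < length U. \<forall>i. length i = t \<longrightarrow>
        arrs s a (k * 2 ^ t + horner_sum of_bool 2 (rev i)) = of_bool ((U ! k) i))"

definition encodes_output :: "nat \<Rightarrow> tensor list \<Rightarrow> tensor list \<Rightarrow> mem \<Rightarrow> bool" where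
  "encodes_output t U V s \<longleftrightarrow>
     regs s ''t'' = t \<and> stores_tensors ''U'' t U s \<and> stores_tensors ''V'' t V s"

text \<open>
  The number of different words available: polynomial in the parameters of the instance and in the
  tensor size \<open>D\<close>, i.e. words have \<open>O(log n + log N + log T + log W + log (1 / \<epsilon>) + log D)\<close> bits.
\<close>

definition word_bound :: "nat \<Rightarrow> real \<Rightarrow> nat \<Rightarrow> bp \<Rightarrow> nat \<Rightarrow> nat" where
  "word_bound c \<epsilon> N P D =
     (bp_inputs P + N + bp_length P + bp_width P + nat \<lceil>1 / \<epsilon>\<rceil> + D) ^ c"

end

theory Submission
  imports Defs "HOL-Number_Theory.Cong"
begin

text \<open>
  Whether a branching program accepts is the value of a complete NAND tree: Savitch's recursion
  expresses reachability over an interval of layers by an existential choice of a middle node and a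
  universal choice of a half, and a leaf of the resulting tree asks for a single edge, whose variable
  belongs to one of the two strings. The value of the tree is certified by the interactive proof
  behind IP = PSPACE: the truth value at depth \<open>j\<close> is extended to a multilinear polynomial in \<open>j\<close>
  variables over a prime field; it is one minus a product of two values at depth \<open>j + 1\<close>, of degree two
  in each variable, and the degree is brought back to one by linearizing the variables one after the
  other. In each round the prover sends a quadratic polynomial and the verifier a random point; a
  false claim survives a round with probability at most two divided by the number of points. At the
  end the multilinear extension of the leaves must be known at one point, and it is a sum of two
  extensions, each depending on one string only; the prover announces one summand, and each party
  checks its own. The coins of the verifier are the averaged indices of the tensors, the bits of
  the prover the maximized ones, and the entries say whether a party accepts the transcript.
\<close>

section \<open>Averages and maxima over interleaved bits\<close>

text \<open>The similarity multiplies entries with equal index, so the parties cannot communicate: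
  both replay the whole public transcript spelled out by the index, and only the conjunction of
  their verdicts counts. Hence the rounds must not look at the strings; they may enter the last
  check alone. Without the linearizations the degree in each variable would double at every level
  and messages of three coefficients would not do. Savitch's recursion keeps the depth at
  \<open>m = 2 * L * K\<close>, with \<open>L\<close> bits for a node and \<open>K\<close> halvings.
  Depth \<open>j\<close> costs \<open>j\<close> linearizations and one NAND, so there are
  \<open>m * (m + 1) / 2\<close> rounds and the error is at most
  \<open>m * (m + 1) / 2 ^ \<kappa>\<close>. Taking for \<open>2 ^ \<kappa>\<close> the least power
  of two above \<open>m * (m + 1) * \<lceil>1 / \<epsilon>\<rceil>\<close>, the order
  \<open>t\<close> is a constant times \<open>m ^ 2 * \<kappa>\<close>. The time bound knows the
  program through \<open>D\<close> only, so the parameters, the prime and the table of leaves must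
  all be computable in time polynomial in \<open>D\<close>. And for \<open>T = W = 2\<close>,
  \<open>\<epsilon> = 1\<close> the bound on \<open>t\<close> is 0: the tensors must then have a
  single entry. This corner is the source of the side cases \<open>K = 0\<close> and
  \<open>\<kappa> = 0\<close>.\<close>

lemma mean_max_mono:
  assumes "\<And>i. length i = t \<Longrightarrow> g i \<le> h i"
  shows "mean_max e t g \<le> mean_max e t h"
  using assms
proof (induction e t g arbitrary: h rule: mean_max.induct)
  case (2 t g)
  have "mean_max False t (\<lambda>i. g (b # i)) \<le> mean_max False t (\<lambda>i. h (b # i))" for b
    using 2 by (cases b) simp_all
  from this[of False] this[of True] show ?case by simp
next
  case (3 t g)
  have "mean_max True t (\<lambda>i. g (b # i)) \<le> mean_max True t (\<lambda>i. h (b # i))" for b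
    using 3 by (cases b) simp_all
  from this[of False] this[of True] show ?case by (auto intro: max.mono simp del: max.bounded_iff)
qed simp

lemma mean_max_cong:
  assumes "\<And>i. length i = t \<Longrightarrow> g i = h i"
  shows "mean_max e t g = mean_max e t h"
  using assms by (intro antisym mean_max_mono) auto

lemma mean_max_const [simp]: "mean_max e t (\<lambda>_. c) = c"
  by (induction e t "\<lambda>_::bool list. c" rule: mean_max.induct) auto

lemma mean_max_le:
  assumes "\<And>i. length i = t \<Longrightarrow> g i \<le> c"
  shows "mean_max e t g \<le> c"
  using mean_max_mono[of t g "\<lambda>_. c" e] assms by simp

text \<open>The prefix has even length, so the alternation restarts behind it with an average; this
  is what allows an index to be cut into messages.\<close>

lemma mean_max_append:
  "mean_max True (2 * n + t) g = mean_max True (2 * n) (\<lambda>i. mean_max True t (\<lambda>j. g (i @ j)))"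
  by (induction n arbitrary: g) auto

text \<open>
  \<open>read_bits e n x bs\<close> appends to the binary number \<open>x\<close> the \<open>n\<close> averaged (\<open>e\<close>) or maximized
  (\<open>\<not> e\<close>) bits among the first \<open>2 * n\<close> entries of the index \<open>bs\<close>.
\<close>

fun read_bits :: "bool \<Rightarrow> nat \<Rightarrow> nat \<Rightarrow> bool list \<Rightarrow> nat" where
  "read_bits e 0 x bs = x"
| "read_bits e (Suc n) x bs =
     read_bits e n (2 * x + of_bool (bs ! (if e then 0 else 1))) (drop 2 bs)"

lemma read_bits_append:
  "2 * n \<le> length i \<Longrightarrow> read_bits e n x (i @ j) = read_bits e n x i"
  by (induction e n x i arbitrary: j rule: read_bits.induct) (auto simp: nth_append)

lemma read_bits_less: "read_bits e n x bs < (x + 1) * 2 ^ n"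
proof (induction e n x bs rule: read_bits.induct)
  case (2 e n x bs)
  let ?x = "2 * x + of_bool (bs ! (if e then 0 else 1))"
  have "read_bits e (Suc n) x bs < (?x + 1) * 2 ^ n" using 2 by simp
  also have "\<dots> \<le> (2 * x + 2) * 2 ^ n" by (intro mult_right_mono) auto
  finally show ?case by (simp add: algebra_simps)
qed simp

text \<open>\<open>h\<close> ignores the maximized bits between the coins, so their maxima are
  vacuous and a uniform mean is left.\<close>

lemma mean_max_read_mean:
  "mean_max True (2 * n) (\<lambda>i. h (read_bits True n x i)) = (\<Sum>y<2 ^ n. h (x * 2 ^ n + y)) / 2 ^ n"
proof (induction n arbitrary: x)
  case (Suc n)
  have "(\<Sum>y<2 ^ Suc n. h (x * 2 ^ Suc n + y)) =
      (\<Sum>y<2 ^ n. h (x * 2 ^ Suc n + y)) + (\<Sum>y<2 ^ n. h (x * 2 ^ Suc n + (2 ^ n + y)))"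
    using sum.atLeastLessThan_concat[of 0 "2 ^ n" "2 ^ Suc n" "\<lambda>y. h (x * 2 ^ Suc n + y)"]
      sum.shift_bounds_nat_ivl[of "\<lambda>y. h (x * 2 ^ Suc n + y)" 0 "2 ^ n" "2 ^ n"]
    by (simp add: lessThan_atLeast0 add.commute mult_2)
  then show ?case
    using Suc[of "2 * x"] Suc[of "Suc (2 * x)"] by (simp add: algebra_simps field_simps)
qed simp

text \<open>The averages between the maximized bits are vacuous, and the bits can be steered to any
  \<open>y\<close>. Upper bounds on the prover come from \<open>mean_max_le\<close> instead.\<close>

lemma mean_max_read_max_ge:
  "y < 2 ^ n \<Longrightarrow> h (x * 2 ^ n + y) \<le> mean_max True (2 * n) (\<lambda>i. h (read_bits False n x i))"
proof (induction n arbitrary: x y)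
  case (Suc n)
  let ?m = "\<lambda>x. mean_max True (2 * n) (\<lambda>i. h (read_bits False n x i))"
  have "h (x * 2 ^ Suc n + y) \<le> max (?m (2 * x)) (?m (Suc (2 * x)))"
  proof (cases "y < 2 ^ n")
    case True
    with Suc.IH[of y "2 * x"] show ?thesis by (simp add: algebra_simps le_max_iff_disj)
  next
    case False
    then have "y - 2 ^ n < 2 ^ n" using Suc.prems by simp
    from Suc.IH[OF this, of "Suc (2 * x)"] False show ?thesis
      by (simp add: algebra_simps le_max_iff_disj)
  qed
  then show ?case by simp
qed simp

section \<open>The interactive proof for NAND trees\<close>

text \<open>Polynomials are handled as functions over the integers; a degree bound speaks about the
  restrictions to axis-parallel lines, which is all that a round looks at. The coefficients may
  depend on the other coordinates.\<close>

definition affine_in :: "nat \<Rightarrow> ((nat \<Rightarrow> int) \<Rightarrow> int) \<Rightarrow> bool" where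
  "affine_in k F \<longleftrightarrow> (\<forall>r. \<exists>a b. \<forall>x. F (r(k := x)) = a + b * x)"

definition quadratic_in :: "nat \<Rightarrow> ((nat \<Rightarrow> int) \<Rightarrow> int) \<Rightarrow> bool" where
  "quadratic_in k F \<longleftrightarrow> (\<forall>r. \<exists>a b c. \<forall>x. F (r(k := x)) = a + b * x + c * x\<^sup>2)"

lemma affine_in_imp_quadratic_in: "affine_in k F \<Longrightarrow> quadratic_in k F"
  unfolding affine_in_def quadratic_in_def by (metis add.right_neutral mult_zero_left)

text \<open>
  The polynomials of the protocol: with \<open>n\<close> rounds left, the current polynomial arises from the next
  one by linearizing variable \<open>i\<close> (if \<open>i < j\<close>) or by eliminating variable \<open>i = j\<close> with a NAND.
\<close>

fun protocol_poly ::
    "((nat \<Rightarrow> int) \<Rightarrow> int) \<Rightarrow> nat \<Rightarrow> nat \<Rightarrow> nat \<Rightarrow> (nat \<Rightarrow> int) \<Rightarrow> int" where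
  "protocol_poly F 0 j i r = F r"
| "protocol_poly F (Suc n) j i r =
     (if i < j
      then (1 - r i) * protocol_poly F n j (Suc i) (r(i := 0))
         + r i * protocol_poly F n j (Suc i) (r(i := 1))
      else 1 - protocol_poly F n (Suc j) 0 (r(i := 0)) * protocol_poly F n (Suc j) 0 (r(i := 1)))"

text \<open>For \<open>i = k\<close> the result interpolates between two values that do not depend
  on variable \<open>k\<close>, so it is affine for any \<open>F\<close>. In another direction it
  combines two affine restrictions with weights free of \<open>k\<close>.\<close>

lemma affine_in_linearize:
  assumes "i = k \<or> affine_in k F"
  shows "affine_in k (\<lambda>r. (1 - r i) * F (r(i := 0)) + r i * F (r(i := 1)))"
  unfolding affine_in_def
proof
  fix r :: "nat \<Rightarrow> int"
  show "\<exists>a b. \<forall>x. (1 - (r(k := x)) i) * F ((r(k := x))(i := 0))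
      + (r(k := x)) i * F ((r(k := x))(i := 1)) = a + b * x"
  proof (cases "i = k")
    case True
    show ?thesis
      by (rule exI[of _ "F (r(k := 0))"], rule exI[of _ "F (r(k := 1)) - F (r(k := 0))"])
        (simp add: True algebra_simps)
  next
    case False
    then have "affine_in k F" using assms by simp
    then obtain a0 b0 a1 b1 where
      "\<forall>x. F ((r(i := 0))(k := x)) = a0 + b0 * x" "\<forall>x. F ((r(i := 1))(k := x)) = a1 + b1 * x"
      unfolding affine_in_def by metis
    then show ?thesis
      by (intro exI[of _ "(1 - r i) * a0 + r i * a1"] exI[of _ "(1 - r i) * b0 + r i * b1"])
        (use False in \<open>simp add: fun_upd_twist algebra_simps\<close>)
  qed
qed

lemma quadratic_in_linearize:
  assumes "i \<noteq> k" "quadratic_in k F"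
  shows "quadratic_in k (\<lambda>r. (1 - r i) * F (r(i := 0)) + r i * F (r(i := 1)))"
  unfolding quadratic_in_def
proof
  fix r :: "nat \<Rightarrow> int"
  obtain a0 b0 c0 a1 b1 c1 where
    "\<forall>x. F ((r(i := 0))(k := x)) = a0 + b0 * x + c0 * x\<^sup>2"
    "\<forall>x. F ((r(i := 1))(k := x)) = a1 + b1 * x + c1 * x\<^sup>2"
    using assms(2) unfolding quadratic_in_def by metis
  then show "\<exists>a b c. \<forall>x. (1 - (r(k := x)) i) * F ((r(k := x))(i := 0))
      + (r(k := x)) i * F ((r(k := x))(i := 1)) = a + b * x + c * x\<^sup>2"
    by (intro exI[of _ "(1 - r i) * a0 + r i * a1"] exI[of _ "(1 - r i) * b0 + r i * b1"]
        exI[of _ "(1 - r i) * c0 + r i * c1"])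
      (use assms(1) in \<open>simp add: fun_upd_twist algebra_simps\<close>)
qed

lemma quadratic_in_nand:
  assumes "i \<noteq> k" "affine_in k F"
  shows "quadratic_in k (\<lambda>r. 1 - F (r(i := 0)) * F (r(i := 1)))"
  unfolding quadratic_in_def
proof
  fix r :: "nat \<Rightarrow> int"
  obtain a0 b0 a1 b1 where
    "\<forall>x. F ((r(i := 0))(k := x)) = a0 + b0 * x" "\<forall>x. F ((r(i := 1))(k := x)) = a1 + b1 * x"
    using assms(2) unfolding affine_in_def by metis
  then show "\<exists>a b c. \<forall>x. 1 - F ((r(k := x))(i := 0)) * F ((r(k := x))(i := 1))
      = a + b * x + c * x\<^sup>2"
    by (intro exI[of _ "1 - a0 * a1"] exI[of _ "- (a0 * b1 + a1 * b0)"] exI[of _ "- (b0 * b1)"])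
      (use assms(1) in \<open>simp add: fun_upd_twist algebra_simps power2_eq_square\<close>)
qed

text \<open>Seen from the leaves, a NAND makes the surviving variables quadratic, and the
  linearizations then remove the squares from variable \<open>j - 1\<close> down to variable 0. So
  with \<open>i\<close> the next variable to be linearized by the verifier, only those below
  \<open>i\<close> can still be quadratic; at \<open>i = 0\<close> all are affine, as the next NAND
  requires.\<close>

lemma protocol_poly_degrees:
  assumes "\<And>k. affine_in k F" "i \<le> j"
  shows "(\<forall>k. i \<le> k \<and> k < j \<longrightarrow> affine_in k (protocol_poly F n j i)) \<and>
    (\<forall>k < i. quadratic_in k (protocol_poly F n j i))"
  using assms(2)
proof (induction n arbitrary: j i)
  case 0
  have "protocol_poly F 0 j i = F" by (rule ext) simp
  then show ?case using assms(1) affine_in_imp_quadratic_in by simp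
next
  case (Suc n)
  show ?case
  proof (cases "i < j")
    case True
    let ?G = "protocol_poly F n j (Suc i)"
    have eq: "protocol_poly F (Suc n) j i = (\<lambda>r. (1 - r i) * ?G (r(i := 0)) + r i * ?G (r(i := 1)))"
      using True by (intro ext) simp
    show ?thesis
    proof (unfold eq, intro conjI allI impI)
      fix k assume "i \<le> k \<and> k < j"
      then show "affine_in k (\<lambda>r. (1 - r i) * ?G (r(i := 0)) + r i * ?G (r(i := 1)))"
        using Suc.IH[of "Suc i" j] True by (intro affine_in_linearize) (cases "i = k", auto)
    next
      fix k assume "k < i"
      then show "quadratic_in k (\<lambda>r. (1 - r i) * ?G (r(i := 0)) + r i * ?G (r(i := 1)))"
        using Suc.IH[of "Suc i" j] True by (intro quadratic_in_linearize) auto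
    qed
  next
    case False
    let ?G = "protocol_poly F n (Suc j) 0"
    have eq: "protocol_poly F (Suc n) j i = (\<lambda>r. 1 - ?G (r(i := 0)) * ?G (r(i := 1)))"
      using False by (intro ext) simp
    show ?thesis
      unfolding eq using Suc.IH[of 0 "Suc j"] False Suc.prems
      by (auto intro!: quadratic_in_nand)
  qed
qed

text \<open>What a round tests: on the line through \<open>r\<close> in direction \<open>i\<close>
  the next polynomial is a quadratic with value \<open>a\<close> at 0 and \<open>a + b + c\<close>
  at 1, and the current value is the interpolation or the NAND of these two.\<close>

lemma protocol_poly_round:
  assumes "\<And>k. affine_in k F" "i \<le> j"
  obtains a b c where
    "\<And>x. protocol_poly F n (if i < j then j else Suc j) (if i < j then Suc i else 0) (r(i := x))
      = a + b * x + c * x\<^sup>2"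
    "protocol_poly F (Suc n) j i r = (if i < j then a + r i * (b + c) else 1 - a * (a + b + c))"
proof -
  let ?G = "protocol_poly F n (if i < j then j else Suc j) (if i < j then Suc i else 0)"
  have "quadratic_in i ?G"
  proof (cases "i < j")
    case True
    then show ?thesis using protocol_poly_degrees[of F "Suc i" j n, OF assms(1)] by simp
  next
    case False
    then show ?thesis
      using protocol_poly_degrees[of F 0 "Suc j" n, OF assms(1)] assms(2)
      by (auto intro: affine_in_imp_quadratic_in)
  qed
  then obtain a b c where abc: "\<And>x. ?G (r(i := x)) = a + b * x + c * x\<^sup>2"
    unfolding quadratic_in_def by metis
  show thesis
    by (rule that[OF abc]) (use abc[of 0] abc[of 1] in \<open>auto simp: algebra_simps split: if_splits\<close>)
qed

text \<open>Divided differences at three roots: the first ones eliminate \<open>a\<close>, the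
  second one eliminates \<open>b\<close> and shows that \<open>p\<close> divides \<open>c\<close>,
  and then also \<open>b\<close> and \<open>a\<close>. The bound \<open>S \<le> p\<close> makes
  distinct points incongruent, so that their differences can be cancelled.\<close>

lemma card_quadratic_roots_mod_prime:
  fixes a b c :: int
  assumes p: "prime p" and S: "S \<le> p" and nz: "\<not> (int p dvd a \<and> int p dvd b \<and> int p dvd c)"
  shows "card {x \<in> {..<S}. int p dvd a + b * int x + c * (int x)\<^sup>2} \<le> 2"
proof (rule ccontr)
  let ?B = "{x \<in> {..<S}. int p dvd a + b * int x + c * (int x)\<^sup>2}"
  assume "\<not> card ?B \<le> 2"
  then have "3 \<le> card ?B" by simp
  then obtain B where "B \<subseteq> ?B" "card B = 3" by (meson obtain_subset_with_card_n)
  then obtain x y z where xyz: "{x, y, z} \<subseteq> ?B" "x \<noteq> y" "y \<noteq> z" "x \<noteq> z"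
    by (auto simp: card_3_iff)
  have ip: "prime (int p)" using p by simp
  have ndvd: "\<not> int p dvd int u - int w" if "u \<in> ?B" "w \<in> ?B" "u \<noteq> w" for u w
  proof
    assume "int p dvd int u - int w"
    then have "int p \<le> \<bar>int u - int w\<bar>" using that(3) using dvd_imp_le_int[of "int u - int w" "int p"] by auto
    then show False using that S by auto
  qed
  have *: "int p dvd b + c * (int u + int w)" if "u \<in> ?B" "w \<in> ?B" "u \<noteq> w" for u w
  proof -
    have "int p dvd (a + b * int u + c * (int u)\<^sup>2) - (a + b * int w + c * (int w)\<^sup>2)"
      using that by (intro dvd_diff) auto
    also have "\<dots> = (int u - int w) * (b + c * (int u + int w))"
      by (simp add: algebra_simps power2_eq_square)
    finally show ?thesis using ndvd[OF that] ip prime_dvd_multD by blast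
  qed
  have "int p dvd (b + c * (int x + int y)) - (b + c * (int x + int z))"
    using xyz by (intro dvd_diff *) auto
  also have "\<dots> = (int y - int z) * c" by (simp add: algebra_simps)
  finally have c: "int p dvd c" using ndvd[of y z] xyz ip prime_dvd_multD by blast
  have "int p dvd b + c * (int x + int y)" using xyz by (intro *) auto
  with c have b: "int p dvd b" by (metis dvd_add_left_iff dvd_mult2)
  have "int p dvd a + (b * int x + c * (int x)\<^sup>2)" using xyz by (simp add: add.assoc)
  moreover have "int p dvd b * int x + c * (int x)\<^sup>2" using b c by simp
  ultimately have "int p dvd a" by (metis dvd_add_left_iff)
  with nz b c show False by simp
qed

section \<open>The verifier's tests and the value of the game\<close>

text \<open>A round occupies \<open>6 * \<mu> + 2 * \<kappa>\<close> bits: three coefficients, then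
  the random point, every second bit being skipped. The NAND test is written as
  \<open>v + a * (a + b + c)\<close> being 1 in order to stay in the naturals. Messages are read
  behind a leading 1. Modulo \<open>p\<close> this is only a shift; but for \<open>\<mu> = 0\<close>
  the sole message is then 1 rather than 0, the correct last message when the tree is a single true
  leaf.\<close>

fun verdict ::
    "nat \<Rightarrow> nat \<Rightarrow> nat \<Rightarrow> ((nat \<Rightarrow> nat) \<Rightarrow> nat \<Rightarrow> nat \<Rightarrow> bool) \<Rightarrow> nat \<Rightarrow> nat \<Rightarrow> nat \<Rightarrow>
      (nat \<Rightarrow> nat) \<Rightarrow> nat \<Rightarrow> bool list \<Rightarrow> bool" where
  "verdict p \<kappa> \<mu> fin 0 j i r v bs = fin r v (read_bits False \<mu> 1 bs)"
| "verdict p \<kappa> \<mu> fin (Suc n) j i r v bs =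
     (let a = read_bits False \<mu> 1 bs;
          b = read_bits False \<mu> 1 (drop (2 * \<mu>) bs);
          c = read_bits False \<mu> 1 (drop (4 * \<mu>) bs);
          x = read_bits True \<kappa> 0 (drop (6 * \<mu>) bs)
      in (if i < j then (a + r i * (b + c)) mod p = v else (v + a * (a + b + c)) mod p = 1) \<and>
         verdict p \<kappa> \<mu> fin n (if i < j then j else Suc j) (if i < j then Suc i else 0)
           (r(i := x)) ((a + x * (b + x * c)) mod p) (drop (6 * \<mu> + 2 * \<kappa>) bs))"

text \<open>The round tests are common to both parties and only the last check differs. Hence the
  product of two tensor entries is again the verdict of one game, whose last check is the
  conjunction.\<close>

lemma verdict_conj:
  "verdict p \<kappa> \<mu> (\<lambda>r v \<alpha>. fin r v \<alpha> \<and> fin' r v \<alpha>) n j i r v bs \<longleftrightarrow>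
    verdict p \<kappa> \<mu> fin n j i r v bs \<and> verdict p \<kappa> \<mu> fin' n j i r v bs"
proof (induction n arbitrary: j i r v bs)
  case (Suc n)
  show ?case unfolding verdict.simps Let_def Suc by blast
qed simp

definition game_value ::
    "nat \<Rightarrow> nat \<Rightarrow> nat \<Rightarrow> ((nat \<Rightarrow> nat) \<Rightarrow> nat \<Rightarrow> nat \<Rightarrow> bool) \<Rightarrow> nat \<Rightarrow> nat \<Rightarrow> nat \<Rightarrow>
      (nat \<Rightarrow> nat) \<Rightarrow> nat \<Rightarrow> real" where
  "game_value p \<kappa> \<mu> fin n j i r v =
     mean_max True (n * (6 * \<mu> + 2 * \<kappa>) + 2 * \<mu>) (\<lambda>bs. of_bool (verdict p \<kappa> \<mu> fin n j i r v bs))"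

definition max_read :: "nat \<Rightarrow> (nat \<Rightarrow> real) \<Rightarrow> real" where
  "max_read \<mu> h = mean_max True (2 * \<mu>) (\<lambda>i. h (read_bits False \<mu> 1 i))"

lemma max_read_le: "(\<And>y. h y \<le> c) \<Longrightarrow> max_read \<mu> h \<le> c"
  unfolding max_read_def by (rule mean_max_le)

text \<open>Since \<open>p \<le> 2 ^ \<mu>\<close>, the numbers with leading bit
  \<open>2 ^ \<mu>\<close> meet every residue class, so the prover can announce any residue
  \<open>z\<close>. It controls the class but not the representative, whence the assumption on all
  \<open>y\<close> in the class.\<close>

lemma max_read_ge: 
  assumes "0 < p" "p \<le> 2 ^ \<mu>" "\<And>y. [int y = z] (mod int p) \<Longrightarrow> c \<le> h y"
  shows "c \<le> max_read \<mu> h"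
proof -
  \<comment> \<open>The number read is \<open>2 ^ \<mu> + y\<close> because of the leading 1; the
    shift is undone here.\<close>
  define y where "y = nat ((z - 2 ^ \<mu>) mod int p)"
  have y: "int y = (z - 2 ^ \<mu>) mod int p" using assms(1) by (simp add: y_def)
  have "int y < int p" using assms(1) by (simp add: y)
  then have "y < 2 ^ \<mu>" using assms(2) by simp
  moreover have "[int (1 * 2 ^ \<mu> + y) = z] (mod int p)"
    by (simp add: y cong_def mod_simps)
  ultimately show ?thesis
    unfolding max_read_def using mean_max_read_max_ge[of y \<mu> h 1] assms(3) order_trans by blast
qed

lemma game_value_0: "game_value p \<kappa> \<mu> fin 0 j i r v = max_read \<mu> (\<lambda>\<alpha>. of_bool (fin r v \<alpha>))"
  by (simp add: game_value_def max_read_def)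

lemma game_value_le_1: "game_value p \<kappa> \<mu> fin n j i r v \<le> 1"
  unfolding game_value_def by (rule mean_max_le) simp

text \<open>Cutting the index into blocks of even length turns a round into three maxima followed by
  a mean. The coefficients are fixed before the point \<open>x\<close> is drawn, so the test does
  not depend on \<open>x\<close> and leaves the mean as a factor.\<close>

lemma game_value_Suc:
  "game_value p \<kappa> \<mu> fin (Suc n) j i r v =
    max_read \<mu> (\<lambda>a. max_read \<mu> (\<lambda>b. max_read \<mu> (\<lambda>c.
      of_bool (if i < j then (a + r i * (b + c)) mod p = v else (v + a * (a + b + c)) mod p = 1) *
      ((\<Sum>x<2 ^ \<kappa>. game_value p \<kappa> \<mu> fin n (if i < j then j else Suc j) (if i < j then Suc i else 0)
         (r(i := x)) ((a + x * (b + x * c)) mod p)) / 2 ^ \<kappa>))))"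
proof -
  let ?rest = "n * (6 * \<mu> + 2 * \<kappa>) + 2 * \<mu>"
  have len: "Suc n * (6 * \<mu> + 2 * \<kappa>) + 2 * \<mu> = 2 * \<mu> + (2 * \<mu> + (2 * \<mu> + (2 * \<kappa> + ?rest)))"
    by (simp add: algebra_simps)
  let ?chk = "\<lambda>a b c. if i < j then (a + r i * (b + c)) mod p = v else (v + a * (a + b + c)) mod p = 1"
  let ?next = "\<lambda>a b c x. game_value p \<kappa> \<mu> fin n (if i < j then j else Suc j) (if i < j then Suc i else 0)
         (r(i := x)) ((a + x * (b + x * c)) mod p)"
  have mean: "mean_max True (2 * \<kappa>) (\<lambda>X. of_bool (?chk a b c) * ?next a b c (read_bits True \<kappa> 0 X))
      = of_bool (?chk a b c) * ((\<Sum>x<2 ^ \<kappa>. ?next a b c x) / 2 ^ \<kappa>)" for a b c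
    using mean_max_read_mean[of \<kappa> "\<lambda>x. of_bool (?chk a b c) * ?next a b c x" 0]
    by (simp only: mult_0 add_0 sum_distrib_left[symmetric] times_divide_eq_right)
  have "game_value p \<kappa> \<mu> fin (Suc n) j i r v =
    mean_max True (2 * \<mu>) (\<lambda>A. mean_max True (2 * \<mu>) (\<lambda>B. mean_max True (2 * \<mu>) (\<lambda>C.
      mean_max True (2 * \<kappa>) (\<lambda>X. mean_max True ?rest (\<lambda>bs.
        of_bool (verdict p \<kappa> \<mu> fin (Suc n) j i r v (A @ B @ C @ X @ bs)))))))"
    unfolding game_value_def len by (simp only: mean_max_append append_assoc)
  also have "\<dots> = mean_max True (2 * \<mu>) (\<lambda>A. mean_max True (2 * \<mu>) (\<lambda>B. mean_max True (2 * \<mu>) (\<lambda>C.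
      mean_max True (2 * \<kappa>) (\<lambda>X.
        of_bool (?chk (read_bits False \<mu> 1 A) (read_bits False \<mu> 1 B) (read_bits False \<mu> 1 C)) *
        ?next (read_bits False \<mu> 1 A) (read_bits False \<mu> 1 B) (read_bits False \<mu> 1 C)
          (read_bits True \<kappa> 0 X)))))"
    (is "_ = mean_max _ _ (\<lambda>A. mean_max _ _ (\<lambda>B. mean_max _ _ (\<lambda>C. mean_max _ _ (\<lambda>X. ?h A B C X))))")
  proof (intro mean_max_cong)
    fix A B C X :: "bool list"
    assume l: "length A = 2 * \<mu>" "length B = 2 * \<mu>" "length C = 2 * \<mu>" "length X = 2 * \<kappa>"
    have "verdict p \<kappa> \<mu> fin (Suc n) j i r v (A @ B @ C @ X @ bs) \<longleftrightarrow>
      ?chk (read_bits False \<mu> 1 A) (read_bits False \<mu> 1 B) (read_bits False \<mu> 1 C) \<and>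
      verdict p \<kappa> \<mu> fin n (if i < j then j else Suc j) (if i < j then Suc i else 0)
        (r(i := read_bits True \<kappa> 0 X))
        ((read_bits False \<mu> 1 A + read_bits True \<kappa> 0 X *
          (read_bits False \<mu> 1 B + read_bits True \<kappa> 0 X * read_bits False \<mu> 1 C)) mod p) bs" for bs
      using l by (simp add: Let_def read_bits_append)
    then show "mean_max True ?rest (\<lambda>bs. of_bool (verdict p \<kappa> \<mu> fin (Suc n) j i r v (A @ B @ C @ X @ bs)))
      = ?h A B C X"
      by (cases "?chk (read_bits False \<mu> 1 A) (read_bits False \<mu> 1 B) (read_bits False \<mu> 1 C)")
        (simp_all add: game_value_def)
  qed
  also have "\<dots> = max_read \<mu> (\<lambda>a. max_read \<mu> (\<lambda>b. max_read \<mu> (\<lambda>c.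
      mean_max True (2 * \<kappa>) (\<lambda>X. of_bool (?chk a b c) * ?next a b c (read_bits True \<kappa> 0 X)))))"
    by (simp only: max_read_def)
  also have "max_read \<mu> (\<lambda>a. max_read \<mu> (\<lambda>b. max_read \<mu> (\<lambda>c.
      mean_max True (2 * \<kappa>) (\<lambda>X. of_bool (?chk a b c) * ?next a b c (read_bits True \<kappa> 0 X)))))
    = max_read \<mu> (\<lambda>a. max_read \<mu> (\<lambda>b. max_read \<mu> (\<lambda>c.
      of_bool (?chk a b c) * ((\<Sum>x<2 ^ \<kappa>. ?next a b c x) / 2 ^ \<kappa>))))"
    by (simp only: mean)
  finally show ?thesis .
qed

definition int_vec :: "(nat \<Rightarrow> nat) \<Rightarrow> nat \<Rightarrow> int" where
  "int_vec r k = int (r k)"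

lemma int_vec_upd: "int_vec (r(i := x)) = (int_vec r)(i := int x)"
  by (auto simp: int_vec_def)

lemma mod_eq_iff_cong_int:
  assumes "v < p"
  shows "y mod p = v \<longleftrightarrow> [int y = int v] (mod int p)"
  using assms unfolding cong_int_iff by (simp add: unique_euclidean_semiring_class.cong_def)

text \<open>The honest prover sends the coefficients of the true restriction; then every test passes
  and the new claim is true for every random point. Only residues can be prescribed, so
  \<open>fin\<close> has to accept a whole residue class of last messages.\<close>

theorem game_value_complete:
  assumes "1 < p" "p \<le> 2 ^ \<mu>" "\<And>k. affine_in k F"
    and fin: "\<And>r v. v < p \<Longrightarrow> [int v = F (int_vec r)] (mod int p) \<Longrightarrow>
      \<exists>z. \<forall>\<alpha>. [int \<alpha> = z] (mod int p) \<longrightarrow> fin r v \<alpha>"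
    and "i \<le> j" "v < p" "[int v = protocol_poly F n j i (int_vec r)] (mod int p)"
  shows "game_value p \<kappa> \<mu> fin n j i r v = 1"
proof (rule antisym[OF game_value_le_1])
  have p0: "0 < p" using assms(1) by simp
  show "1 \<le> game_value p \<kappa> \<mu> fin n j i r v"
    using assms(5-7)
  proof (induction n arbitrary: j i r v)
    case 0
    then obtain z where "\<forall>\<alpha>. [int \<alpha> = z] (mod int p) \<longrightarrow> fin r v \<alpha>" using fin[of v r] by auto
    then show ?case
      unfolding game_value_0 by (intro max_read_ge[OF p0 assms(2), of z]) auto
  next
    case (Suc n)
    obtain a' b' c' where
      G: "\<And>x. protocol_poly F n (if i < j then j else Suc j) (if i < j then Suc i else 0)
        ((int_vec r)(i := x)) = a' + b' * x + c' * x\<^sup>2" and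
      V: "protocol_poly F (Suc n) j i (int_vec r)
        = (if i < j then a' + int_vec r i * (b' + c') else 1 - a' * (a' + b' + c'))"
      using protocol_poly_round[of F i j n "int_vec r", OF assms(3) Suc.prems(1)] by blast
    note cv = Suc.prems(3)[unfolded V]
    show ?case
      unfolding game_value_Suc
    proof (intro max_read_ge[OF p0 assms(2)])
      fix a b c
      assume abc: "[int a = a'] (mod int p)" "[int b = b'] (mod int p)" "[int c = c'] (mod int p)"
      have chk: "if i < j then (a + r i * (b + c)) mod p = v else (v + a * (a + b + c)) mod p = 1"
      proof (cases "i < j")
        case True
        have "[int a + int (r i) * (int b + int c) = a' + int_vec r i * (b' + c')] (mod int p)"
          unfolding int_vec_def using abc by (intro cong_add cong_mult) auto
        also have "[a' + int_vec r i * (b' + c') = int v] (mod int p)"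
          using cv True by (simp add: cong_sym)
        finally show ?thesis using True Suc.prems(2) by (simp add: mod_eq_iff_cong_int)
      next
        case False
        have "[int v + int a * (int a + int b + int c)
            = (1 - a' * (a' + b' + c')) + a' * (a' + b' + c')] (mod int p)"
          using abc cv False by (intro cong_add cong_mult) auto
        then have "[int (v + a * (a + b + c)) = int 1] (mod int p)" by simp
        then show ?thesis using False assms(1) by (simp only: mod_eq_iff_cong_int if_False)
      qed
      have "1 \<le> game_value p \<kappa> \<mu> fin n (if i < j then j else Suc j) (if i < j then Suc i else 0)
         (r(i := x)) ((a + x * (b + x * c)) mod p)" for x
      proof (rule Suc.IH)
        have "[int a + int x * (int b + int x * int c) = a' + int x * (b' + int x * c')] (mod int p)"
          using abc by (intro cong_add cong_mult) auto
        then show "[int ((a + x * (b + x * c)) mod p) =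
          protocol_poly F n (if i < j then j else Suc j) (if i < j then Suc i else 0)
          (int_vec (r(i := x)))] (mod int p)"
          unfolding int_vec_upd G by (simp add: zmod_int cong_def algebra_simps power2_eq_square)
      qed (use Suc.prems p0 in auto)
      then have "(\<Sum>x<2 ^ \<kappa> :: nat. 1) \<le> (\<Sum>x<2 ^ \<kappa>. game_value p \<kappa> \<mu> fin n (if i < j then j else Suc j)
        (if i < j then Suc i else 0) (r(i := x)) ((a + x * (b + x * c)) mod p))"
        by (intro sum_mono) auto
      then show "1 \<le> of_bool (if i < j then (a + r i * (b + c)) mod p = v
          else (v + a * (a + b + c)) mod p = 1) *
        ((\<Sum>x<2 ^ \<kappa>. game_value p \<kappa> \<mu> fin n (if i < j then j else Suc j) (if i < j then Suc i else 0)
         (r(i := x)) ((a + x * (b + x * c)) mod p)) / 2 ^ \<kappa>)"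
        unfolding of_bool_eq_1_iff[THEN iffD2, OF chk] by simp
    qed
  qed
qed

text \<open>If the claim is false and the test passes, the announced quadratic differs from the true
  one modulo \<open>p\<close>. They agree in at most two points; any other point leaves a false
  claim for the remaining rounds. The errors of the rounds add up.\<close>

theorem game_value_sound:
  assumes "prime p" "2 ^ \<kappa> \<le> p" "\<And>k. affine_in k F"
    and fin: "\<And>r v \<alpha>. v < p \<Longrightarrow> \<not> [int v = F (int_vec r)] (mod int p) \<Longrightarrow> \<not> fin r v \<alpha>"
    and "i \<le> j" "v < p" "\<not> [int v = protocol_poly F n j i (int_vec r)] (mod int p)"
  shows "game_value p \<kappa> \<mu> fin n j i r v \<le> 2 * real n / 2 ^ \<kappa>"
  using assms(5-7)
proof (induction n arbitrary: j i r v)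
  case 0
  then show ?case
    unfolding game_value_0 by (intro max_read_le) (use fin in auto)
next
  case (Suc n)
  have p1: "1 < p" using assms(1) prime_gt_1_nat by blast
  obtain a' b' c' where
    G: "\<And>x. protocol_poly F n (if i < j then j else Suc j) (if i < j then Suc i else 0)
      ((int_vec r)(i := x)) = a' + b' * x + c' * x\<^sup>2" and
    V: "protocol_poly F (Suc n) j i (int_vec r)
      = (if i < j then a' + int_vec r i * (b' + c') else 1 - a' * (a' + b' + c'))"
    using protocol_poly_round[of F i j n "int_vec r", OF assms(3) Suc.prems(1)] by blast
  note cv = Suc.prems(3)[unfolded V]
  show ?case
    unfolding game_value_Suc
  proof (intro max_read_le)
    fix a b c
    let ?chk = "if i < j then (a + r i * (b + c)) mod p = v else (v + a * (a + b + c)) mod p = 1"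
    let ?next = "\<lambda>x. game_value p \<kappa> \<mu> fin n (if i < j then j else Suc j) (if i < j then Suc i else 0)
         (r(i := x)) ((a + x * (b + x * c)) mod p)"
    show "of_bool ?chk * ((\<Sum>x<2 ^ \<kappa>. ?next x) / 2 ^ \<kappa>) \<le> 2 * real (Suc n) / 2 ^ \<kappa>"
    proof (cases ?chk)
      case chk: True
      \<comment> \<open>The points at which a wrong quadratic happens to take the right value, so
        that the next claim becomes true.\<close>
      define Bad where "Bad = {x \<in> {..<2 ^ \<kappa>}.
        int p dvd (int a - a') + (int b - b') * int x + (int c - c') * (int x)\<^sup>2}"
      \<comment> \<open>Correct coefficients that pass the test would make the claim
        \<open>v\<close> true.\<close>
      have "\<not> (int p dvd int a - a' \<and> int p dvd int b - b' \<and> int p dvd int c - c')"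
      proof
        assume "int p dvd int a - a' \<and> int p dvd int b - b' \<and> int p dvd int c - c'"
        then have abc: "[int a = a'] (mod int p)" "[int b = b'] (mod int p)" "[int c = c'] (mod int p)"
          by (simp_all add: cong_iff_dvd_diff)
        show False
        proof (cases "i < j")
          case True
          have "[int v = int (a + r i * (b + c))] (mod int p)"
            using chk True Suc.prems(2) mod_eq_iff_cong_int[of v p] by (simp only: if_True cong_sym)
          also have "int (a + r i * (b + c)) = int a + int (r i) * (int b + int c)" by simp
          also have "[\<dots> = a' + int_vec r i * (b' + c')] (mod int p)"
            unfolding int_vec_def using abc by (intro cong_add cong_mult) auto
          finally show False using cv True by simp
        next
          case False
          have "[int (v + a * (a + b + c)) = int 1] (mod int p)"
            using chk False p1 by (simp only: mod_eq_iff_cong_int if_False)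
          then have "[int v + int a * (int a + int b + int c) - int a * (int a + int b + int c)
            = 1 - a' * (a' + b' + c')] (mod int p)"
            using abc by (intro cong_diff cong_mult cong_add) auto
          then show False using cv False by simp
        qed
      qed
      then have card: "card Bad \<le> 2"
        unfolding Bad_def by (intro card_quadratic_roots_mod_prime assms)
      have fB: "finite Bad" by (simp add: Bad_def)
      \<comment> \<open>A bad point is charged the full value 1; there are at most two, which turns
        \<open>2 * n\<close> into \<open>2 * Suc n\<close>.\<close>
      have "?next x \<le> 2 * real n / 2 ^ \<kappa> + of_bool (x \<in> Bad)" if "x < 2 ^ \<kappa>" for x
      proof (cases "x \<in> Bad")
        case True
        have "0 \<le> 2 * real n / 2 ^ \<kappa>" by simp
        with game_value_le_1 True show ?thesis by (smt (verit) of_bool_eq(2))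
      next
        case False
        have "?next x \<le> 2 * real n / 2 ^ \<kappa>"
        proof (rule Suc.IH)
          have "\<not> int p dvd (int a + int b * int x + int c * (int x)\<^sup>2) - (a' + b' * int x + c' * (int x)\<^sup>2)"
            using False that by (simp add: Bad_def algebra_simps)
          then have "\<not> [int (a + x * (b + x * c)) = a' + b' * int x + c' * (int x)\<^sup>2] (mod int p)"
            by (simp add: cong_iff_dvd_diff algebra_simps power2_eq_square)
          then show "\<not> [int ((a + x * (b + x * c)) mod p) =
            protocol_poly F n (if i < j then j else Suc j) (if i < j then Suc i else 0)
            (int_vec (r(i := x)))] (mod int p)"
            unfolding int_vec_upd G by (simp add: zmod_int cong_def)
        qed (use Suc.prems p1 in auto)
        then show ?thesis using False by simp
      qed
      then have "(\<Sum>x<2 ^ \<kappa>. ?next x) \<le> (\<Sum>x<2 ^ \<kappa>. 2 * real n / 2 ^ \<kappa> + of_bool (x \<in> Bad))"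
        by (intro sum_mono) auto
      also have "\<dots> = 2 * real n + real (card ({..<2 ^ \<kappa>} \<inter> Bad))"
        by (simp add: sum.distrib)
      also have "{..<2 ^ \<kappa>} \<inter> Bad = Bad" by (auto simp: Bad_def)
      also have "2 * real n + real (card Bad) \<le> 2 * real (Suc n)" using card by simp
      finally have "(\<Sum>x<2 ^ \<kappa>. ?next x) / 2 ^ \<kappa> \<le> 2 * real (Suc n) / 2 ^ \<kappa>"
        by (rule divide_right_mono) simp
      then show ?thesis unfolding of_bool_eq_1_iff[THEN iffD2, OF chk] by simp
    qed simp
  qed
qed

section \<open>Branching programs as NAND trees\<close>

fun multilinear_ext :: "nat \<Rightarrow> nat \<Rightarrow> (nat \<Rightarrow> int) \<Rightarrow> (bool list \<Rightarrow> int) \<Rightarrow> int" where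
  "multilinear_ext 0 j r g = g []"
| "multilinear_ext (Suc d) j r g =
     (1 - r j) * multilinear_ext d (Suc j) r (\<lambda>bs. g (False # bs))
     + r j * multilinear_ext d (Suc j) r (\<lambda>bs. g (True # bs))"

lemma multilinear_ext_cong:
  "(\<And>k. j \<le> k \<Longrightarrow> k < j + d \<Longrightarrow> r k = r' k) \<Longrightarrow>
    multilinear_ext d j r g = multilinear_ext d j r' g"
  by (induction d j r g rule: multilinear_ext.induct) simp_all

lemma affine_in_multilinear_ext: "affine_in k (\<lambda>r. multilinear_ext d j r g)"
proof (induction d arbitrary: j g)
  case 0
  show ?case by (simp add: affine_in_def) (metis add.right_neutral mult_zero_left)
next
  case (Suc d)
  let ?F = "\<lambda>b r. multilinear_ext d (Suc j) r (\<lambda>bs. g (b # bs))"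
  have upd: "?F b (r(j := x)) = ?F b r" for b r x
    by (rule multilinear_ext_cong) simp
  show ?case
    unfolding affine_in_def
  proof
    fix r :: "nat \<Rightarrow> int"
    obtain a0 b0 a1 b1 where
      "\<forall>x. ?F False (r(k := x)) = a0 + b0 * x" "\<forall>x. ?F True (r(k := x)) = a1 + b1 * x"
      using Suc unfolding affine_in_def by metis
    moreover have "\<exists>a b. \<forall>x. (1 - x) * a0 + x * a1 = a + b * x"
      by (rule exI[of _ a0], rule exI[of _ "a1 - a0"]) (simp add: algebra_simps)
    moreover have "\<exists>a b. \<forall>x. (1 - r j) * (a0 + b0 * x) + r j * (a1 + b1 * x) = a + b * x"
      by (rule exI[of _ "(1 - r j) * a0 + r j * a1"], rule exI[of _ "(1 - r j) * b0 + r j * b1"])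
        (simp add: algebra_simps)
    ultimately show "\<exists>a b. \<forall>x. multilinear_ext (Suc d) j (r(k := x)) g = a + b * x"
    proof (cases "k = j")
      case True
      have "\<exists>a b. \<forall>x. (1 - x) * ?F False r + x * ?F True r = a + b * x"
        by (rule exI[of _ "?F False r"], rule exI[of _ "?F True r - ?F False r"])
          (simp add: algebra_simps)
      then show ?thesis using True upd by simp
    qed simp
  qed
qed

text \<open>The interpolation weights sum to 1, so constants pass through. This splits the extension
  of the leaves into two extensions that each depend on one string.\<close>

lemma multilinear_ext_add_diff_one:
  "multilinear_ext d j r (\<lambda>bs. f bs + g bs - 1) = multilinear_ext d j r f + multilinear_ext d j r g - 1"
proof (induction d arbitrary: j f g)
  case (Suc d)
  show ?case unfolding multilinear_ext.simps Suc by (simp add: algebra_simps)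
qed simp

lemma multilinear_ext_boolean:
  "(\<And>k. k < length bs \<Longrightarrow> r (j + k) = of_bool (bs ! k)) \<Longrightarrow>
    multilinear_ext (length bs) j r g = g bs"
proof (induction bs arbitrary: j g)
  case (Cons b bs)
  have "r j = of_bool b" using Cons.prems[of 0] by simp
  moreover have "multilinear_ext (length bs) (Suc j) r (\<lambda>bs. g (b # bs)) = g (b # bs)"
    using Cons.prems[of "Suc _"] by (intro Cons.IH) simp
  ultimately show ?case by (cases b) simp_all
qed simp

fun nand_tree :: "nat \<Rightarrow> (bool list \<Rightarrow> bool) \<Rightarrow> bool" where
  "nand_tree 0 g = g []"
| "nand_tree (Suc d) g \<longleftrightarrow>
     \<not> (nand_tree d (\<lambda>bs. g (False # bs)) \<and> nand_tree d (\<lambda>bs. g (True # bs)))"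

text \<open>The number of rounds of the protocol for the last \<open>d\<close> of \<open>j + d\<close> variables.\<close>

fun rounds :: "nat \<Rightarrow> nat \<Rightarrow> nat" where
  "rounds 0 j = 0"
| "rounds (Suc d) j = j + Suc (rounds d (Suc j))"

text \<open>A sum of arithmetic progression, doubled to avoid division; for \<open>j = 0\<close> the
  number of rounds is \<open>d * (d + 1) / 2\<close>.\<close>

lemma twice_rounds: "2 * rounds d j = d * (d + 2 * j + 1)"
  by (induction d j rule: rounds.induct) (simp_all add: algebra_simps)

text \<open>Linearization interpolates between the values at 0 and 1, hence changes nothing at a
  Boolean point.\<close>

lemma protocol_poly_linearize_boolean:
  "i + q = j \<Longrightarrow> (\<And>k. k < j \<Longrightarrow> r k = 0 \<or> r k = 1) \<Longrightarrow>
    protocol_poly F (q + n) j i r = protocol_poly F n j j r"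
proof (induction q arbitrary: i)
  case (Suc q)
  have "protocol_poly F (q + n) j (Suc i) r = protocol_poly F n j j r"
    using Suc by auto
  moreover have "r i = 0 \<or> r i = 1" using Suc.prems by auto
  moreover from this have "r(i := r i) = r" by simp
  ultimately show ?case using Suc.prems(1) by (auto simp: fun_upd_idem)
qed simp

text \<open>On the Boolean cube only the NAND steps act, so the recursion of the protocol is that of
  the tree. The prefix \<open>pre\<close> is the path from the root to the current subtree; the
  claim for the root is the case of an empty prefix.\<close>

lemma protocol_poly_eq_nand_tree:
  assumes "length pre = j" "\<And>k. k < j \<Longrightarrow> r k = of_bool (pre ! k)"
  shows "protocol_poly (\<lambda>r. multilinear_ext (j + d) 0 r (\<lambda>bs. of_bool (g bs))) (rounds d j) j 0 r
    = of_bool (nand_tree d (\<lambda>bs. g (pre @ bs)))"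
  using assms
proof (induction d arbitrary: j r pre)
  case 0
  then show ?case using multilinear_ext_boolean[of pre r 0] by simp
next
  case (Suc d)
  let ?F = "\<lambda>r. multilinear_ext (j + Suc d) 0 r (\<lambda>bs. of_bool (g bs))"
  have IH: "protocol_poly ?F (rounds d (Suc j)) (Suc j) 0 (r(j := of_bool b))
      = of_bool (nand_tree d (\<lambda>bs. g (pre @ b # bs)))" for b
  proof -
    have "protocol_poly (\<lambda>r. multilinear_ext (Suc j + d) 0 r (\<lambda>bs. of_bool (g bs)))
        (rounds d (Suc j)) (Suc j) 0 (r(j := of_bool b))
      = of_bool (nand_tree d (\<lambda>bs. g ((pre @ [b]) @ bs)))"
      by (rule Suc.IH) (use Suc.prems in \<open>auto simp: nth_append less_Suc_eq\<close>)
    then show ?thesis by (simp only: add_Suc_shift append_assoc append_Cons append_Nil)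
  qed
  have "protocol_poly ?F (rounds (Suc d) j) j 0 r = protocol_poly ?F (Suc (rounds d (Suc j))) j j r"
    unfolding rounds.simps using Suc.prems
    by (intro protocol_poly_linearize_boolean) auto
  then show ?case using IH[of False] IH[of True] by simp
qed

text \<open>By De Morgan a NAND of NANDs is an OR of ANDs, so two levels make one existential and
  one universal bit.\<close>

lemma nand_tree_two_levels:
  "nand_tree (Suc (Suc d)) g \<longleftrightarrow> (\<exists>x. \<forall>y. nand_tree d (\<lambda>bs. g (x # y # bs)))"
  by (simp add: ex_bool_eq all_bool_eq) blast

lemma ex_less_two_power_Suc:
  "(\<exists>y<2 ^ Suc n. P (x * 2 ^ Suc n + y)) \<longleftrightarrow>
    (\<exists>b. \<exists>y<2 ^ n. P ((2 * x + of_bool b) * 2 ^ n + y))" for x :: nat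
proof
  assume "\<exists>y<2 ^ Suc n. P (x * 2 ^ Suc n + y)"
  then obtain y where y: "y < 2 ^ Suc n" "P (x * 2 ^ Suc n + y)" by blast
  show "\<exists>b. \<exists>y<2 ^ n. P ((2 * x + of_bool b) * 2 ^ n + y)"
  proof (cases "y < 2 ^ n")
    case True
    then show ?thesis using y by (intro exI[of _ False] exI[of _ y]) (simp add: algebra_simps)
  next
    case False
    then show ?thesis using y
      by (intro exI[of _ True] exI[of _ "y - 2 ^ n"]) (simp add: algebra_simps)
  qed
next
  assume "\<exists>b. \<exists>y<2 ^ n. P ((2 * x + of_bool b) * 2 ^ n + y)"
  then obtain b y where "y < 2 ^ n" "P ((2 * x + of_bool b) * 2 ^ n + y)" by blast
  then show "\<exists>y<2 ^ Suc n. P (x * 2 ^ Suc n + y)"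
    by (intro exI[of _ "of_bool b * 2 ^ n + y"]) (cases b; simp add: algebra_simps)
qed

text \<open>\<open>read_bits\<close> is reused for paths in the tree: the flag \<open>True\<close>
  picks the first bit of each pair, which is existential here. Universal bits other than the last
  are not passed to \<open>G\<close>, so their quantifiers are vacuous.\<close>

lemma nand_tree_read_bits:
  "nand_tree (2 * Suc n + d)
     (\<lambda>bs. G (read_bits True (Suc n) x bs) (bs ! (2 * n + 1)) (drop (2 * Suc n) bs)) \<longleftrightarrow>
   (\<exists>y<2 ^ Suc n. \<forall>b. nand_tree d (G (x * 2 ^ Suc n + y) b))"
proof (induction n arbitrary: x)
  case 0
  have "nand_tree (Suc (Suc d))
      (\<lambda>bs. G (read_bits True (Suc 0) x bs) (bs ! (2 * 0 + 1)) (drop (2 * Suc 0) bs)) \<longleftrightarrow>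
    (\<exists>b. \<forall>b'. nand_tree d (G (2 * x + of_bool b) b'))"
    by (subst nand_tree_two_levels) simp
  also have "\<dots> \<longleftrightarrow> (\<exists>y<2 ^ Suc 0. \<forall>b. nand_tree d (G (x * 2 ^ Suc 0 + y) b))"
    by (subst ex_less_two_power_Suc[of 0 "\<lambda>z. \<forall>b. nand_tree d (G z b)"]) simp
  finally show ?case by (simp del: nand_tree.simps)
next
  case (Suc n)
  have "nand_tree (2 * Suc (Suc n) + d)
     (\<lambda>bs. G (read_bits True (Suc (Suc n)) x bs) (bs ! (2 * Suc n + 1)) (drop (2 * Suc (Suc n)) bs)) \<longleftrightarrow>
    (\<exists>b. nand_tree (2 * Suc n + d) (\<lambda>bs. G (read_bits True (Suc n) (2 * x + of_bool b) bs)
      (bs ! (2 * n + 1)) (drop (2 * Suc n) bs)))"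
    using nand_tree_two_levels[of "2 * Suc n + d" "\<lambda>bs. G (read_bits True (Suc (Suc n)) x bs)
      (bs ! (2 * Suc n + 1)) (drop (2 * Suc (Suc n)) bs)"]
    by (simp del: nand_tree.simps)
  then show ?case
    unfolding Suc ex_less_two_power_Suc[of "Suc n" "\<lambda>z. \<forall>b. nand_tree d (G z b)"] .
qed

text \<open>
  A leaf of the tree is a play of Savitch's game: in each of \<open>s\<close> steps the existential player names
  a node in the middle of the current interval of layers and the universal player picks a half.
  Naming the node takes \<open>L\<close> pairs of levels; of their universal bits only the last one matters.
\<close>

fun descend :: "nat \<Rightarrow> nat \<Rightarrow> nat \<Rightarrow> nat \<Rightarrow> nat \<Rightarrow> bool list \<Rightarrow> nat \<times> nat \<times> nat" where
  "descend L 0 lo u v bs = (lo, u, v)"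
| "descend L (Suc s) lo u v bs =
     (let z = read_bits True L 0 bs
      in if bs ! (2 * L - 1) then descend L s (lo + 2 ^ s) z v (drop (2 * L) bs)
         else descend L s lo u z (drop (2 * L) bs))"

fun reach :: "(nat \<Rightarrow> nat \<Rightarrow> nat \<Rightarrow> bool) \<Rightarrow> nat \<Rightarrow> nat \<Rightarrow> nat \<Rightarrow> nat \<Rightarrow> nat \<Rightarrow> bool" where
  "reach E L 0 lo u v \<longleftrightarrow> E lo u v"
| "reach E L (Suc s) lo u v \<longleftrightarrow> (\<exists>z<2 ^ L. reach E L s lo u z \<and> reach E L s (lo + 2 ^ s) z v)"

text \<open>One step of Savitch's recursion is one block of \<open>2 * L\<close> levels: the
  existential bits spell the middle node \<open>z\<close> and the last universal bit selects the
  half. A block has such a bit because \<open>0 < L\<close>.\<close>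

lemma nand_tree_descend:
  assumes "0 < L"
  shows "nand_tree (2 * L * s) (\<lambda>bs. case descend L s lo u v bs of (lo, u, v) \<Rightarrow> E lo u v) \<longleftrightarrow>
    reach E L s lo u v"
proof (induction s arbitrary: lo u v)
  case (Suc s)
  obtain l where L: "L = Suc l" using assms by (cases L) auto
  let ?G = "\<lambda>z b bs. if b then case descend L s (lo + 2 ^ s) z v bs of (lo, u, v) \<Rightarrow> E lo u v
    else case descend L s lo u z bs of (lo, u, v) \<Rightarrow> E lo u v"
  have len: "2 * L * Suc s = 2 * Suc l + 2 * L * s" by (simp add: L)
  have eq: "(\<lambda>bs. case descend L (Suc s) lo u v bs of (lo, u, v) \<Rightarrow> E lo u v) =
    (\<lambda>bs. ?G (read_bits True (Suc l) 0 bs) (bs ! (2 * l + 1)) (drop (2 * Suc l) bs))"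
    by (intro ext) (simp add: Let_def L)
  have "nand_tree (2 * L * Suc s) (\<lambda>bs. case descend L (Suc s) lo u v bs of (lo, u, v) \<Rightarrow> E lo u v)
    \<longleftrightarrow> (\<exists>y<2 ^ Suc l. \<forall>b. nand_tree (2 * L * s) (?G (0 * 2 ^ Suc l + y) b))"
    unfolding len eq by (rule nand_tree_read_bits[of l "2 * L * s" ?G 0])
  also have "\<dots> \<longleftrightarrow> reach E L (Suc s) lo u v"
    unfolding L[symmetric] by (auto simp: all_bool_eq Suc)
  finally show ?case .
qed simp

text \<open>A path of length \<open>2 ^ Suc s\<close> is cut at its middle node. The recursion only
  offers middle nodes below \<open>2 ^ L\<close>; since edges lead from such nodes to such nodes, a
  path starting there never leaves the range.\<close>

lemma reach_iff_path:
  assumes "\<And>i u v. E i u v \<Longrightarrow> u < 2 ^ L \<Longrightarrow> v < 2 ^ L" "u < 2 ^ L"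
  shows "reach E L s lo u v \<longleftrightarrow>
    (\<exists>p. p 0 = u \<and> p (2 ^ s) = v \<and> (\<forall>i<2 ^ s. E (lo + i) (p i) (p (Suc i))))"
  using assms(2)
proof (induction s arbitrary: lo u v)
  case 0
  show ?case
  proof
    assume "reach E L 0 lo u v"
    then show "\<exists>p. p 0 = u \<and> p (2 ^ 0) = v \<and> (\<forall>i<2 ^ 0. E (lo + i) (p i) (p (Suc i)))"
      by (intro exI[of _ "\<lambda>i. if i = 0 then u else v"]) simp
  qed auto
next
  case (Suc s)
  show ?case
  proof
    assume "reach E L (Suc s) lo u v"
    then obtain z where z: "z < 2 ^ L" "reach E L s lo u z" "reach E L s (lo + 2 ^ s) z v" by auto
    obtain p where p: "p 0 = u" "p (2 ^ s) = z" "\<And>i. i < 2 ^ s \<Longrightarrow> E (lo + i) (p i) (p (Suc i))"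
      using Suc.IH[of u] Suc.prems z by blast
    obtain q where q: "q 0 = z" "q (2 ^ s) = v"
      "\<And>i. i < 2 ^ s \<Longrightarrow> E (lo + 2 ^ s + i) (q i) (q (Suc i))"
      using Suc.IH[of z] z by blast
    define pq where "pq i = (if i \<le> 2 ^ s then p i else q (i - 2 ^ s))" for i
    have "E (lo + i) (pq i) (pq (Suc i))" if "i < 2 ^ Suc s" for i
    proof (cases "i < 2 ^ s")
      case True
      then show ?thesis using p by (simp add: pq_def)
    next
      case False
      then have "pq i = q (i - 2 ^ s)" "pq (Suc i) = q (Suc (i - 2 ^ s))"
        using p q by (auto simp: pq_def Suc_diff_le)
      then show ?thesis using q(3)[of "i - 2 ^ s"] that False by simp
    qed
    moreover have "pq 0 = u" "pq (2 ^ Suc s) = v" using p q by (simp_all add: pq_def)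
    ultimately show "\<exists>p. p 0 = u \<and> p (2 ^ Suc s) = v \<and> (\<forall>i<2 ^ Suc s. E (lo + i) (p i) (p (Suc i)))"
      by blast
  next
    assume "\<exists>p. p 0 = u \<and> p (2 ^ Suc s) = v \<and> (\<forall>i<2 ^ Suc s. E (lo + i) (p i) (p (Suc i)))"
    then obtain p where p: "p 0 = u" "p (2 ^ Suc s) = v"
      "\<And>i. i < 2 ^ Suc s \<Longrightarrow> E (lo + i) (p i) (p (Suc i))" by blast
    have "i \<le> 2 ^ Suc s \<Longrightarrow> p i < 2 ^ L" for i
      by (induction i) (use Suc.prems p assms(1) in \<open>auto simp: Suc_le_eq\<close>)
    then have z: "p (2 ^ s) < 2 ^ L" by simp
    have "reach E L s lo u (p (2 ^ s))"
      using Suc.IH[OF Suc.prems] p by auto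
    moreover have "reach E L s (lo + 2 ^ s) (p (2 ^ s)) v"
      using Suc.IH[OF z] p(2) p(3)[of "2 ^ s + _"]
      by (auto intro!: exI[of _ "\<lambda>i. p (2 ^ s + i)"] simp: mult_2 add.assoc)
    ultimately show "reach E L (Suc s) lo u v" using z by auto
  qed
qed

section \<open>Padding a program and dividing its leaves between the parties\<close>

text \<open>Repeated halving needs a power of two many steps; the layers beyond the last one are
  filled with identity edges, which preserve the end node.\<close>

definition padded_edge :: "bp \<Rightarrow> bool list \<Rightarrow> nat \<Rightarrow> nat \<Rightarrow> nat \<Rightarrow> bool" where
  "padded_edge P x i u v \<longleftrightarrow>
     (if i < bp_length P - 1 then (i, u, x ! bp_label P i, v) \<in> bp_edges P else u = v)"

lemma bp_accepts_iff_reach: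
  assumes "branching_program P" "bp_width P \<le> 2 ^ L" "bp_length P - 1 \<le> 2 ^ K"
  shows "bp_accepts P x \<longleftrightarrow> reach (padded_edge P x) L K 0 0 0"
proof -
  let ?E = "padded_edge P x" and ?T = "bp_length P - 1"
  have "reach ?E L K 0 0 0 \<longleftrightarrow>
    (\<exists>p. p 0 = 0 \<and> p (2 ^ K) = 0 \<and> (\<forall>i<2 ^ K. ?E (0 + i) (p i) (p (Suc i))))"
    using assms(1,2)
    by (intro reach_iff_path) (auto simp: padded_edge_def branching_program_def split: if_splits)
  also have "\<dots> \<longleftrightarrow> bp_accepts P x"
    unfolding bp_accepts_def
  proof
    assume "\<exists>p. p 0 = 0 \<and> p (2 ^ K) = 0 \<and> (\<forall>i<2 ^ K. ?E (0 + i) (p i) (p (Suc i)))"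
    then obtain p where p: "p 0 = 0" "p (2 ^ K) = 0" "\<And>i. i < 2 ^ K \<Longrightarrow> ?E i (p i) (p (Suc i))"
      by auto
    have "p ?T = p (2 ^ K)"
      using assms(3)
    proof (induction rule: dec_induct)
      case (step i)
      then show ?case using p(3)[of i] by (simp add: padded_edge_def)
    qed simp
    then show "\<exists>p. p 0 = 0 \<and> p ?T = 0 \<and> (\<forall>i<?T. (i, p i, x ! bp_label P i, p (Suc i)) \<in> bp_edges P)"
      using p assms(3) by (intro exI[of _ p]) (force simp: padded_edge_def)
  next
    assume "\<exists>p. p 0 = 0 \<and> p ?T = 0 \<and> (\<forall>i<?T. (i, p i, x ! bp_label P i, p (Suc i)) \<in> bp_edges P)"
    then obtain p where p: "p 0 = 0" "p ?T = 0"
      "\<And>i. i < ?T \<Longrightarrow> (i, p i, x ! bp_label P i, p (Suc i)) \<in> bp_edges P" by auto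
    \<comment> \<open>Beyond the last layer \<open>p\<close> is arbitrary, so it is replaced by the
      constant 0, which follows the identity edges.\<close>
    define q where "q i = (if i < ?T then p i else 0)" for i
    have q: "q i = p i" if "i \<le> ?T" for i
      using that p(2) by (cases "i = ?T") (auto simp: q_def)
    have "?E i (q i) (q (Suc i))" for i
    proof (cases "i < ?T")
      case True
      then show ?thesis using p(3)[of i] q[of i] q[of "Suc i"] by (simp add: padded_edge_def)
    qed (simp add: padded_edge_def q_def)
    moreover have "q 0 = 0" "q (2 ^ K) = 0" using q[of 0] p assms(3) by (auto simp: q_def)
    ultimately show "\<exists>p. p 0 = 0 \<and> p (2 ^ K) = 0 \<and> (\<forall>i<2 ^ K. ?E (0 + i) (p i) (p (Suc i)))"
      by (intro exI[of _ q]) simp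
  qed
  finally show ?thesis by simp
qed

text \<open>
  The share of one party in the value of a leaf: a party contributes 1 on layers whose variable it
  does not own, so the leaf has value \<open>\<alpha> + \<beta> - 1\<close> for the shares \<open>\<alpha>\<close> and \<open>\<beta>\<close>. Side 0 owns the
  first half of the variables and the padding layers.
\<close>

definition share :: "bp \<Rightarrow> nat \<Rightarrow> bool list \<Rightarrow> nat \<Rightarrow> nat \<Rightarrow> nat \<Rightarrow> nat" where
  "share P side x i u v =
     (if i < bp_length P - 1
      then if bp_label P i div (bp_inputs P div 2) = side
           then of_bool ((i, u, x ! (bp_label P i mod (bp_inputs P div 2)), v) \<in> bp_edges P)
           else 1
      else of_bool (u = v \<or> side \<noteq> 0))"

lemma share_le_1: "share P side x i u v \<le> 1"
  by (simp add: share_def)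

text \<open>On every layer one of the two shares is 1, so the conjunction is their sum minus one.
  Unlike a product, this form separates into one term per string after extension.\<close>

lemma share_sum:
  assumes "branching_program P" "even (bp_inputs P)" "length a = bp_inputs P div 2"
  shows "int (share P 0 a i u v) + int (share P 1 b i u v) - 1 = of_bool (padded_edge P (a @ b) i u v)"
proof (cases "i < bp_length P - 1")
  case True
  let ?h = "bp_inputs P div 2"
  have lt: "bp_label P i < 2 * ?h" using assms(1,2) True by (auto simp: branching_program_def)
  show ?thesis
  proof (cases "bp_label P i < ?h")
    case True
    then show ?thesis using \<open>i < bp_length P - 1\<close> assms(3)
      by (simp add: share_def padded_edge_def nth_append)
  next
    case False
    then have div: "bp_label P i div ?h = 1"
      using lt by (intro div_nat_eqI) simp_all
    then have "bp_label P i mod ?h = bp_label P i - ?h"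
      using minus_div_mult_eq_mod[of "bp_label P i" ?h] by simp
    with div show ?thesis using \<open>i < bp_length P - 1\<close> assms(3) False
      by (simp add: share_def padded_edge_def nth_append)
  qed
qed (simp add: share_def padded_edge_def)

definition leaf_share :: "bp \<Rightarrow> nat \<Rightarrow> nat \<Rightarrow> nat \<Rightarrow> bool list \<Rightarrow> bool list \<Rightarrow> nat" where
  "leaf_share P L K side x bs = (case descend L K 0 0 0 bs of (i, u, v) \<Rightarrow> share P side x i u v)"

text \<open>\<open>\<alpha>\<close> is the claimed extension of the shares of side 0. The
  \<open>+ 1\<close> on side 1 is the 1 subtracted in the sum of the two shares, moved to the other
  side.\<close>

definition final_check ::
    "nat \<Rightarrow> nat \<Rightarrow> nat \<Rightarrow> (bool list \<Rightarrow> nat) \<Rightarrow> (nat \<Rightarrow> nat) \<Rightarrow> nat \<Rightarrow> nat \<Rightarrow> bool" where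
  "final_check p m side f r v \<alpha> \<longleftrightarrow>
     (if side = 0 then [multilinear_ext m 0 (int_vec r) (\<lambda>bs. int (f bs)) = int \<alpha>] (mod int p)
      else [multilinear_ext m 0 (int_vec r) (\<lambda>bs. int (f bs)) + int \<alpha> = int v + 1] (mod int p))"

definition bp_tensor ::
    "nat \<Rightarrow> nat \<Rightarrow> nat \<Rightarrow> bp \<Rightarrow> nat \<Rightarrow> nat \<Rightarrow> nat \<Rightarrow> bool list \<Rightarrow> tensor" where
  "bp_tensor p \<kappa> \<mu> P L K side x =
     verdict p \<kappa> \<mu> (final_check p (2 * L * K) side (leaf_share P L K side x))
       (rounds (2 * L * K) 0) 0 0 (\<lambda>_. 0) 1"

text \<open>The alternatives \<open>K = 0\<close> cover programs with at most one layer of edges.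
  Their tree is a single leaf for any \<open>L\<close>, and with \<open>\<mu> = 0\<close> no power
  of two is large enough for the prime, so completeness is checked by hand there.\<close>

lemma bp_tensor_game:
  fixes \<kappa> \<mu> L K :: nat
  assumes "branching_program P" "even (bp_inputs P)" "length a = bp_inputs P div 2"
    "bp_width P \<le> 2 ^ L \<or> K = 0" "bp_length P - 1 \<le> 2 ^ K" "0 < L \<or> K = 0"
  defines "m \<equiv> 2 * L * K"
  defines "t \<equiv> rounds m 0 * (6 * \<mu> + 2 * \<kappa>) + 2 * \<mu>"
  shows
    "1 < p \<Longrightarrow> p \<le> 2 ^ \<mu> \<or> K = 0 \<and> \<mu> = 0 \<Longrightarrow> bp_accepts P (a @ b) \<Longrightarrow>
      trop_sim t (bp_tensor p \<kappa> \<mu> P L K 0 a) (bp_tensor p \<kappa> \<mu> P L K 1 b) = 1"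
    "prime p \<Longrightarrow> 2 ^ \<kappa> \<le> p \<Longrightarrow> \<not> bp_accepts P (a @ b) \<Longrightarrow>
      trop_sim t (bp_tensor p \<kappa> \<mu> P L K 0 a) (bp_tensor p \<kappa> \<mu> P L K 1 b) \<le> real (m * (m + 1)) / 2 ^ \<kappa>"
proof -
  let ?A = "\<lambda>r. multilinear_ext m 0 r (\<lambda>bs. int (leaf_share P L K 0 a bs))"
  let ?B = "\<lambda>r. multilinear_ext m 0 r (\<lambda>bs. int (leaf_share P L K 1 b bs))"
  define g where
    "g bs = (case descend L K 0 0 0 bs of (i, u, v) \<Rightarrow> padded_edge P (a @ b) i u v)" for bs
  define F where "F r = multilinear_ext m 0 r (\<lambda>bs. of_bool (g bs))" for r
  define fin where "fin r v \<alpha> \<longleftrightarrow> final_check p m 0 (leaf_share P L K 0 a) r v \<alpha> \<and>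
    final_check p m 1 (leaf_share P L K 1 b) r v \<alpha>" for r v \<alpha>
  have acc: "bp_accepts P (a @ b) \<longleftrightarrow> reach (padded_edge P (a @ b)) L K 0 0 0"
  proof (cases "K = 0")
    case True
    then show ?thesis
      \<comment> \<open>For \<open>K = 0\<close> reachability is the same for all \<open>L\<close>,
        so the width itself, being smaller than its power of two, serves as the number of node
        bits.\<close>
      using bp_accepts_iff_reach[OF assms(1), of "bp_width P" K] assms(5) less_exp[of "bp_width P"]
      by simp
  qed (use assms in \<open>auto simp: bp_accepts_iff_reach\<close>)
  have F: "F r = ?A r + ?B r - 1" for r
  proof -
    have "(\<lambda>bs. of_bool (g bs)) = (\<lambda>bs. int (leaf_share P L K 0 a bs) + int (leaf_share P L K 1 b bs) - 1)"
    proof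
      fix bs
      obtain i u v where "descend L K 0 0 0 bs = (i, u, v)" by (metis prod.exhaust)
      then show "of_bool (g bs) = int (leaf_share P L K 0 a bs) + int (leaf_share P L K 1 b bs) - 1"
        using share_sum[OF assms(1-3), of i u v b] by (simp only: g_def leaf_share_def prod.case)
    qed
    then show ?thesis unfolding F_def by (simp only: multilinear_ext_add_diff_one)
  qed
  have trop: "trop_sim t (bp_tensor p \<kappa> \<mu> P L K 0 a) (bp_tensor p \<kappa> \<mu> P L K 1 b)
    = game_value p \<kappa> \<mu> fin (rounds m 0) 0 0 (\<lambda>_. 0) 1"
    unfolding trop_sim_def game_value_def t_def fin_def verdict_conj bp_tensor_def m_def
    by (simp add: of_bool_conj)
  have aff: "affine_in k F" for k
    unfolding F_def by (rule affine_in_multilinear_ext)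
  have "nand_tree m g \<longleftrightarrow> bp_accepts P (a @ b)"
  proof (cases "K = 0")
    case True
    then show ?thesis
      using acc by (simp add: m_def g_def)
  next
    case False
    then show ?thesis
      using nand_tree_descend[of L K "padded_edge P (a @ b)" 0 0 0] assms(6)
        acc by (simp add: m_def g_def[abs_def])
  qed
  then have root: "protocol_poly F (rounds m 0) 0 0 r = of_bool (bp_accepts P (a @ b))" for r
    using protocol_poly_eq_nand_tree[of "[]" 0 r m g] unfolding F_def by simp
  show "trop_sim t (bp_tensor p \<kappa> \<mu> P L K 0 a) (bp_tensor p \<kappa> \<mu> P L K 1 b) = 1"
    if "1 < p" "p \<le> 2 ^ \<mu> \<or> K = 0 \<and> \<mu> = 0" "bp_accepts P (a @ b)"
  proof (cases "p \<le> 2 ^ \<mu>")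
    case True
    show ?thesis
      unfolding trop
    proof (rule game_value_complete[OF that(1) True aff])
      fix r v assume v: "[int v = F (int_vec r)] (mod int p)"
      show "\<exists>z. \<forall>\<alpha>. [int \<alpha> = z] (mod int p) \<longrightarrow> fin r v \<alpha>"
      proof (intro exI[of _ "?A (int_vec r)"] allI impI)
        fix \<alpha> assume \<alpha>: "[int \<alpha> = ?A (int_vec r)] (mod int p)"
        have "[?B (int_vec r) + int \<alpha> = ?B (int_vec r) + ?A (int_vec r)] (mod int p)"
          using \<alpha> by (intro cong_add) auto
        also have "?B (int_vec r) + ?A (int_vec r) = F (int_vec r) + 1" by (simp add: F)
        also have "[F (int_vec r) + 1 = int v + 1] (mod int p)"
          using cong_sym[OF v] by (intro cong_add) auto
        finally show "fin r v \<alpha>"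
          using cong_sym[OF \<alpha>] by (simp add: fin_def final_check_def)
      qed
    qed (use that root in auto)
  next
    case False
    \<comment> \<open>The only last message is now the leading 1, and both shares are 1 because they
      are at most 1 and their sum is 2.\<close>
    then have K: "K = 0" "\<mu> = 0" using that by auto
    then have m: "m = 0" by (simp add: m_def)
    have "padded_edge P (a @ b) 0 0 0"
      using that(3) acc K by simp
    then have "share P 0 a 0 0 0 = 1" "share P 1 b 0 0 0 = 1"
      using share_sum[OF assms(1-3), where i = 0 and u = 0 and v = 0 and b = b]
        share_le_1[of P 0 a 0 0 0] share_le_1[of P 1 b 0 0 0] by simp_all
    then show ?thesis
      unfolding trop by (simp add: m game_value_0 max_read_def K fin_def final_check_def leaf_share_def)
  qed
  show "trop_sim t (bp_tensor p \<kappa> \<mu> P L K 0 a) (bp_tensor p \<kappa> \<mu> P L K 1 b) \<le> real (m * (m + 1)) / 2 ^ \<kappa>"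
    if p: "prime p" "2 ^ \<kappa> \<le> p" and "\<not> bp_accepts P (a @ b)"
  proof -
    have "game_value p \<kappa> \<mu> fin (rounds m 0) 0 0 (\<lambda>_. 0) 1 \<le> 2 * real (rounds m 0) / 2 ^ \<kappa>"
    proof (rule game_value_sound[OF p aff])
      fix r v \<alpha> assume v: "\<not> [int v = F (int_vec r)] (mod int p)"
      show "\<not> fin r v \<alpha>"
      proof
        assume fin: "fin r v \<alpha>"
        \<comment> \<open>Adding the two checks cancels \<open>\<alpha>\<close>, so no last message
          can make both parties accept a false claim.\<close>
        have "[?A (int_vec r) + (?B (int_vec r) + int \<alpha>) = int \<alpha> + (int v + 1)] (mod int p)"
          using fin unfolding fin_def final_check_def by (intro cong_add[of _ "int \<alpha>"]) auto
        then have "[F (int_vec r) + (1 + int \<alpha>) = int v + (1 + int \<alpha>)] (mod int p)"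
          by (simp add: F algebra_simps)
        then have "[F (int_vec r) = int v] (mod int p)" by (simp only: cong_add_rcancel)
        with v show False using cong_sym by blast
      qed
    next
      show "(1::nat) < p" using p(1) by (rule prime_gt_1_nat)
      then show "\<not> [int 1 = protocol_poly F (rounds m 0) 0 0 (int_vec (\<lambda>_. 0))] (mod int p)"
        using that(3) unfolding root by (simp add: unique_euclidean_semiring_class.cong_def)
    qed simp
    also have "2 * real (rounds m 0) = real (m * (m + 1))"
    proof -
      have "2 * real (rounds m 0) = real (2 * rounds m 0)" by simp
      then show ?thesis unfolding twice_rounds by simp
    qed
    finally show ?thesis unfolding trop .
  qed
qed

section \<open>A prime between a power of two and its square\<close>

text \<open>Leibniz's harmonic triangle: with \<open>a = k * (n - 1 choose k)\<close>,
  \<open>b = k * (n choose k)\<close> and \<open>c = (k + 1) * (n choose k + 1)\<close> one has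
  \<open>1 / c = 1 / a - 1 / b\<close>. If the least common multiple is \<open>a * x\<close> and
  \<open>b * y\<close>, it is therefore \<open>c * (x - y)\<close>.\<close>

lemma mult_binomial_dvd_Lcm:
  "1 \<le> k \<Longrightarrow> k \<le> n \<Longrightarrow> k * (n choose k) dvd Lcm {1..n::nat}"
proof (induction k arbitrary: n)
  case (Suc k)
  show ?case
  proof (cases "k = 0")
    case True
    then show ?thesis using Suc.prems by simp
  next
    case False
    obtain n' where n: "n = Suc n'" using Suc.prems by (cases n) auto
    let ?a = "k * (n' choose k)" and ?b = "k * (n choose k)" and ?c = "Suc k * (n choose Suc k)"
    have sub: "Lcm {1..n'} dvd Lcm {1..n}" by (rule Lcm_subset) (auto simp: n)
    have "?a dvd Lcm {1..n}"
      using Suc.IH[of n'] Suc.prems False n sub by (auto intro: dvd_trans)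
    then obtain x where x: "Lcm {1..n} = ?a * x" by (elim dvdE)
    have "?b dvd Lcm {1..n}"
      using Suc.IH[of n] Suc.prems False by auto
    then obtain y where y: "Lcm {1..n} = ?b * y" by (elim dvdE)
    have key: "int ?c * (int ?b - int ?a) = int ?a * int ?b"
    proof -
      obtain k' where k: "k = Suc k'" using False by (cases k) auto
      have "int ?b - int ?a = int k * int (n' choose k')"
        by (simp add: n k algebra_simps)
      moreover have "int ?c = int n * int (n' choose k)"
        using Suc_times_binomial[of k n'] by (simp only: n of_nat_mult[symmetric])
      moreover have "int ?b = int n * int (n' choose k')"
        using Suc_times_binomial[of k' n'] by (simp only: n k of_nat_mult[symmetric])
      moreover have "int ?a = int k * int (n' choose k)" by simp
      ultimately show ?thesis by (simp only: mult_ac)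
    qed
    have L: "int (Lcm {1..n}) * (int ?a * int ?b) = int ?c * (int x - int y) * (int ?a * int ?b)"
    proof -
      have X: "int (Lcm {1..n}) = int ?a * int x" and Y: "int (Lcm {1..n}) = int ?b * int y"
        using x y by (simp_all only: of_nat_mult[symmetric])
      have "int (Lcm {1..n}) * (int ?a * int ?b)
        = int ?c * (int (Lcm {1..n}) * int ?b - int (Lcm {1..n}) * int ?a)"
        by (simp only: key[symmetric] algebra_simps)
      also have "\<dots> = int ?c * (int ?a * int x * int ?b - int ?b * int y * int ?a)"
        by (simp only: X[symmetric] Y[symmetric])
      finally show ?thesis by (simp only: algebra_simps)
    qed
    have "int ?a * int ?b \<noteq> 0" using False Suc.prems n by simp
    with L have "int (Lcm {1..n}) = int ?c * (int x - int y)" 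
      by (metis mult_cancel_right)
    then have "int ?c dvd int (Lcm {1..n})" by (rule dvdI)
    then show ?thesis by (simp only: int_dvd_int_iff)
  qed
qed simp

text \<open>The multiplicity of a prime in a least common multiple is the maximum of its
  multiplicities in the members, so a prime power dividing it divides one of the numbers up to
  \<open>n\<close>.\<close>

lemma prime_power_dvd_Lcm:
  assumes "prime (p::nat)" "p ^ e dvd Lcm {1..n}" "0 < n"
  shows "p ^ e \<le> n"
  using assms(2,3)
proof (induction n)
  case (Suc n)
  show ?case
  proof (cases "n = 0")
    case True
    then show ?thesis using Suc.prems by (auto dest: dvd_imp_le)
  next
    case False
    have "{1..Suc n} = insert (Suc n) {1..n}" by auto
    then have "Lcm {1..Suc n} = lcm (Suc n) (Lcm {1..n})" by simp
    moreover have "Lcm {1..n} \<noteq> 0" by (simp add: Lcm_0_iff)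
    moreover have "\<not> is_unit p" using assms(1) by (metis not_prime_unit)
    ultimately have "e \<le> multiplicity p (lcm (Suc n) (Lcm {1..n}))"
      using Suc.prems(1) by (intro multiplicity_geI) (simp_all add: lcm_eq_0_iff)
    also have "\<dots> = max (multiplicity p (Suc n)) (multiplicity p (Lcm {1..n}))"
      using assms(1) \<open>Lcm {1..n} \<noteq> 0\<close> by (intro multiplicity_lcm) (simp_all add: prime_imp_prime_elem)
    finally have "p ^ e dvd Suc n \<or> p ^ e dvd Lcm {1..n}"
      by (auto simp: le_max_iff_disj intro: multiplicity_dvd')
    then show ?thesis
      using Suc.IH False by (auto dest: dvd_imp_le)
  qed
qed simp

text \<open>Chebyshev's argument with the central binomial coefficient. Each prime power in it is at
  most \<open>2 * n\<close>; without a prime in the range all its prime factors are below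
  \<open>2 ^ \<kappa>\<close>, so it is at most \<open>(2 * n) ^ 2 ^ \<kappa>\<close>, less than its
  size \<open>4 ^ n / (2 * n)\<close> allows. The wide range makes it sufficient to bound the number
  of prime factors by \<open>2 ^ \<kappa>\<close>.\<close>

lemma ex_prime_between:
  fixes \<kappa> :: nat
  assumes "3 \<le> \<kappa>"
  shows "\<exists>p::nat. prime p \<and> 2 ^ \<kappa> \<le> p \<and> p \<le> 2 ^ (2 * \<kappa>)"
proof (rule ccontr)
  assume no: "\<not> ?thesis"
  \<comment> \<open>Chosen so that \<open>2 * n\<close> is the upper end of the range.\<close>
  define n :: nat where "n = 2 ^ (2 * \<kappa> - 1)"
  have n2: "2 * n = 2 ^ (2 * \<kappa>)" using assms by (simp add: n_def flip: power_Suc)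
  have npos: "0 < n" by (simp add: n_def)
  define c where "c = 2 * n choose n"
  have c0: "c \<noteq> 0" by (simp add: c_def)
  have pp: "p ^ multiplicity p c \<le> 2 * n" if "prime p" for p
  proof (rule prime_power_dvd_Lcm[OF that])
    have "c dvd Lcm {1..2 * n}"
      unfolding c_def using mult_binomial_dvd_Lcm[of n "2 * n"] npos by (auto intro: dvd_mult_right)
    then show "p ^ multiplicity p c dvd Lcm {1..2 * n}"
      using multiplicity_dvd dvd_trans by blast
  qed (use npos in simp)
  have sub: "prime_factors c \<subseteq> {0<..<2 ^ \<kappa>}"
  proof
    fix p assume p: "p \<in> prime_factors c"
    then have pr: "prime p" and "1 \<le> multiplicity p c"
      by (auto simp: prime_factors_multiplicity)
    then have "p ^ 1 \<le> p ^ multiplicity p c"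
      by (intro power_increasing) (auto dest: prime_gt_0_nat simp: Suc_le_eq)
    with pp[OF pr] have "p \<le> 2 ^ (2 * \<kappa>)" by (simp add: n2)
    with no pr show "p \<in> {0<..<2 ^ \<kappa>}" by (auto simp: not_le dest: prime_gt_0_nat)
  qed
  have "card (prime_factors c) \<le> card {0<..<2 ^ \<kappa> :: nat}"
    using sub by (intro card_mono) auto
  then have card: "card (prime_factors c) \<le> 2 ^ \<kappa>" by simp
  have "c = (\<Prod>p\<in>prime_factors c. p ^ multiplicity p c)"
    using c0 by (intro prime_factorization_nat) auto
  also have "\<dots> \<le> (\<Prod>p\<in>prime_factors c. 2 * n)"
    using pp by (intro prod_mono) (auto simp: in_prime_factors_imp_prime)
  also have "\<dots> = (2 * n) ^ card (prime_factors c)" by simp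
  also have "\<dots> \<le> (2 * n) ^ 2 ^ \<kappa>" using card npos by (intro power_increasing) auto
  finally have cle: "c \<le> (2 * n) ^ 2 ^ \<kappa>" .
  have "4 ^ n / (2 * real n) \<le> real c"
    unfolding c_def using npos by (intro central_binomial_lower_bound)
  then have "4 ^ n \<le> real c * (2 * real n)" using npos by (simp add: field_simps)
  then have "4 ^ n \<le> real (c * (2 * n))" by simp
  then have "real (4 ^ n) \<le> real (c * (2 * n))" by simp
  then have "4 ^ n \<le> c * (2 * n)" by (simp only: of_nat_le_iff)
  also have "\<dots> \<le> (2 * n) ^ 2 ^ \<kappa> * (2 * n)" using cle by (intro mult_right_mono) auto
  also have "\<dots> = 2 ^ (2 * \<kappa> * (2 ^ \<kappa> + 1))"
    by (simp add: n2 power_add power_mult)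
  finally have "(2::nat) ^ (2 * n) \<le> 2 ^ (2 * \<kappa> * (2 ^ \<kappa> + 1))"
    by (simp add: power_mult)
  then have le: "2 * n \<le> 2 * \<kappa> * (2 ^ \<kappa> + 1)"
    by (simp add: power_increasing_iff)
  \<comment> \<open>The induction starts from 54 < 64 at \<open>\<kappa> = 3\<close>; at
    \<open>\<kappa> = 2\<close> the estimate fails, being 20 against 16.\<close>
  have "2 * \<kappa> * (2 ^ \<kappa> + 1) < (2::nat) ^ (2 * \<kappa>)"
    using assms
  proof (induction \<kappa> rule: dec_induct)
    case (step k)
    have "2 * Suc k * (2 ^ Suc k + 1) = 4 * (k * 2 ^ k) + 4 * 2 ^ k + 2 * k + (2::nat)"
      by (simp add: algebra_simps)
    also have "\<dots> \<le> 8 * (k * 2 ^ k) + 8 * k"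
    proof -
      have "1 * 2 ^ k \<le> k * (2::nat) ^ k" using step.hyps by (intro mult_right_mono) auto
      then show ?thesis using step.hyps by linarith
    qed
    also have "\<dots> = 4 * (2 * k * (2 ^ k + 1))" by (simp add: algebra_simps)
    finally have "2 * Suc k * (2 ^ Suc k + 1) \<le> 4 * (2 * k * (2 ^ k + (1::nat)))" .
    with step.IH show ?case by simp
  qed simp
  with le n2 show False by simp
qed

section \<open>Weakest preconditions on the word RAM\<close>

text \<open>Total correctness with time: the postcondition sees the running time, so time bound and
  result are proved together. As \<open>exec\<close> is deterministic, the existence of a good run
  says that the run is good.\<close>

definition runs :: "nat \<Rightarrow> com \<Rightarrow> mem \<Rightarrow> (nat \<Rightarrow> mem \<Rightarrow> bool) \<Rightarrow> bool" where
  "runs M c s Q \<longleftrightarrow> (\<exists>\<tau> s'. exec M c s \<tau> s' \<and> Q \<tau> s')"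

lemma runs_mono: "runs M c s Q \<Longrightarrow> (\<And>\<tau> s'. Q \<tau> s' \<Longrightarrow> Q' \<tau> s') \<Longrightarrow> runs M c s Q'"
  unfolding runs_def by blast

lemma runs_Assign [simp]:
  "runs M (Assign x e) s Q \<longleftrightarrow>
     fits M e s \<and> Q (cost e + 1) (s\<lparr>regs := (regs s)(x := val e s)\<rparr>)"
  unfolding runs_def by (auto elim!: AssignE intro!: exec.Assign exI)

lemma runs_Write [simp]:
  "runs M (Write a e1 e2) s Q \<longleftrightarrow> fits M e1 s \<and> fits M e2 s \<and>
     Q (cost e1 + cost e2 + 1) (s\<lparr>arrs := (arrs s)(a := (arrs s a)(val e1 s := val e2 s))\<rparr>)"
  unfolding runs_def by (auto elim!: WriteE intro!: exec.Write exI)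

lemma runs_Seq [simp]:
  "runs M (Seq c1 c2) s Q \<longleftrightarrow> runs M c1 s (\<lambda>\<tau>1 s1. runs M c2 s1 (\<lambda>\<tau>2. Q (\<tau>1 + \<tau>2)))"
  unfolding runs_def by (blast elim: SeqE intro: exec.Seq)

lemma runs_Cond [simp]:
  "runs M (Cond e c1 c2) s Q \<longleftrightarrow> fits M e s \<and>
     (if val e s \<noteq> 0 then runs M c1 s (\<lambda>\<tau>. Q (cost e + 1 + \<tau>))
      else runs M c2 s (\<lambda>\<tau>. Q (cost e + 1 + \<tau>)))"
  (is "_ \<longleftrightarrow> ?R")
proof
  assume "runs M (Cond e c1 c2) s Q"
  then obtain \<tau> s' where "exec M (Cond e c1 c2) s \<tau> s'" "Q \<tau> s'" unfolding runs_def by blast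
  then show ?R unfolding runs_def by (auto elim!: CondE)
next
  assume R: ?R
  show "runs M (Cond e c1 c2) s Q"
  proof (cases "val e s = 0")
    case True
    with R obtain \<tau> s' where "exec M c2 s \<tau> s'" "Q (cost e + 1 + \<tau>) s'" unfolding runs_def by auto
    then show ?thesis unfolding runs_def using R exec.CondFalse[OF _ True] by blast
  next
    case False
    with R obtain \<tau> s' where "exec M c1 s \<tau> s'" "Q (cost e + 1 + \<tau>) s'" unfolding runs_def by auto
    then show ?thesis unfolding runs_def using R exec.CondTrue[OF _ False] by blast
  qed
qed

text \<open>The index of the invariant is at the same time the variant: it drops by one in each
  iteration. So there are at most \<open>n\<close> iterations of cost \<open>cost e + 1 + b\<close>,
  and one failing test.\<close>

lemma runs_While:
  assumes "I n s"
    and body: "\<And>k s. I k s \<Longrightarrow> fits M e s \<and>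
      (val e s \<noteq> 0 \<longrightarrow> 0 < k \<and> runs M c s (\<lambda>\<tau> s'. \<tau> \<le> b \<and> I (k - 1) s'))"
    and exit: "\<And>k s \<tau>. I k s \<Longrightarrow> val e s = 0 \<Longrightarrow> \<tau> \<le> n * (cost e + 1 + b) + cost e + 1 \<Longrightarrow> Q \<tau> s"
  shows "runs M (While e c) s Q"
proof -
  have "\<exists>\<tau> s' k'. exec M (While e c) s \<tau> s' \<and> \<tau> \<le> k * (cost e + 1 + b) + cost e + 1 \<and>
      I k' s' \<and> val e s' = 0" if "I k s" for k s
    using that
  proof (induction k arbitrary: s)
    case 0
    then have "fits M e s" "val e s = 0" using body[of 0 s] by auto
    then show ?case using exec.WhileFalse[of M e s c] 0 by fastforce
  next
    case (Suc k)
    show ?case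
    proof (cases "val e s = 0")
      case True
      then show ?thesis using exec.WhileFalse[of M e s c] Suc.prems body[of "Suc k" s] by fastforce
    next
      case False
      with body[OF Suc.prems] obtain \<tau>1 s1 where
        1: "fits M e s" "exec M c s \<tau>1 s1" "\<tau>1 \<le> b" "I k s1"
        by (auto simp: runs_def)
      from Suc.IH[OF 1(4)] obtain \<tau>2 s2 k' where
        2: "exec M (While e c) s1 \<tau>2 s2" "\<tau>2 \<le> k * (cost e + 1 + b) + cost e + 1"
          "I k' s2" "val e s2 = 0"
        by blast
      have "exec M (While e c) s (cost e + 1 + \<tau>1 + \<tau>2) s2"
        using 1 2 False by (intro exec.WhileTrue)
      moreover have "cost e + 1 + \<tau>1 + \<tau>2 \<le> Suc k * (cost e + 1 + b) + cost e + 1"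
        using 1(3) 2(2) by simp
      ultimately show ?thesis using 2 by blast
    qed
  qed
  from this[OF assms(1)] show ?thesis unfolding runs_def using exit by blast
qed

section \<open>Frame rule and absence of overflow\<close>

fun assigned :: "com \<Rightarrow> string set" where
  "assigned Skip = {}"
| "assigned (Assign x e) = {x}"
| "assigned (Write a e1 e2) = {}"
| "assigned (Seq c1 c2) = assigned c1 \<union> assigned c2"
| "assigned (Cond e c1 c2) = assigned c1 \<union> assigned c2"
| "assigned (While e c) = assigned c"

fun written :: "com \<Rightarrow> string set" where
  "written Skip = {}"
| "written (Assign x e) = {}"
| "written (Write a e1 e2) = {a}"
| "written (Seq c1 c2) = written c1 \<union> written c2"
| "written (Cond e c1 c2) = written c1 \<union> written c2"
| "written (While e c) = written c"

lemma exec_frame: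
  "exec M c s \<tau> s' \<Longrightarrow>
    (\<forall>x. x \<notin> assigned c \<longrightarrow> regs s' x = regs s x) \<and> (\<forall>a. a \<notin> written c \<longrightarrow> arrs s' a = arrs s a)"
  by (induction rule: exec.induct) auto

text \<open>Specifications need only mention what a fragment computes; that all else is unchanged is
  recovered from the syntactic sets of assigned registers and written arrays.\<close>

lemma runs_frame:
  assumes "runs M c s Q"
    and "\<And>\<tau> s'. Q \<tau> s' \<Longrightarrow> (\<And>x. x \<notin> assigned c \<Longrightarrow> regs s' x = regs s x) \<Longrightarrow>
      (\<And>a. a \<notin> written c \<Longrightarrow> arrs s' a = arrs s a) \<Longrightarrow> Q' \<tau> s'"
  shows "runs M c s Q'"
  using assms exec_frame unfolding runs_def by meson

text \<open>
  Expressions built from words below \<open>Y\<close> have values below \<open>Y ^ cost e\<close>, whence no overflow occurs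
  with words below a fixed power of \<open>Y\<close>.
\<close>

fun small :: "nat \<Rightarrow> expr \<Rightarrow> mem \<Rightarrow> bool" where
  "small Y (Const k) s \<longleftrightarrow> k < Y"
| "small Y (Reg x) s \<longleftrightarrow> regs s x < Y"
| "small Y (Read a e) s \<longleftrightarrow> small Y e s \<and> arrs s a (val e s) < Y"
| "small Y (Op f e1 e2) s \<longleftrightarrow> small Y e1 s \<and> small Y e2 s"

lemma cost_pos: "0 < cost e"
  by (cases e) auto

text \<open>Powers \<open>Y ^ cost e\<close> are at least 2, so a sum of two is at most their
  product. The unit charged for the operation itself supplies one more factor \<open>Y\<close> and
  with it the strict inequality.\<close>

lemma small_val:
  assumes "2 \<le> Y" "small Y e s"
  shows "val e s < Y ^ cost e"
  using assms(2)
proof (induction e)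
  case (Read a e)
  then have "val (Read a e) s < Y ^ 1" by simp
  also have "\<dots> \<le> Y ^ cost (Read a e)" using assms(1) by (intro power_increasing) auto
  finally show ?case .
next
  case (Op f e1 e2)
  let ?a = "val e1 s" and ?b = "val e2 s" and ?A = "Y ^ cost e1" and ?B = "Y ^ cost e2"
  have a: "?a < ?A" and b: "?b < ?B" using Op by auto
  have A: "2 \<le> ?A" "2 \<le> ?B"
    using assms(1) cost_pos[of e1] cost_pos[of e2]
      power_increasing[of 1 "cost e1" Y] power_increasing[of 1 "cost e2" Y] by auto
  have sum: "?A + ?B \<le> ?A * ?B"
    using A by (metis add_le_mono mult_2 mult_le_mono1 mult_le_mono2 nat_le_linear order_trans mult.commute mult_2_right)
  have "?a * ?b \<le> ?A * ?B" using a b by (intro mult_mono) auto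
  moreover have "?a \<le> ?A * ?B" using a sum by linarith
  ultimately have "apply_op f ?a ?b \<le> ?A * ?B"
    using a b A sum
    by (cases f) (auto intro: order_trans[OF div_le_dividend] order_trans[OF mod_less_eq_dividend])
  also have "\<dots> < Y ^ cost (Op f e1 e2)"
    using assms(1) A by (simp add: power_add)
  finally show ?case by simp
qed simp_all

lemma small_imp_fits:
  assumes "2 \<le> Y" "Y ^ q \<le> M" "small Y e s" "cost e \<le> q"
  shows "fits M e s"
  using assms(3,4)
proof (induction e)
  case (Op f e1 e2)
  have "val (Op f e1 e2) s < Y ^ cost (Op f e1 e2)"
    using small_val[OF assms(1) Op.prems(1)] .
  also have "\<dots> \<le> Y ^ q" using assms(1) Op.prems(2) by (intro power_increasing) auto
  finally show ?case using Op assms(2) by simp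
next
  case (Read a e)
  then have "val (Read a e) s < Y ^ 1" by simp
  also have "\<dots> \<le> Y ^ q" using assms(1) Read.prems(2) by (intro power_increasing) auto
  finally show ?case using Read assms(2) by simp
next
  case (Const k)
  then have "k < Y ^ 1" by simp
  also have "\<dots> \<le> Y ^ q" using assms(1) Const.prems(2) by (intro power_increasing) auto
  finally show ?case using assms(2) by simp
next
  case (Reg x)
  then have "regs s x < Y ^ 1" by simp
  also have "\<dots> \<le> Y ^ q" using assms(1) Reg.prems(2) by (intro power_increasing) auto
  finally show ?case using assms(2) by simp
qed

section \<open>A program computing the tensors\<close>

abbreviation num :: "bool list \<Rightarrow> nat" where
  "num i \<equiv> horner_sum of_bool 2 (rev i)"

lemma num_snoc: "num (i @ [b]) = 2 * num i + of_bool b"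
  by simp

lemma num_less: "num i < 2 ^ length i"
  using horner_sum_of_bool_2_less[of "rev i"] by simp

lemma num_bit:
  assumes "k < length i"
  shows "num i div 2 ^ (length i - Suc k) mod 2 = of_bool (i ! k)"
proof -
  have "bit (num i) (length i - Suc k) \<longleftrightarrow> i ! k"
    using assms by (auto simp: bit_horner_sum_bit_iff rev_nth)
  then show ?thesis by (simp add: bit_iff_odd mod_2_eq_odd)
qed

lemma num_inject: "length i = length j \<Longrightarrow> num i = num j \<Longrightarrow> i = j"
  by (rule nth_equalityI) (metis num_bit of_bool_eq_iff)+

lemma num_surj: "n < 2 ^ t \<Longrightarrow> \<exists>i. length i = t \<and> num i = n"
  by (rule exI[of _ "rev (map (bit n) [0..<t])"])
    (simp add: horner_sum_bit_eq_take_bit take_bit_nat_eq_self)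

abbreviation add_expr (infixl "\<oplus>" 65) where "a \<oplus> b \<equiv> Op Add a b"
abbreviation sub_expr (infixl "\<ominus>" 65) where "a \<ominus> b \<equiv> Op Sub a b"
abbreviation mul_expr (infixl "\<otimes>" 70) where "a \<otimes> b \<equiv> Op Mul a b"
abbreviation div_expr (infixl "\<oslash>" 70) where "a \<oslash> b \<equiv> Op Div a b"
abbreviation mod_expr (infixl "\<odot>" 70) where "a \<odot> b \<equiv> Op Mod a b"
abbreviation less_expr (infix "\<prec>" 50) where "a \<prec> b \<equiv> Op Less a b"
abbreviation equal_expr (infix "\<doteq>" 50) where "a \<doteq> b \<equiv> Op Equal a b"
abbreviation assign_com (infix "::=" 45) where "x ::= e \<equiv> Assign x e"
abbreviation seq_com (infixr ";;" 40) where "c ;; d \<equiv> Seq c d"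

text \<open>\<open>Y\<close> bounds the words held in memory and the constants of the program. The
  exponent 30 exceeds the cost of every expression that occurs, so all intermediate values stay
  below \<open>M\<close>.\<close>

locale word_ram =
  fixes M Y :: nat
  assumes Y_ge: "10 \<le> Y" and Y_power: "Y ^ 30 \<le> M"
begin

lemma fits_small [simp]: "small Y e s \<Longrightarrow> cost e \<le> 30 \<Longrightarrow> fits M e s"
  using small_imp_fits[of Y 30 M e s] Y_ge Y_power by simp

lemma numeral_less_Y [simp]: "0 < Y" "Suc 0 < Y" "2 < Y" "3 < Y" "4 < Y" "6 < Y"
  using Y_ge by simp_all

declare fits.simps [simp del]

end

section \<open>Reading numbers off an index and evaluating a leaf on the machine\<close>

text \<open>\<open>pw\<close> is the binary weight of the position reached in the index and loses a
  factor 4 per pair of bits. After this division the factor \<open>sh = 2\<close> addresses the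
  first bit of the pair and \<open>sh = 1\<close> the second.\<close>

definition read_code :: "string \<Rightarrow> string \<Rightarrow> string \<Rightarrow> string \<Rightarrow> nat \<Rightarrow> com" where
  "read_code x src pw cnt sh =
    (''c'' ::= Reg cnt ;;
     While (Reg ''c'')
       (pw ::= Reg pw \<oslash> Const 4 ;;
        x ::= Const 2 \<otimes> Reg x \<oplus> (Reg src \<oslash> (Reg pw \<otimes> Const sh)) \<odot> Const 2 ;;
        ''c'' ::= Reg ''c'' \<ominus> Const 1))"

lemma read_code_frame [simp]:
  "assigned (read_code x src pw cnt sh) = {''c'', pw, x}" "written (read_code x src pw cnt sh) = {}"
  by (auto simp: read_code_def)

lemma (in word_ram) runs_read_code:
  assumes src: "regs s src = num i" and pw: "regs s pw = 2 ^ (length i - pos)"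
    and pos: "pos + 2 * n \<le> length i" and cnt: "regs s cnt = n"
    and sh: "sh = (if e then 2 else 1)"
    and bnd: "2 ^ length i < Y" "(regs s x + 1) * 2 ^ n \<le> Y" "n < Y"
    and dist: "distinct [x, src, pw, ''c'']"
  shows "runs M (read_code x src pw cnt sh) s (\<lambda>\<tau> s'. \<tau> \<le> n * 30 + 10 \<and>
    regs s' x = read_bits e n (regs s x) (drop pos i) \<and> regs s' pw = 2 ^ (length i - (pos + 2 * n)))"
proof -
  \<comment> \<open>The product \<open>(x + 1) * 2 ^ k\<close> does not grow when \<open>x\<close>
    takes up a bit and \<open>k\<close> drops by one, which keeps the accumulated number below
    \<open>Y\<close>.\<close>
  define I where "I k s' \<longleftrightarrow> k \<le> n \<and> regs s' ''c'' = k \<and> regs s' src = num i \<and>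
    regs s' pw = 2 ^ (length i - (pos + 2 * (n - k))) \<and> (regs s' x + 1) * 2 ^ k \<le> Y \<and>
    read_bits e k (regs s' x) (drop (pos + 2 * (n - k)) i) = read_bits e n (regs s x) (drop pos i)"
    for k and s' :: mem
  let ?s = "s\<lparr>regs := (regs s)(''c'' := n)\<rparr>"
  have "I n ?s" using assms by (auto simp: I_def)
  have numY: "num i < Y" using num_less[of i] bnd(1) by linarith
  have "runs M (While (Reg ''c'')
       (pw ::= Reg pw \<oslash> Const 4 ;;
        x ::= Const 2 \<otimes> Reg x \<oplus> (Reg src \<oslash> (Reg pw \<otimes> Const sh)) \<odot> Const 2 ;;
        ''c'' ::= Reg ''c'' \<ominus> Const 1)) ?s
     (\<lambda>\<tau> s'. \<tau> \<le> n * 22 + 2 \<and>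
       regs s' x = read_bits e n (regs s x) (drop pos i) \<and> regs s' pw = 2 ^ (length i - (pos + 2 * n)))"
  proof (rule runs_While[where I = I and n = n and b = 20])
    show "I n ?s" by fact
  next
    fix k s' assume I: "I k s'"
    have x: "regs s' x < Y"
    proof -
      have "(regs s' x + 1) * 1 \<le> (regs s' x + 1) * 2 ^ k" by (intro mult_left_mono) auto
      then show ?thesis using I by (simp add: I_def)
    qed
    have pwY: "(2::nat) ^ q < Y" if "q \<le> length i" for q
      using power_increasing[OF that, of "2::nat"] bnd(1) by linarith
    show "fits M (Reg ''c'') s' \<and> (val (Reg ''c'') s' \<noteq> 0 \<longrightarrow> 0 < k \<and> runs M
       (pw ::= Reg pw \<oslash> Const 4 ;;
        x ::= Const 2 \<otimes> Reg x \<oplus> (Reg src \<oslash> (Reg pw \<otimes> Const sh)) \<odot> Const 2 ;;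
        ''c'' ::= Reg ''c'' \<ominus> Const 1) s' (\<lambda>\<tau> s'. \<tau> \<le> 20 \<and> I (k - 1) s'))"
    proof (intro conjI impI)
      show "fits M (Reg ''c'') s'" using I bnd by (simp add: I_def)
      assume "val (Reg ''c'') s' \<noteq> 0"
      then show k: "0 < k" using I by (simp add: I_def)
      define q where "q = pos + 2 * (n - k)"
      have q: "q + 2 \<le> length i" "q + 2 = pos + 2 * (n - (k - 1))"
        using k I pos by (auto simp: q_def I_def)
      have pw4: "(2::nat) ^ (length i - q) div 4 = 2 ^ (length i - (q + 2))"
      proof -
        have "length i - q = length i - (q + 2) + 2" using q by simp
        then have "(2::nat) ^ (length i - q) = 2 ^ (length i - (q + 2)) * 4"
          by (simp only: power_add) simp
        then show ?thesis by simp
      qed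
      have bit: "num i div (2 ^ (length i - (q + 2)) * sh) mod 2
        = of_bool (drop q i ! (if e then 0 else 1))"
      proof (cases e)
        case True
        have "Suc (length i - (q + 2)) = length i - Suc q" using q by simp
        then have "(2::nat) ^ (length i - (q + 2)) * sh = 2 ^ (length i - Suc q)"
          unfolding sh by (metis True mult.commute power_Suc)
        then show ?thesis using num_bit[of q i] q True by simp
      next
        case False
        then show ?thesis using num_bit[of "Suc q" i] q sh by simp
      qed
      have shY: "sh < Y" using sh Y_ge by simp
      define x' where "x' = 2 * regs s' x + of_bool (drop q i ! (if e then 0 else 1))"
      have x': "(x' + 1) * 2 ^ (k - 1) \<le> Y"
      proof -
        have "(x' + 1) * 2 ^ (k - 1) \<le> (2 * (regs s' x + 1)) * 2 ^ (k - 1)"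
          unfolding x'_def by (intro mult_right_mono) auto
        also have "\<dots> = (regs s' x + 1) * 2 ^ k" using k by (cases k) auto
        finally show ?thesis using I by (simp add: I_def)
      qed
      obtain k' where k': "k = Suc k'" using k by (cases k) auto
      have "read_bits e k (regs s' x) (drop q i) = read_bits e n (regs s x) (drop pos i)"
        using I by (simp add: I_def q_def)
      then have rb: "read_bits e (k - 1) x' (drop (q + 2) i) = read_bits e n (regs s x) (drop pos i)"
        by (simp add: k' x'_def add.commute)
      define q' where "q' = q + 2"
      have q': "pos + 2 * (n - (k - Suc 0)) = q'" using q by (simp add: q'_def)
      have x'_eq: "2 * regs s' x + num i div (2 ^ (length i - q') * sh) mod 2 = x'"
        using bit by (simp add: x'_def q'_def)
      have d: "pw \<noteq> x" "x \<noteq> pw" "src \<noteq> x" "x \<noteq> src" "''c'' \<noteq> pw" "''c'' \<noteq> x" "src \<noteq> ''c''"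
        "pw \<noteq> ''c''" "x \<noteq> ''c''" "src \<noteq> pw" "''c'' \<noteq> src" "pw \<noteq> src"
        using dist by auto
      have regs: "regs s' pw = 2 ^ (length i - q)" "regs s' src = num i" "regs s' ''c'' = k"
        "k - Suc 0 \<le> n" "k < Y"
        using I bnd by (auto simp: I_def q_def)
      show "runs M (pw ::= Reg pw \<oslash> Const 4 ;;
        x ::= Const 2 \<otimes> Reg x \<oplus> (Reg src \<oslash> (Reg pw \<otimes> Const sh)) \<odot> Const 2 ;;
        ''c'' ::= Reg ''c'' \<ominus> Const 1) s' (\<lambda>\<tau> s'. \<tau> \<le> 20 \<and> I (k - 1) s')"
        using numY shY x pwY[of "length i - q"] pwY[of "length i - q'"] x' rb[folded q'_def]
        by (simp add: d regs pw4[folded q'_def] I_def q' x'_eq q'_def[symmetric])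
    qed
  next
    fix k s' \<tau> assume "I k s'" "val (Reg ''c'') s' = 0" "\<tau> \<le> n * (cost (Reg ''c'') + 1 + 20) + cost (Reg ''c'') + 1"
    then show "\<tau> \<le> n * 22 + 2 \<and> regs s' x = read_bits e n (regs s x) (drop pos i) \<and>
      regs s' pw = 2 ^ (length i - (pos + 2 * n))"
      by (auto simp: I_def)
  qed
  then show ?thesis
    using cnt bnd(3) unfolding read_code_def by (auto elim!: runs_mono)
qed

text \<open>An iterative form of \<open>descend\<close>: \<open>hl\<close> runs through the powers
  of two that halve the interval, and \<open>gg\<close> counts the remaining steps.\<close>

definition descend_code :: com where
  "descend_code =
    (''qw'' ::= Reg ''Q'' ;; ''hl'' ::= Reg ''H'' ;; ''lo'' ::= Const 0 ;; ''uu'' ::= Const 0 ;;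
     ''vv'' ::= Const 0 ;; ''gg'' ::= Reg ''K'' ;;
     While (Reg ''gg'')
       (''hl'' ::= Reg ''hl'' \<oslash> Const 2 ;; ''z'' ::= Const 0 ;;
        read_code ''z'' ''w'' ''qw'' ''L'' 2 ;;
        Cond ((Reg ''w'' \<oslash> Reg ''qw'') \<odot> Const 2)
          (''lo'' ::= Reg ''lo'' \<oplus> Reg ''hl'' ;; ''uu'' ::= Reg ''z'')
          (''vv'' ::= Reg ''z'') ;;
        ''gg'' ::= Reg ''gg'' \<ominus> Const 1))"

text \<open>The descent names nodes below \<open>2 ^ L\<close>, possibly beyond the width; these
  have no edges, and a lookup at them would leave the proper cells of the adjacency table, so they
  are caught beforehand. The last expression computes the disjunction
  \<open>u = v \<or> side \<noteq> 0\<close>.\<close>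

definition share_code :: "string \<Rightarrow> com" where
  "share_code arr =
    Cond (Reg ''lo'' \<prec> Reg ''T'' \<ominus> Const 1)
      (''h'' ::= Read ''label'' (Reg ''lo'') ;;
       Cond (Reg ''h'' \<oslash> Reg ''n2'' \<doteq> Reg ''side'')
         (Cond (Reg ''uu'' \<prec> Reg ''W'')
            (Cond (Reg ''vv'' \<prec> Reg ''W'')
               (''y'' ::= Read arr (Reg ''k'' \<otimes> Reg ''n2'' \<oplus> Reg ''h'' \<odot> Reg ''n2'') ;;
                ''f'' ::= Read ''edge'' (((Reg ''lo'' \<otimes> Reg ''W'' \<oplus> Reg ''uu'') \<otimes> Const 2 \<oplus> Reg ''y'')
                  \<otimes> Reg ''W'' \<oplus> Reg ''vv''))
               (''f'' ::= Const 0))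
            (''f'' ::= Const 0))
         (''f'' ::= Const 1))
      (''f'' ::= Const 0 \<prec> ((Reg ''uu'' \<doteq> Reg ''vv'') \<oplus> Reg ''side''))"

definition leaf_code :: "string \<Rightarrow> com" where
  "leaf_code a = (descend_code ;; share_code a)"

text \<open>The computation of one party. The same code is run for both, with different
  \<open>side\<close>, input array and output array.\<close>

locale bp_machine = word_ram +
  fixes P :: bp and L K p \<kappa> \<mu> side :: nat and xs :: "bool list list" and arr out :: string
  assumes P: "branching_program P" and even_inputs: "even (bp_inputs P)"
    and p: "1 < p" "2 ^ \<kappa> \<le> p" and side: "side \<le> 1" and L_pos: "0 < L \<or> K = 0"
    and names: "arr = ''A'' \<or> arr = ''B''" "out = ''U'' \<or> out = ''V''"
    and bounds: "2 ^ L < Y" "2 * 2 ^ K < Y" "2 ^ (2 * L * K) < Y" "p < Y" "2 * 2 ^ \<mu> < Y"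
      "2 ^ (rounds (2 * L * K) 0 * (6 * \<mu> + 2 * \<kappa>) + 2 * \<mu>) < Y" "rounds (2 * L * K) 0 < Y"
      "bp_inputs P < Y" "bp_length P < Y" "bp_width P < Y" "length xs < Y"
begin

abbreviation m :: nat where "m \<equiv> 2 * L * K"
abbreviation t :: nat where "t \<equiv> rounds m 0 * (6 * \<mu> + 2 * \<kappa>) + 2 * \<mu>"

definition env_regs :: "(string \<Rightarrow> nat) \<Rightarrow> bool" where
  "env_regs f \<longleftrightarrow> f ''L'' = L \<and> f ''K'' = K \<and> f ''m'' = m \<and> f ''Q'' = 2 ^ m \<and> f ''H'' = 2 ^ K \<and>
     f ''p'' = p \<and> f ''kap'' = \<kappa> \<and> f ''ell'' = \<mu> \<and> f ''n2'' = bp_inputs P div 2 \<and>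
     f ''T'' = bp_length P \<and> f ''W'' = bp_width P \<and> f ''D'' = 2 ^ t \<and> f ''R'' = rounds m 0 \<and>
     f ''side'' = side \<and> f ''N'' = length xs"

definition env_arrs :: "(string \<Rightarrow> nat \<Rightarrow> nat) \<Rightarrow> bool" where
  "env_arrs f \<longleftrightarrow>
     (\<forall>i < bp_length P - 1. f ''label'' i = bp_label P i) \<and>
     (\<forall>i < bp_length P - 1. \<forall>u < bp_width P. \<forall>b. \<forall>v < bp_width P.
        f ''edge'' (((i * bp_width P + u) * 2 + of_bool b) * bp_width P + v)
          = of_bool ((i, u, b, v) \<in> bp_edges P)) \<and>
     (\<forall>k < length xs. \<forall>j < bp_inputs P div 2.
        f arr (k * (bp_inputs P div 2) + j) = of_bool (xs ! k ! j))"

abbreviation env :: "mem \<Rightarrow> bool" where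
  "env s \<equiv> env_regs (regs s) \<and> env_arrs (arrs s)"

definition env_names :: "string set" where
  "env_names = {''L'', ''K'', ''m'', ''Q'', ''H'', ''p'', ''kap'', ''ell'', ''n2'',
    ''T'', ''W'', ''D'', ''R'', ''side'', ''N''}"

lemma env_regs_cong:
  assumes "env_regs f" "\<And>x. x \<in> env_names \<Longrightarrow> g x = f x"
  shows "env_regs g"
  using assms by (simp add: env_regs_def env_names_def)

lemma env_regs_upd:
  assumes "x \<notin> env_names"
  shows "env_regs (f(x := v)) = env_regs f"
proof -
  have "(f(x := v)) y = f y" if "y \<in> env_names" for y
    using that assms by (metis fun_upd_other)
  then show ?thesis by (metis env_regs_cong)
qed

lemmas env_upd [simp] = env_regs_upd[unfolded env_names_def]

lemma env_arrs_upd [simp]: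
  assumes "a \<notin> {''label'', ''edge'', ''A'', ''B''}"
  shows "env_arrs (f(a := v)) = env_arrs f"
proof -
  have "(f(a := v)) ''label'' = f ''label''" "(f(a := v)) ''edge'' = f ''edge''" "(f(a := v)) arr = f arr"
    using assms names(1) by (metis fun_upd_other insertCI)+
  then show ?thesis unfolding env_arrs_def by (simp only:)
qed

lemma env_arrs_cong:
  assumes "env_arrs f" "\<And>x. x \<in> {''label'', ''edge'', ''A'', ''B''} \<Longrightarrow> g x = f x"
  shows "env_arrs g"
proof -
  have "g ''label'' = f ''label''" "g ''edge'' = f ''edge''" "g arr = f arr"
    using assms(2) names(1) by auto
  then show ?thesis using assms(1) unfolding env_arrs_def by simp
qed

lemma less_Y [simp]: "L < Y" "K < Y" "m < Y" "\<mu> < Y" "\<kappa> < Y" "2 ^ K < Y" "2 ^ \<kappa> < Y" "2 ^ \<mu> < Y"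
  "bp_inputs P div 2 < Y" "p < Y" "bp_length P < Y" "bp_width P < Y" "2 ^ t < Y" "side < Y" "2 ^ m < Y"
  "2 ^ L < Y" "rounds m 0 < Y" "length xs < Y"
  using bounds p side less_exp[of L] less_exp[of K] less_exp[of m] less_exp[of \<mu>] less_exp[of \<kappa>] Y_ge
    div_le_dividend[of "bp_inputs P" 2]
  by linarith+

lemma runs_descend_code:
  assumes env: "env s" and w: "regs s ''w'' = num bs" and len: "length bs = m"
  shows "runs M descend_code s (\<lambda>\<tau> s'. \<tau> \<le> K * (L * 30 + 50) + 20 \<and>
    descend L K 0 0 0 bs = (regs s' ''lo'', regs s' ''uu'', regs s' ''vv'') \<and>
    regs s' ''lo'' < 2 ^ K \<and> regs s' ''uu'' < 2 ^ L \<and> regs s' ''vv'' < 2 ^ L)"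
proof -
  \<comment> \<open>The remaining descent from the current state has the result of the whole
    descent; \<open>lo + 2 ^ k\<close> being at most \<open>2 ^ K\<close> says that the current
    interval lies within the padded layers.\<close>
  define I where "I k s' \<longleftrightarrow> k \<le> K \<and> env s' \<and> regs s' ''w'' = num bs \<and> regs s' ''gg'' = k \<and>
    regs s' ''hl'' = 2 ^ k \<and> regs s' ''qw'' = 2 ^ (m - 2 * L * (K - k)) \<and>
    regs s' ''lo'' + 2 ^ k \<le> 2 ^ K \<and> regs s' ''uu'' < 2 ^ L \<and> regs s' ''vv'' < 2 ^ L \<and>
    descend L k (regs s' ''lo'') (regs s' ''uu'') (regs s' ''vv'') (drop (2 * L * (K - k)) bs)
      = descend L K 0 0 0 bs" for k and s' :: mem
  have wY: "num bs < Y" using num_less[of bs] less_Y(15) unfolding len by linarith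
  let ?body = "''hl'' ::= Reg ''hl'' \<oslash> Const 2 ;; ''z'' ::= Const 0 ;;
        read_code ''z'' ''w'' ''qw'' ''L'' 2 ;;
        Cond ((Reg ''w'' \<oslash> Reg ''qw'') \<odot> Const 2)
          (''lo'' ::= Reg ''lo'' \<oplus> Reg ''hl'' ;; ''uu'' ::= Reg ''z'')
          (''vv'' ::= Reg ''z'') ;;
        ''gg'' ::= Reg ''gg'' \<ominus> Const 1"
  have loop: "runs M (While (Reg ''gg'') ?body) s' (\<lambda>\<tau> s''. \<tau> \<le> K * (L * 30 + 50) + 2 \<and> I 0 s'')"
    if "I K s'" for s'
  proof (rule runs_While[where I = I and n = K and b = "L * 30 + 48"])
    fix k s' assume I: "I k s'"
    then have gg: "regs s' ''gg'' = k" "k < Y"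
      using less_Y(2) unfolding I_def by (blast, linarith)
    show "fits M (Reg ''gg'') s' \<and>
      (val (Reg ''gg'') s' \<noteq> 0 \<longrightarrow> 0 < k \<and> runs M ?body s' (\<lambda>\<tau> s'. \<tau> \<le> L * 30 + 48 \<and> I (k - 1) s'))"
    proof (intro conjI impI)
      show "fits M (Reg ''gg'') s'" using gg by simp
      assume "val (Reg ''gg'') s' \<noteq> 0"
      then show k: "0 < k" using gg by simp
      then obtain k' where k': "k = Suc k'" by (cases k) auto
      define q where "q = 2 * L * (K - k)"
      define q' where "q' = 2 * L * (K - k')"
      have kK: "k \<le> K" using I by (simp add: I_def)
      have L0: "0 < L" using k kK L_pos by simp
      have "K - k' = Suc (K - k)" using kK k' by simp
      then have q: "q + 2 * L = q'" by (simp add: q_def q'_def)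
      have q'm: "q' \<le> m" by (simp add: q'_def)
      have e: "env_regs (regs s')" "env_arrs (arrs s')" using I by (auto simp: I_def)
      note eL = e(1)[unfolded env_regs_def]
      have r: "regs s' ''w'' = num bs" "regs s' ''hl'' = 2 ^ k" "regs s' ''qw'' = 2 ^ (m - q)"
        "regs s' ''lo'' + 2 ^ k \<le> 2 ^ K" "regs s' ''uu'' < 2 ^ L" "regs s' ''vv'' < 2 ^ L"
        "descend L k (regs s' ''lo'') (regs s' ''uu'') (regs s' ''vv'') (drop q bs) = descend L K 0 0 0 bs"
        using I by (auto simp: I_def q_def)
      have hlY: "2 ^ k < Y" "2 ^ k' < Y" "regs s' ''lo'' < Y"
      proof -
        have "k' \<le> K" using kK k' by simp
        then have "(2::nat) ^ k \<le> 2 ^ K" "(2::nat) ^ k' \<le> 2 ^ K"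
          using kK by (auto intro: power_increasing)
        then show "2 ^ k < Y" "2 ^ k' < Y" "regs s' ''lo'' < Y"
          using less_Y(6) r(4) by linarith+
      qed
      let ?s1 = "s'\<lparr>regs := (regs s')(''hl'' := 2 ^ k', ''z'' := 0)\<rparr>"
      have read: "runs M (read_code ''z'' ''w'' ''qw'' ''L'' 2) ?s1 (\<lambda>\<tau> s''. \<tau> \<le> L * 30 + 10 \<and>
        regs s'' ''z'' = read_bits True L (regs ?s1 ''z'') (drop q bs) \<and>
        regs s'' ''qw'' = 2 ^ (length bs - (q + 2 * L)))"
        using q q'm eL by (intro runs_read_code) (auto simp: r len less_imp_le)
      have cont: "runs M (Cond ((Reg ''w'' \<oslash> Reg ''qw'') \<odot> Const 2)
          (''lo'' ::= Reg ''lo'' \<oplus> Reg ''hl'' ;; ''uu'' ::= Reg ''z'')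
          (''vv'' ::= Reg ''z'') ;; ''gg'' ::= Reg ''gg'' \<ominus> Const 1) s''
          (\<lambda>\<tau>' s'''. 6 + (\<tau> + \<tau>') \<le> L * 30 + 48 \<and> I k' s''')"
        if \<tau>: "\<tau> \<le> L * 30 + 10" and z: "regs s'' ''z'' = read_bits True L 0 (drop q bs)"
          and qw: "regs s'' ''qw'' = 2 ^ (m - q')"
          and fr: "\<And>x. x \<notin> {''c'', ''qw'', ''z''} \<Longrightarrow> regs s'' x = regs ?s1 x"
          and fa: "arrs s'' = arrs s'" for \<tau> s''
      proof -
        define z0 where "z0 = read_bits True L 0 (drop q bs)"
        have e'': "env_regs (regs s'')"
          by (rule env_regs_cong[OF e(1)]) (auto simp: fr env_names_def)
        have zL: "z0 < 2 ^ L"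
          using read_bits_less[of True L 0 "drop q bs"] by (simp add: z0_def)
        have zY: "z0 < Y" using zL less_Y(16) by linarith
        have qwY: "2 ^ (m - q') < Y"
          using power_increasing[of "m - q'" m "2::nat"] less_Y(15) by linarith
        have uY: "regs s' ''uu'' < Y" "regs s' ''vv'' < Y" using r less_Y(16) by linarith+
        \<comment> \<open>Once the block is read, \<open>qw\<close> is the weight of its last bit,
          number \<open>2 * L - 1\<close>: the universal bit that selects the half.\<close>
        have bit: "num bs div 2 ^ (m - q') mod 2 = of_bool (drop q bs ! (2 * L - 1))"
        proof -
          have "length bs - Suc (q + (2 * L - 1)) = m - q'" using q L0 by (simp add: len)
          moreover have "q + (2 * L - 1) < length bs" using q q'm L0 by (simp add: len)
          ultimately show ?thesis using num_bit[of "q + (2 * L - 1)" bs] by simp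
        qed
        have d: "descend L K 0 0 0 bs = (if drop q bs ! (2 * L - 1)
            then descend L k' (regs s' ''lo'' + 2 ^ k') z0 (regs s' ''vv'') (drop q' bs)
            else descend L k' (regs s' ''lo'') (regs s' ''uu'') z0 (drop q' bs))"
          using r(7) q by (auto simp: k' z0_def Let_def add.commute[of "2 * L"] split: if_splits)
        have lo: "regs s' ''lo'' + 2 ^ k' + 2 ^ k' \<le> 2 ^ K" using r(4) by (simp add: k')
        have loY: "regs s' ''lo'' + 2 ^ k' < Y" using lo less_Y(6) by linarith
        have kK': "k' \<le> K" using kK k' by simp
        have kY: "Suc k' < Y" using gg k' by simp
        show ?thesis
          using \<tau> e'' e(2) zL zY qwY uY d lo loY kK' kY wY hlY r(5,6)
          by (cases "drop q bs ! (2 * L - 1)")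
            (simp_all add: I_def fr fa z[folded z0_def] qw r(1-4) gg k' bit q'_def[symmetric])
      qed
      show "runs M ?body s' (\<lambda>\<tau> s'. \<tau> \<le> L * 30 + 48 \<and> I (k - 1) s')"
      proof -
        have head: "runs M (''hl'' ::= Reg ''hl'' \<oslash> Const 2 ;; ''z'' ::= Const 0 ;; rest) s'
          (\<lambda>\<tau> s'. \<tau> \<le> L * 30 + 48 \<and> I (k - 1) s')"
          if "runs M rest ?s1 (\<lambda>\<tau> s''. 6 + \<tau> \<le> L * 30 + 48 \<and> I k' s'')" for rest
          using hlY that by (simp add: r(2) k')
        show ?thesis
        proof (rule head, subst runs_Seq, rule runs_frame[OF read], rule cont)
          fix \<tau> s''
          assume "\<And>a. a \<notin> written (read_code ''z'' ''w'' ''qw'' ''L'' 2) \<Longrightarrow> arrs s'' a = arrs ?s1 a"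
          then show "arrs s'' = arrs s'" by (intro ext) simp
        qed (use q in \<open>auto simp: len\<close>)
      qed
    qed
  next
    show "I K s'" by fact
  next
    fix k s' \<tau> assume "I k s'" "val (Reg ''gg'') s' = 0"
      "\<tau> \<le> K * (cost (Reg ''gg'') + 1 + (L * 30 + 48)) + cost (Reg ''gg'') + 1"
    then show "\<tau> \<le> K * (L * 30 + 50) + 2 \<and> I 0 s'"
      by (simp add: I_def algebra_simps)
  qed
  have init: "I K (s\<lparr>regs := (regs s)(''qw'' := 2 ^ m, ''hl'' := 2 ^ K, ''lo'' := 0, ''uu'' := 0,
     ''vv'' := 0, ''gg'' := K)\<rparr>)"
    using env w by (simp add: I_def)
  have head: "runs M (''qw'' ::= Reg ''Q'' ;; ''hl'' ::= Reg ''H'' ;; ''lo'' ::= Const 0 ;;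
      ''uu'' ::= Const 0 ;; ''vv'' ::= Const 0 ;; ''gg'' ::= Reg ''K'' ;; rest) s Q"
    if "runs M rest (s\<lparr>regs := (regs s)(''qw'' := 2 ^ m, ''hl'' := 2 ^ K, ''lo'' := 0, ''uu'' := 0,
     ''vv'' := 0, ''gg'' := K)\<rparr>) (\<lambda>\<tau>. Q (12 + \<tau>))" for rest Q
    using env[unfolded env_regs_def]
    by (simp, intro runs_mono[OF that]) (simp add: eval_nat_numeral)
  show ?thesis
    unfolding descend_code_def by (rule head, rule runs_mono[OF loop[OF init]]) (auto simp: I_def)
qed

lemma descend_code_frame [simp]:
  "assigned descend_code = {''qw'', ''hl'', ''lo'', ''uu'', ''vv'', ''gg'', ''z'', ''c''}"
  "written descend_code = {}"
  by (auto simp: descend_code_def)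

lemma share_code_frame [simp]:
  "assigned (share_code a) = {''h'', ''y'', ''f''}" "written (share_code a) = {}"
  by (auto simp: share_code_def)

lemma runs_share_code:
  assumes env: "env s" and k: "regs s ''k'' = k" "k < length xs"
    and st: "regs s ''lo'' = lo" "regs s ''uu'' = u" "regs s ''vv'' = v"
    and bnd: "lo < Y" "u < Y" "v < Y"
  shows "runs M (share_code arr) s (\<lambda>\<tau> s'. \<tau> \<le> 80 \<and> regs s' ''f'' = share P side (xs ! k) lo u v)"
proof (cases "lo < bp_length P - 1")
  case False
  then show ?thesis
    using env[unfolded env_regs_def] bnd side
    by (auto simp: share_code_def st share_def)
next
  case lo: True
  let ?n = "bp_inputs P div 2" and ?h = "bp_label P lo"
  have h: "?h < bp_inputs P" using P lo by (simp add: branching_program_def)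
  then have n0: "0 < ?n" using even_inputs by (cases "bp_inputs P = 0") (auto elim!: evenE)
  have hY: "?h < Y" using h bounds(8) by linarith
  have kY: "k < Y" using k(2) less_Y(18) by linarith
  have lab: "arrs s ''label'' lo = ?h" using env lo by (simp add: env_arrs_def)
  have bit: "arrs s arr (k * ?n + ?h mod ?n) = of_bool (xs ! k ! (?h mod ?n))"
    using env k(2) n0 by (simp add: env_arrs_def)
  have edge: "arrs s ''edge'' (((lo * bp_width P + u) * 2 + of_bool b) * bp_width P + v)
      = of_bool ((lo, u, b, v) \<in> bp_edges P)" if "u < bp_width P" "v < bp_width P" for b
    using env lo that by (simp add: env_arrs_def)
  have noedge: "(lo, u, b, v) \<notin> bp_edges P" if "\<not> (u < bp_width P \<and> v < bp_width P)" for b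
    using P that by (auto simp: branching_program_def)
  have E: "regs s ''T'' = bp_length P" "regs s ''n2'' = ?n" "regs s ''side'' = side"
    "regs s ''W'' = bp_width P" using env by (auto simp: env_regs_def)
  have hdY: "of_bool b < Y" for b using Y_ge by (cases b) auto
  define b where "b = xs ! k ! (?h mod ?n)"
  define y where "y = (of_bool b :: nat)"
  define e where "e = (of_bool ((lo, u, b, v) \<in> bp_edges P) :: nat)"
  have small: "y < Y" "e < Y" using hdY by (simp_all add: y_def e_def)
  have share: "share P side (xs ! k) lo u v = (if ?h div ?n = side then e else 1)"
    using lo by (simp add: share_def e_def b_def)
  show ?thesis
  proof (cases "u < bp_width P \<and> v < bp_width P")
    case True
    then have "arrs s ''edge'' (((lo * bp_width P + u) * 2 + y) * bp_width P + v) = e"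
      using edge by (simp add: e_def y_def)
    then show ?thesis
      using lo bnd hY kY small True
      by (simp add: share_code_def st k E lab share bit[folded b_def, folded y_def])
  next
    case False
    then have "e = 0" using noedge by (simp add: e_def)
    then show ?thesis
      using lo bnd hY kY False by (auto simp: share_code_def st k E lab share)
  qed
qed

lemma leaf_code_frame [simp]:
  "assigned (leaf_code a) = {''qw'', ''hl'', ''lo'', ''uu'', ''vv'', ''gg'', ''z'', ''c'', ''h'', ''y'', ''f''}"
  "written (leaf_code a) = {}"
  by (auto simp: leaf_code_def)

lemma runs_leaf_code:
  assumes env: "env s" and w: "regs s ''w'' = num bs" and len: "length bs = m"
    and k: "regs s ''k'' = k" "k < length xs"
  shows "runs M (leaf_code arr) s (\<lambda>\<tau> s'. \<tau> \<le> K * (L * 30 + 50) + 100 \<and>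
    regs s' ''f'' = leaf_share P L K side (xs ! k) bs)"
  unfolding leaf_code_def
proof (subst runs_Seq, rule runs_frame[OF runs_descend_code[OF env w len]])
  fix \<tau> and s' :: mem
  assume d: "\<tau> \<le> K * (L * 30 + 50) + 20 \<and>
    descend L K 0 0 0 bs = (regs s' ''lo'', regs s' ''uu'', regs s' ''vv'') \<and>
    regs s' ''lo'' < 2 ^ K \<and> regs s' ''uu'' < 2 ^ L \<and> regs s' ''vv'' < 2 ^ L"
    and fr: "\<And>x. x \<notin> assigned descend_code \<Longrightarrow> regs s' x = regs s x"
    and fa: "\<And>a. a \<notin> written descend_code \<Longrightarrow> arrs s' a = arrs s a"
  have e: "env_regs (regs s')" "env_arrs (arrs s')"
    using env by (auto intro!: env_regs_cong[of "regs s"] env_arrs_cong[of "arrs s"] fr fa simp: env_names_def)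
  have Y: "regs s' ''lo'' < Y" "regs s' ''uu'' < Y" "regs s' ''vv'' < Y"
    using d less_Y(6,16) by linarith+
  have "regs s' ''k'' = k" using k by (simp add: fr)
  then have "runs M (share_code arr) s' (\<lambda>\<tau> s''. \<tau> \<le> 80 \<and>
      regs s'' ''f'' = share P side (xs ! k) (regs s' ''lo'') (regs s' ''uu'') (regs s' ''vv''))"
    using e k Y by (intro runs_share_code) auto
  then show "runs M (share_code arr) s' (\<lambda>\<tau>2 s''. \<tau> + \<tau>2 \<le> K * (L * 30 + 50) + 100 \<and>
      regs s'' ''f'' = leaf_share P L K side (xs ! k) bs)"
    by (rule runs_mono) (use d in \<open>auto simp: leaf_share_def\<close>)
qed

end

section \<open>Evaluating the multilinear extension of a party's shares\<close>

definition table_code :: "string \<Rightarrow> com" where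
  "table_code a =
    (''w'' ::= Const 0 ;;
     While (Reg ''w'' \<prec> Reg ''Q'')
       (leaf_code a ;; Write ''F'' (Reg ''w'') (Reg ''f'') ;; ''w'' ::= Reg ''w'' \<oplus> Const 1))"

text \<open>Leaves that differ only in their last bit are adjacent, so the variables are eliminated
  from the last to the first, in place, each pass halving the table. \<open>p + 1 - r\<close> stands
  for \<open>1 - r\<close> modulo \<open>p\<close> without negative numbers.\<close>

definition fold_code :: com where
  "fold_code =
    (''j2'' ::= Reg ''m'' ;; ''hq'' ::= Reg ''Q'' ;;
     While (Reg ''j2'')
       (''j2'' ::= Reg ''j2'' \<ominus> Const 1 ;; ''hq'' ::= Reg ''hq'' \<oslash> Const 2 ;; ''w'' ::= Const 0 ;;
        While (Reg ''w'' \<prec> Reg ''hq'')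
          (Write ''F'' (Reg ''w'')
             ((Read ''F'' (Const 2 \<otimes> Reg ''w'') \<otimes> (Reg ''p'' \<oplus> Const 1 \<ominus> Read ''r'' (Reg ''j2''))
               \<oplus> Read ''r'' (Reg ''j2'') \<otimes> Read ''F'' (Const 2 \<otimes> Reg ''w'' \<oplus> Const 1)) \<odot> Reg ''p'') ;;
           ''w'' ::= Reg ''w'' \<oplus> Const 1)))"

lemma leaf_share_le_1: "leaf_share P L K side x bs \<le> 1"
  using share_le_1 by (auto simp: leaf_share_def split: prod.split)

context bp_machine
begin

lemma table_code_frame [simp]:
  "assigned (table_code a) =
    {''w'', ''qw'', ''hl'', ''lo'', ''uu'', ''vv'', ''gg'', ''z'', ''c'', ''h'', ''y'', ''f''}"
  "written (table_code a) = {''F''}"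
  by (auto simp: table_code_def)

lemma fold_code_frame [simp]:
  "assigned fold_code = {''j2'', ''hq'', ''w''}" "written fold_code = {''F''}"
  by (auto simp: fold_code_def)

lemma runs_table_code:
  assumes env: "env s" and k: "regs s ''k'' = k" "k < length xs"
  shows "runs M (table_code arr) s (\<lambda>\<tau> s'. \<tau> \<le> 2 ^ m * (K * (L * 30 + 50) + 120) + 10 \<and>
    (\<forall>bs. length bs = m \<longrightarrow> arrs s' ''F'' (num bs) = leaf_share P L K side (xs ! k) bs))"
proof -
  let ?f = "leaf_share P L K side (xs ! k)" and ?tl = "K * (L * 30 + 50) + 100"
  let ?body = "leaf_code arr ;; Write ''F'' (Reg ''w'') (Reg ''f'') ;; ''w'' ::= Reg ''w'' \<oplus> Const 1"
  define I where "I q s' \<longleftrightarrow> env s' \<and> regs s' ''k'' = k \<and> regs s' ''w'' + q = 2 ^ m \<and>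
    (\<forall>bs. length bs = m \<longrightarrow> num bs < regs s' ''w'' \<longrightarrow> arrs s' ''F'' (num bs) = ?f bs)"
    for q and s' :: mem
  have loop: "runs M (While (Reg ''w'' \<prec> Reg ''Q'') ?body) s'
      (\<lambda>\<tau> s'. \<tau> \<le> 2 ^ m * (?tl + 20) + 4 \<and> (\<forall>bs. length bs = m \<longrightarrow> arrs s' ''F'' (num bs) = ?f bs))"
    if "I (2 ^ m) s'" for s'
  proof (rule runs_While[where I = I and n = "2 ^ m" and b = "?tl + 10"])
    show "I (2 ^ m) s'" by fact
  next
    fix q s' assume I: "I q s'"
    have Q: "regs s' ''Q'' = 2 ^ m" using I by (simp add: I_def env_regs_def)
    have wY: "regs s' ''w'' < Y"
    proof -
      have "regs s' ''w'' + q = 2 ^ m" using I by (simp add: I_def)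
      then show ?thesis using less_Y(15) by linarith
    qed
    show "fits M (Reg ''w'' \<prec> Reg ''Q'') s' \<and> (val (Reg ''w'' \<prec> Reg ''Q'') s' \<noteq> 0 \<longrightarrow>
      0 < q \<and> runs M ?body s' (\<lambda>\<tau> s'. \<tau> \<le> ?tl + 10 \<and> I (q - 1) s'))"
    proof (intro conjI impI)
      show "fits M (Reg ''w'' \<prec> Reg ''Q'') s'" using wY by (simp add: Q)
      assume "val (Reg ''w'' \<prec> Reg ''Q'') s' \<noteq> 0"
      then have lt: "regs s' ''w'' < 2 ^ m" by (simp add: Q split: if_splits)
      then show "0 < q" using I by (auto simp: I_def)
      obtain bs where bs: "length bs = m" "num bs = regs s' ''w''" using num_surj[OF lt] by auto
      show "runs M ?body s' (\<lambda>\<tau> s'. \<tau> \<le> ?tl + 10 \<and> I (q - 1) s')"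
      proof (subst runs_Seq, rule runs_frame[OF runs_leaf_code[of s' bs k]])
        show "env_regs (regs s') \<and> env_arrs (arrs s')" "regs s' ''k'' = k" using I by (auto simp: I_def)
      next
        fix \<tau> and s'' :: mem
        assume f: "\<tau> \<le> ?tl \<and> regs s'' ''f'' = ?f bs"
          and fr: "\<And>x. x \<notin> assigned (leaf_code arr) \<Longrightarrow> regs s'' x = regs s' x"
          and fa: "\<And>a. a \<notin> written (leaf_code arr) \<Longrightarrow> arrs s'' a = arrs s' a"
        have e: "env_regs (regs s'')" "env_arrs (arrs s'')"
          using I by (auto intro!: env_regs_cong[of "regs s'"] env_arrs_cong[of "arrs s'"] fr fa
            simp: env_names_def I_def)
        have fY: "?f bs < Y"
          using leaf_share_le_1[of P L K side "xs ! k" bs] Y_ge by linarith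
        have F: "arrs s'' ''F'' = arrs s' ''F''" by (simp add: fa)
        define F' where "F' = (arrs s' ''F'')(num bs := ?f bs)"
        have upd: "F' (num bs') = ?f bs'"
          if "length bs' = m" "num bs' < Suc (num bs)" for bs'
        proof (cases "num bs' = num bs")
          case True
          then show ?thesis using num_inject[of bs' bs] that bs by (simp add: F'_def)
        next
          case False
          then show ?thesis using that I bs by (simp add: I_def F'_def)
        qed
        have I': "I (q - 1) (s''\<lparr>arrs := (arrs s'')(''F'' := F'), regs := (regs s'')(''w'' := Suc (num bs))\<rparr>)"
          using e I lt upd bs(2) by (simp add: I_def fr)
        have w: "runs M (Write ''F'' (Reg ''w'') (Reg ''f'')) s'' Q"
          if "Q 3 (s''\<lparr>arrs := (arrs s'')(''F'' := F')\<rparr>)" for Q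
          using that fY wY by (simp add: fr F F'_def bs(2) f numeral_3_eq_3)
        show "runs M (Write ''F'' (Reg ''w'') (Reg ''f'') ;; ''w'' ::= Reg ''w'' \<oplus> Const 1) s''
          (\<lambda>\<tau>2 s'. \<tau> + \<tau>2 \<le> ?tl + 10 \<and> I (q - 1) s')"
          by (subst runs_Seq, rule w) (use I' wY f in \<open>simp add: fr bs(2)[symmetric]\<close>)
      qed (use bs k in auto)
    qed
  next
    fix q s' \<tau> assume I: "I q s'" and v: "val (Reg ''w'' \<prec> Reg ''Q'') s' = 0"
      and \<tau>: "\<tau> \<le> 2 ^ m * (cost (Reg ''w'' \<prec> Reg ''Q'') + 1 + (?tl + 10)) + cost (Reg ''w'' \<prec> Reg ''Q'') + 1"
    have Q: "regs s' ''Q'' = 2 ^ m" using I by (simp add: I_def env_regs_def)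
    have "regs s' ''w'' = 2 ^ m" using I v by (simp add: I_def Q split: if_splits)
    then have "arrs s' ''F'' (num bs) = ?f bs" if "length bs = m" for bs
      using I num_less[of bs] that by (simp add: I_def)
    moreover have "\<tau> \<le> 2 ^ m * (?tl + 20) + 4"
    proof -
      have "\<tau> \<le> 2 ^ m * (?tl + 14) + 4" using \<tau> by (simp add: algebra_simps)
      also have "\<dots> \<le> 2 ^ m * (?tl + 20) + 4" by (intro add_right_mono mult_left_mono) auto
      finally show ?thesis .
    qed
    ultimately show "\<tau> \<le> 2 ^ m * (?tl + 20) + 4 \<and> (\<forall>bs. length bs = m \<longrightarrow> arrs s' ''F'' (num bs) = ?f bs)"
      by blast
  qed
  have "I (2 ^ m) (s\<lparr>regs := (regs s)(''w'' := 0)\<rparr>)" using env k by (simp add: I_def)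
  note loop[OF this]
  then show ?thesis
    unfolding table_code_def
    by (subst runs_Seq, subst runs_Assign) (auto elim!: runs_mono simp: algebra_simps)
qed

lemma runs_fold_code:
  assumes env: "env s"
    and F: "\<And>bs. length bs = m \<Longrightarrow> arrs s ''F'' (num bs) = f bs" "\<And>bs. f bs \<le> 1"
    and r: "\<And>i. i < m \<Longrightarrow> arrs s ''r'' i = r i" "\<And>i. i < m \<Longrightarrow> r i < 2 ^ \<kappa>"
  shows "runs M fold_code s (\<lambda>\<tau> s'. \<tau> \<le> m * (2 ^ m * 40 + 40) + 10 \<and> arrs s' ''F'' 0 < p \<and>
    [int (arrs s' ''F'' 0) = multilinear_ext m 0 (int_vec r) (\<lambda>bs. int (f bs))] (mod int p))"
proof -
  let ?ml = "\<lambda>j pre. multilinear_ext (m - j) j (int_vec r) (\<lambda>bs. int (f (pre @ bs)))"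
  define ok where "ok y j pre \<longleftrightarrow> y < p \<and> [int y = ?ml j pre] (mod int p)" for y j pre
  define C where "C s' \<longleftrightarrow> env s' \<and> (\<forall>i<m. arrs s' ''r'' i = r i)" for s' :: mem
  define I where "I j s' \<longleftrightarrow> C s' \<and> j \<le> m \<and> regs s' ''j2'' = j \<and> regs s' ''hq'' = 2 ^ j \<and>
    (\<forall>pre. length pre = j \<longrightarrow> ok (arrs s' ''F'' (num pre)) j pre)" for j and s' :: mem
  \<comment> \<open>In-place safety: cells below \<open>w\<close> already belong to level
    \<open>j\<close>, cells from \<open>2 * w\<close> on still to level \<open>Suc j\<close>.
    Writing cell \<open>w\<close> spoils nothing that a later iteration reads.\<close>
  define J where "J j q s' \<longleftrightarrow> C s' \<and> j < m \<and> regs s' ''j2'' = j \<and> regs s' ''hq'' = 2 ^ j \<and>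
    regs s' ''w'' + q = 2 ^ j \<and>
    (\<forall>pre. length pre = j \<longrightarrow> num pre < regs s' ''w'' \<longrightarrow> ok (arrs s' ''F'' (num pre)) j pre) \<and>
    (\<forall>pre. length pre = Suc j \<longrightarrow> 2 * regs s' ''w'' \<le> num pre \<longrightarrow> ok (arrs s' ''F'' (num pre)) (Suc j) pre)"
    for j q and s' :: mem
  let ?e = "(Read ''F'' (Const 2 \<otimes> Reg ''w'') \<otimes> (Reg ''p'' \<oplus> Const 1 \<ominus> Read ''r'' (Reg ''j2''))
               \<oplus> Read ''r'' (Reg ''j2'') \<otimes> Read ''F'' (Const 2 \<otimes> Reg ''w'' \<oplus> Const 1)) \<odot> Reg ''p''"
  let ?body = "Write ''F'' (Reg ''w'') ?e ;; ''w'' ::= Reg ''w'' \<oplus> Const 1"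
  have pow: "(2::nat) ^ j \<le> 2 ^ m" "(2::nat) ^ j < Y" if "j \<le> m" for j
    using power_increasing[OF that, of "2::nat"] less_Y(15) by linarith+
  have inner: "runs M (While (Reg ''w'' \<prec> Reg ''hq'') ?body) s' (\<lambda>\<tau> s'. \<tau> \<le> 2 ^ m * 40 + 4 \<and> I j s')"
    if "J j (2 ^ j) s'" for j s'
  proof (rule runs_While[where I = "J j" and n = "2 ^ j" and b = 36])
    show "J j (2 ^ j) s'" by fact
  next
    fix q s' assume J: "J j q s'"
    have jm: "j < m" and hq: "regs s' ''hq'' = 2 ^ j" and wq: "regs s' ''w'' + q = 2 ^ j"
      and j2: "regs s' ''j2'' = j" and rr: "arrs s' ''r'' j = r j" and pp: "regs s' ''p'' = p"
      using J by (auto simp: J_def C_def env_regs_def)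
    have jY: "j < Y" using jm less_Y(3) by linarith
    have powY: "2 ^ j < Y" using pow[of j] jm by simp
    have wY: "regs s' ''w'' < Y" using wq powY by linarith
    show "fits M (Reg ''w'' \<prec> Reg ''hq'') s' \<and> (val (Reg ''w'' \<prec> Reg ''hq'') s' \<noteq> 0 \<longrightarrow>
      0 < q \<and> runs M ?body s' (\<lambda>\<tau> s'. \<tau> \<le> 36 \<and> J j (q - 1) s'))"
    proof (intro conjI impI)
      show "fits M (Reg ''w'' \<prec> Reg ''hq'') s'" using wY powY by (simp add: hq)
      assume "val (Reg ''w'' \<prec> Reg ''hq'') s' \<noteq> 0"
      then have lt: "regs s' ''w'' < 2 ^ j" by (simp add: hq split: if_splits)
      then show q: "0 < q" using wq by linarith
      obtain pre where pre: "length pre = j" "num pre = regs s' ''w''" using num_surj[OF lt] by auto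
      define a b y where "a = arrs s' ''F'' (2 * regs s' ''w'')" and
        "b = arrs s' ''F'' (2 * regs s' ''w'' + 1)" and
        "y = (a * (p + 1 - r j) + r j * b) mod p"
      have "ok (arrs s' ''F'' (num (pre @ [c]))) (Suc j) (pre @ [c])" for c
      proof -
        have "\<forall>pre. length pre = Suc j \<longrightarrow> 2 * regs s' ''w'' \<le> num pre \<longrightarrow> ok (arrs s' ''F'' (num pre)) (Suc j) pre"
          using J by (simp add: J_def)
        moreover have "2 * regs s' ''w'' \<le> num (pre @ [c])" unfolding num_snoc by (simp add: pre)
        moreover have "length (pre @ [c]) = Suc j" by (simp add: pre)
        ultimately show ?thesis by blast
      qed
      from this[of False] this[of True] have a: "ok a (Suc j) (pre @ [False])"
        and b: "ok b (Suc j) (pre @ [True])"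
        unfolding num_snoc by (simp_all add: a_def b_def pre)
      have rp: "r j < p" using r(2)[OF jm] p by linarith
      have "ok y j pre"
      proof -
        obtain d where d: "m - j = Suc d" "m - Suc j = d" using jm by (cases "m - j") auto
        \<comment> \<open>Modulo \<open>p\<close> the summand \<open>int p\<close> becomes the 0 on
          the right.\<close>
        have "[int a * (int p + 1 - int (r j)) + int (r j) * int b
          = ?ml (Suc j) (pre @ [False]) * (0 + 1 - int (r j)) + int (r j) * ?ml (Suc j) (pre @ [True])] (mod int p)"
          using a b unfolding ok_def by (intro cong_add cong_mult cong_diff) (auto simp: cong_0_iff)
        also have "?ml (Suc j) (pre @ [False]) * (0 + 1 - int (r j)) + int (r j) * ?ml (Suc j) (pre @ [True])
          = ?ml j pre" unfolding d by (simp add: int_vec_def)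
        also have "int a * (int p + 1 - int (r j)) + int (r j) * int b = int (a * (p + 1 - r j) + r j * b)"
          using rp by (simp add: of_nat_diff)
        finally show ?thesis
          using p unfolding ok_def y_def by (simp add: unique_euclidean_semiring_class.cong_def zmod_int)
      qed
      have ab: "a < Y" "b < Y" "r j < Y" using a b rp less_Y(10) unfolding ok_def by linarith+
      have upd1: "ok (((arrs s' ''F'')(num pre := y)) (num pre')) j pre'"
        if "length pre' = j" "num pre' < Suc (num pre)" for pre'
      proof (cases "num pre' = num pre")
        case True
        then show ?thesis using num_inject[of pre' pre] that pre \<open>ok y j pre\<close> by simp
      next
        case False
        then show ?thesis using that J pre by (simp add: J_def)
      qed
      have upd2: "ok (((arrs s' ''F'')(num pre := y)) (num pre')) (Suc j) pre'"
        if "length pre' = Suc j" "2 * Suc (num pre) \<le> num pre'" for pre'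
        using that J pre by (simp add: J_def)
      have st: "val ?e s' = y" "small Y ?e s'"
        using ab jY wY by (simp_all add: y_def a_def b_def rr pp j2)
      have C': "C (s'\<lparr>arrs := (arrs s')(''F'' := (arrs s' ''F'')(num pre := y)), regs := (regs s')(''w'' := Suc (num pre))\<rparr>)"
        using J by (simp add: J_def C_def)
      have J': "J j (q - 1) (s'\<lparr>arrs := (arrs s')(''F'' := (arrs s' ''F'')(num pre := y)), regs := (regs s')(''w'' := Suc (num pre))\<rparr>)"
        using C' jm hq j2 wq pre(2) upd1 upd2 q unfolding J_def by (simp del: fun_upd_apply add: fun_upd_same fun_upd_other)
      have w: "runs M (Write ''F'' (Reg ''w'') ?e) s' Q"
        if "\<And>\<tau>. \<tau> \<le> 30 \<Longrightarrow> Q \<tau> (s'\<lparr>arrs := (arrs s')(''F'' := (arrs s' ''F'')(num pre := y))\<rparr>)" for Q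
        using wY st(2) unfolding runs_Write st(1) by (auto intro!: that[unfolded pre(2)])
      show "runs M ?body s' (\<lambda>\<tau> s'. \<tau> \<le> 36 \<and> J j (q - 1) s')"
        by (subst runs_Seq, rule w) (use J' wY in \<open>simp add: pre(2)[symmetric]\<close>)
    qed
  next
    fix q s' \<tau> assume J: "J j q s'" and v: "val (Reg ''w'' \<prec> Reg ''hq'') s' = 0"
      and \<tau>: "\<tau> \<le> 2 ^ j * (cost (Reg ''w'' \<prec> Reg ''hq'') + 1 + 36) + cost (Reg ''w'' \<prec> Reg ''hq'') + 1"
    have hq: "regs s' ''hq'' = 2 ^ j" "j < m" using J by (auto simp: J_def)
    have w: "regs s' ''w'' = 2 ^ j" using J v by (simp add: J_def hq split: if_splits)
    have "ok (arrs s' ''F'' (num pre)) j pre" if "length pre = j" for pre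
      using J num_less[of pre] that by (simp add: J_def w)
    moreover have "\<tau> \<le> 2 ^ m * 40 + 4" 
    proof -
      have "\<tau> \<le> 2 ^ j * 40 + 4" using \<tau> by simp
      with pow(1)[OF less_imp_le[OF hq(2)]] show ?thesis by linarith
    qed
    ultimately show "\<tau> \<le> 2 ^ m * 40 + 4 \<and> I j s'" using J by (simp add: I_def J_def)
  qed
  let ?outer = "''j2'' ::= Reg ''j2'' \<ominus> Const 1 ;; ''hq'' ::= Reg ''hq'' \<oslash> Const 2 ;; ''w'' ::= Const 0 ;;
        While (Reg ''w'' \<prec> Reg ''hq'') ?body"
  have outer: "runs M (While (Reg ''j2'') ?outer) s' (\<lambda>\<tau> s'. \<tau> \<le> m * (2 ^ m * 40 + 40) + 2 \<and> I 0 s')"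
    if "I m s'" for s'
  proof (rule runs_While[where I = I and n = m and b = "2 ^ m * 40 + 20"])
    show "I m s'" by fact
  next
    fix j s' assume I: "I j s'"
    have jm: "j \<le> m" and j2: "regs s' ''j2'' = j" and hq: "regs s' ''hq'' = 2 ^ j"
      using I by (auto simp: I_def)
    have jY: "j < Y" using jm less_Y(3) by linarith
    have powY: "2 ^ j < Y" using pow[OF jm] by simp
    show "fits M (Reg ''j2'') s' \<and> (val (Reg ''j2'') s' \<noteq> 0 \<longrightarrow>
      0 < j \<and> runs M ?outer s' (\<lambda>\<tau> s'. \<tau> \<le> 2 ^ m * 40 + 20 \<and> I (j - 1) s'))"
    proof (intro conjI impI)
      show "fits M (Reg ''j2'') s'" using jY by (simp add: j2)
      assume "val (Reg ''j2'') s' \<noteq> 0"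
      then show "0 < j" by (simp add: j2)
      then obtain j' where j': "j = Suc j'" by (cases j) auto
      let ?s1 = "s'\<lparr>regs := (regs s')(''j2'' := j', ''hq'' := 2 ^ j', ''w'' := 0)\<rparr>"
      have "J j' (2 ^ j') ?s1" using I by (simp add: I_def J_def C_def j')
      note in' = inner[OF this]
      have head: "runs M (''j2'' ::= Reg ''j2'' \<ominus> Const 1 ;; ''hq'' ::= Reg ''hq'' \<oslash> Const 2 ;;
          ''w'' ::= Const 0 ;; rest) s' Q"
        if "runs M rest ?s1 (\<lambda>\<tau>. Q (10 + \<tau>))" for rest Q
        using jY powY by (simp add: j2 hq j', intro runs_mono[OF that]) (simp add: eval_nat_numeral)
      show "runs M ?outer s' (\<lambda>\<tau> s'. \<tau> \<le> 2 ^ m * 40 + 20 \<and> I (j - 1) s')"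
        by (rule head, rule runs_mono[OF in']) (auto simp: j')
    qed
  next
    fix j s' \<tau> assume I: "I j s'" and v: "val (Reg ''j2'') s' = 0"
      and \<tau>: "\<tau> \<le> m * (cost (Reg ''j2'') + 1 + (2 ^ m * 40 + 20)) + cost (Reg ''j2'') + 1"
    have "j = 0" using I v by (simp add: I_def)
    moreover have "\<tau> \<le> m * (2 ^ m * 40 + 40) + 2"
    proof -
      have "\<tau> \<le> m * (2 ^ m * 40 + 22) + 2" using \<tau> by (simp add: algebra_simps)
      also have "\<dots> \<le> m * (2 ^ m * 40 + 40) + 2" by (intro add_right_mono mult_left_mono) auto
      finally show ?thesis .
    qed
    ultimately show "\<tau> \<le> m * (2 ^ m * 40 + 40) + 2 \<and> I 0 s'" using I by simp
  qed
  let ?s0 = "s\<lparr>regs := (regs s)(''j2'' := m, ''hq'' := 2 ^ m)\<rparr>"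
  have "f bs < p" for bs using F(2)[of bs] p by linarith
  then have init: "I m ?s0" using env r F by (simp add: I_def C_def ok_def)
  have head: "runs M (''j2'' ::= Reg ''m'' ;; ''hq'' ::= Reg ''Q'' ;; rest) s Q"
    if "runs M rest ?s0 (\<lambda>\<tau>. Q (4 + \<tau>))" for rest Q
    using env[unfolded env_regs_def] by (simp, intro runs_mono[OF that]) (simp add: eval_nat_numeral)
  show ?thesis
    unfolding fold_code_def
    by (rule head, rule runs_mono[OF outer[OF init]]) (auto simp: I_def ok_def)
qed

end

section \<open>Replaying a transcript on the machine\<close>

text \<open>\<open>ok\<close> is the product of all test results so far; a failed test does not stop
  the run, so every transcript takes the same number of rounds.\<close>

definition round_check_code :: com where
  "round_check_code =
    (Cond (Reg ''ii'' \<prec> Reg ''jj'')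
       (''ok'' ::= Reg ''ok'' \<otimes>
          ((Reg ''a'' \<oplus> Read ''r'' (Reg ''ii'') \<otimes> (Reg ''b'' \<oplus> Reg ''cc'')) \<odot> Reg ''p'' \<doteq> Reg ''v'') ;;
        Write ''r'' (Reg ''ii'') (Reg ''x'') ;; ''ii'' ::= Reg ''ii'' \<oplus> Const 1)
       (''ok'' ::= Reg ''ok'' \<otimes>
          ((Reg ''v'' \<oplus> Reg ''a'' \<otimes> (Reg ''a'' \<oplus> Reg ''b'' \<oplus> Reg ''cc'')) \<odot> Reg ''p'' \<doteq> Const 1) ;;
        Write ''r'' (Reg ''ii'') (Reg ''x'') ;; ''ii'' ::= Const 0 ;; ''jj'' ::= Reg ''jj'' \<oplus> Const 1) ;;
     ''v'' ::= (Reg ''a'' \<oplus> Reg ''x'' \<otimes> (Reg ''b'' \<oplus> Reg ''x'' \<otimes> Reg ''cc'')) \<odot> Reg ''p'' ;;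
     ''g'' ::= Reg ''g'' \<ominus> Const 1)"

definition rounds_code :: com where
  "rounds_code =
    (''pw'' ::= Reg ''D'' ;; ''v'' ::= Const 1 ;; ''ok'' ::= Const 1 ;; ''jj'' ::= Const 0 ;;
     ''ii'' ::= Const 0 ;; ''g'' ::= Reg ''R'' ;;
     While (Reg ''g'')
       (''a'' ::= Const 1 ;; read_code ''a'' ''idx'' ''pw'' ''ell'' 1 ;;
        ''b'' ::= Const 1 ;; read_code ''b'' ''idx'' ''pw'' ''ell'' 1 ;;
        ''cc'' ::= Const 1 ;; read_code ''cc'' ''idx'' ''pw'' ''ell'' 1 ;;
        ''x'' ::= Const 0 ;; read_code ''x'' ''idx'' ''pw'' ''kap'' 2 ;;
        round_check_code) ;;
     ''al'' ::= Const 1 ;; read_code ''al'' ''idx'' ''pw'' ''ell'' 1)"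

text \<open>The table of leaves is rebuilt for every entry. It has \<open>2 ^ m\<close> cells, at
  most \<open>D\<close>, so the cost stays polynomial in \<open>D\<close>.\<close>

definition entry_code :: "string \<Rightarrow> string \<Rightarrow> com" where
  "entry_code a out =
    (rounds_code ;; table_code a ;; fold_code ;;
     Cond (Reg ''side'')
       (''ok'' ::= Reg ''ok'' \<otimes>
         ((Read ''F'' (Const 0) \<oplus> Reg ''al'') \<odot> Reg ''p'' \<doteq> (Reg ''v'' \<oplus> Const 1) \<odot> Reg ''p''))
       (''ok'' ::= Reg ''ok'' \<otimes> (Read ''F'' (Const 0) \<doteq> Reg ''al'' \<odot> Reg ''p'')) ;;
     Write out (Reg ''k'' \<otimes> Reg ''D'' \<oplus> Reg ''idx'') (Reg ''ok''))"

definition tensors_code :: "string \<Rightarrow> string \<Rightarrow> com" where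
  "tensors_code a out =
    (''k'' ::= Const 0 ;;
     While (Reg ''k'' \<prec> Reg ''N'')
       (''idx'' ::= Const 0 ;;
        While (Reg ''idx'' \<prec> Reg ''D'')
          (entry_code a out ;; ''idx'' ::= Reg ''idx'' \<oplus> Const 1) ;;
        ''k'' ::= Reg ''k'' \<oplus> Const 1))"

text \<open>Initialization, reading and framing in one rule in continuation form, so that the four
  reads of a round can be chained.\<close>

lemma (in word_ram) runs_read_then:
  assumes src: "regs s src = num i" and pw: "regs s pw = 2 ^ (length i - pos)"
    and pos: "pos + 2 * n \<le> length i" and cnt: "regs s cnt = n" "cnt \<noteq> x"
    and sh: "sh = (if e then 2 else 1)"
    and bnd: "2 ^ length i < Y" "(init + 1) * 2 ^ n \<le> Y" "n < Y" "init < Y"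
    and dist: "distinct [x, src, pw, ''c'']"
    and rest: "\<And>\<tau> s'. \<tau> \<le> n * 30 + 20 \<Longrightarrow> regs s' x = read_bits e n init (drop pos i) \<Longrightarrow>
      regs s' pw = 2 ^ (length i - (pos + 2 * n)) \<Longrightarrow>
      (\<And>y. y \<notin> {''c'', pw, x} \<Longrightarrow> regs s' y = regs s y) \<Longrightarrow> arrs s' = arrs s \<Longrightarrow>
      runs M rest s' (\<lambda>\<tau>'. Q (\<tau> + \<tau>'))"
  shows "runs M (x ::= Const init ;; read_code x src pw cnt sh ;; rest) s Q"
proof -
  let ?s = "s\<lparr>regs := (regs s)(x := init)\<rparr>"
  have d: "pw \<noteq> x" "src \<noteq> x" using dist by auto
  have read: "runs M (read_code x src pw cnt sh) ?s (\<lambda>\<tau> s'. \<tau> \<le> n * 30 + 10 \<and>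
    regs s' x = read_bits e n (regs ?s x) (drop pos i) \<and> regs s' pw = 2 ^ (length i - (pos + 2 * n)))"
    by (rule runs_read_code[OF _ _ pos _ sh bnd(1) _ bnd(3) dist])
      (use d src pw cnt bnd in auto)
  have "runs M (read_code x src pw cnt sh ;; rest) ?s (\<lambda>\<tau>. Q (2 + \<tau>))"
  proof (subst runs_Seq, rule runs_frame[OF read])
    fix \<tau> and s' :: mem
    assume 1: "\<tau> \<le> n * 30 + 10 \<and> regs s' x = read_bits e n (regs ?s x) (drop pos i) \<and>
        regs s' pw = 2 ^ (length i - (pos + 2 * n))"
      and 2: "\<And>y. y \<notin> assigned (read_code x src pw cnt sh) \<Longrightarrow> regs s' y = regs ?s y"
      and 3: "\<And>a. a \<notin> written (read_code x src pw cnt sh) \<Longrightarrow> arrs s' a = arrs ?s a"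
    have "runs M rest s' (\<lambda>\<tau>'. Q (2 + \<tau> + \<tau>'))"
      by (rule rest) (use 1 2 3 in \<open>auto intro!: ext\<close>)
    then show "runs M rest s' (\<lambda>\<tau>'. Q (2 + (\<tau> + \<tau>')))" by (simp add: add.assoc)
  qed
  then show ?thesis using bnd(4) by (subst runs_Seq) (simp add: numeral_2_eq_2 del: runs_Seq)
qed

lemma round_check_code_frame [simp]:
  "assigned round_check_code = {''ok'', ''ii'', ''jj'', ''v'', ''g''}"
  "written round_check_code = {''r''}"
  by (auto simp: round_check_code_def)

lemma rounds_code_frame [simp]:
  "assigned rounds_code = {''pw'', ''v'', ''ok'', ''jj'', ''ii'', ''g'', ''a'', ''b'', ''cc'', ''x'', ''al'', ''c''}"
  "written rounds_code = {''r''}"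
  by (auto simp: rounds_code_def)

context bp_machine
begin

abbreviation accepts :: "((nat \<Rightarrow> nat) \<Rightarrow> nat \<Rightarrow> nat \<Rightarrow> bool) \<Rightarrow> bool list \<Rightarrow> bool" where
  "accepts fin bs \<equiv> verdict p \<kappa> \<mu> fin (rounds m 0) 0 0 (\<lambda>_. 0) 1 bs"

text \<open>The verdict works with a vector on all naturals, the machine with an array that agrees
  with it on \<open>m\<close> cells only; these are the variables of the extension evaluated
  afterwards. \<open>al\<close> is left unreduced, hence bounded by \<open>Y\<close> and not by
  \<open>p\<close>.\<close>

definition rounds_post ::
    "((nat \<Rightarrow> nat) \<Rightarrow> nat \<Rightarrow> nat \<Rightarrow> bool) \<Rightarrow> bool list \<Rightarrow> mem \<Rightarrow> bool" where
  "rounds_post fin bs s \<longleftrightarrow> regs s ''ok'' \<le> 1 \<and> regs s ''v'' < p \<and> regs s ''al'' < Y \<and>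
     (\<exists>r'. (\<forall>q < m. arrs s ''r'' q = r' q \<and> r' q < 2 ^ \<kappa>) \<and>
       (regs s ''ok'' = 1 \<and> fin r' (regs s ''v'') (regs s ''al'') \<longleftrightarrow> accepts fin bs))"

text \<open>
  The array \<open>r\<close> holds garbage at the positions not yet drawn, so the invariant relates it to some
  vector \<open>r'\<close> only below \<open>j\<close>.
\<close>

definition rounds_inv ::
    "((nat \<Rightarrow> nat) \<Rightarrow> nat \<Rightarrow> nat \<Rightarrow> bool) \<Rightarrow> bool list \<Rightarrow> nat \<Rightarrow> mem \<Rightarrow> bool" where
  "rounds_inv fin bs k s \<longleftrightarrow> env s \<and> regs s ''idx'' = num bs \<and> regs s ''g'' = k \<and>
     k \<le> rounds m 0 \<and> regs s ''pw'' = 2 ^ (t - (rounds m 0 - k) * (6 * \<mu> + 2 * \<kappa>)) \<and>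
     regs s ''ok'' \<le> 1 \<and> regs s ''v'' < p \<and> regs s ''ii'' \<le> regs s ''jj'' \<and> regs s ''jj'' \<le> m \<and>
     k + regs s ''ii'' = rounds (m - regs s ''jj'') (regs s ''jj'') \<and>
     (\<exists>r'. (\<forall>q < regs s ''jj''. arrs s ''r'' q = r' q \<and> r' q < 2 ^ \<kappa>) \<and>
       (regs s ''ok'' = 1 \<and> verdict p \<kappa> \<mu> fin k (regs s ''jj'') (regs s ''ii'') r' (regs s ''v'')
          (drop ((rounds m 0 - k) * (6 * \<mu> + 2 * \<kappa>)) bs)
        \<longleftrightarrow> accepts fin bs))"

lemma runs_round_check_code:
  assumes env: "env s" and idx: "regs s ''idx'' = num bs" and len: "length bs = t"
    and k: "regs s ''g'' = Suc k" "Suc k \<le> rounds m 0"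
    and pw: "regs s ''pw'' = 2 ^ (t - (rounds m 0 - k) * (6 * \<mu> + 2 * \<kappa>))"
    and st: "regs s ''ok'' \<le> 1" "regs s ''v'' < p" "regs s ''ii'' \<le> regs s ''jj''" "regs s ''jj'' \<le> m"
      "Suc k + regs s ''ii'' = rounds (m - regs s ''jj'') (regs s ''jj'')"
    and r': "\<forall>q < regs s ''jj''. arrs s ''r'' q = r' q \<and> r' q < 2 ^ \<kappa>"
    and v: "regs s ''ok'' = 1 \<and> verdict p \<kappa> \<mu> fin (Suc k) (regs s ''jj'') (regs s ''ii'') r' (regs s ''v'')
          (drop ((rounds m 0 - Suc k) * (6 * \<mu> + 2 * \<kappa>)) bs)
        \<longleftrightarrow> accepts fin bs"
    and pos: "pos = (rounds m 0 - Suc k) * (6 * \<mu> + 2 * \<kappa>)"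
    and abc: "regs s ''a'' = read_bits False \<mu> 1 (drop pos bs)"
      "regs s ''b'' = read_bits False \<mu> 1 (drop (pos + 2 * \<mu>) bs)"
      "regs s ''cc'' = read_bits False \<mu> 1 (drop (pos + 4 * \<mu>) bs)"
      "regs s ''x'' = read_bits True \<kappa> 0 (drop (pos + 6 * \<mu>) bs)"
  shows "runs M round_check_code s (\<lambda>\<tau> s'. \<tau> \<le> 80 \<and> rounds_inv fin bs k s')"
proof -
  define j i v a b c x where "j = regs s ''jj''" and "i = regs s ''ii''" and "v = regs s ''v''"
    and "a = regs s ''a''" and "b = regs s ''b''" and "c = regs s ''cc''" and "x = regs s ''x''"
  note defs = j_def[symmetric] i_def[symmetric] v_def[symmetric] a_def[symmetric] b_def[symmetric]
    c_def[symmetric] x_def[symmetric]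
  note st' = st[unfolded defs] and r'' = r'[unfolded defs] and v' = v[unfolded defs]
  define pos' where "pos' = (rounds m 0 - k) * (6 * \<mu> + 2 * \<kappa>)"
  have "rounds m 0 - k = Suc (rounds m 0 - Suc k)" using k by simp
  then have pos': "pos' = pos + (6 * \<mu> + 2 * \<kappa>)" by (simp add: pos'_def pos)
  define v2 where "v2 = (a + x * (b + x * c)) mod p"
  let ?chk = "if i < j then (a + r' i * (b + c)) mod p = v else (v + a * (a + b + c)) mod p = 1"
  have ver: "verdict p \<kappa> \<mu> fin (Suc k) j i r' v (drop pos bs) \<longleftrightarrow> ?chk \<and>
    verdict p \<kappa> \<mu> fin k (if i < j then j else Suc j) (if i < j then Suc i else 0) (r'(i := x)) v2 (drop pos' bs)"
    unfolding verdict.simps Let_def v2_def pos' a_def b_def c_def x_def abc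
    by (simp add: add.commute add.left_commute)
  have "regs s y < Y" if "y \<in> {''a'', ''b'', ''cc''}" for y
  proof -
    have "regs s y < (1 + 1) * 2 ^ \<mu>" using that abc read_bits_less[of False \<mu> 1] by auto
    then show ?thesis using bounds(5) by simp
  qed
  then have aY: "a < Y" "b < Y" "c < Y" by (simp_all add: a_def b_def c_def)
  have x\<kappa>: "x < 2 ^ \<kappa>" using abc(4) read_bits_less[of True \<kappa> 0] by (simp add: x_def)
  have xY: "x < Y" using x\<kappa> less_Y(7) by linarith
  have vY: "v < Y" using st'(2) less_Y(10) by linarith
  have jY: "j < Y" "i < Y" using st' less_Y(3) by linarith+
  have kY: "Suc k < Y" using k(2) less_Y(17) by linarith
  have okY: "regs s ''ok'' < Y" using st(1) Y_ge by linarith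
  have pp: "regs s ''p'' = p" using env by (simp add: env_regs_def)
  have v2p: "v2 < p" using p by (simp add: v2_def)
  have v2Y: "v2 < Y" using v2p less_Y(10) by linarith
  \<comment> \<open>At \<open>j = m\<close> the equation between \<open>k\<close>, \<open>i\<close>
    and \<open>rounds\<close> would leave no round to play.\<close>
  have jm: "j < m"
  proof (rule ccontr)
    assume "\<not> j < m"
    then have "m - j = 0" by simp
    then show False using st'(5) by simp
  qed
  then have rec: "rounds (m - j) j = j + Suc (rounds (m - Suc j) (Suc j))"
    by (metis Suc_diff_Suc rounds.simps(2))
  show ?thesis
  proof (cases "i < j")
    case True
    have ri: "arrs s ''r'' i = r' i" "r' i < Y"
      using r'' True less_Y(7) by (auto intro: less_trans)
    define ok where "ok = regs s ''ok'' * of_bool ((a + r' i * (b + c)) mod p = v)"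
    have ok: "ok \<le> 1" "ok < Y" using st(1) Y_ge by (auto simp: ok_def)
    have vi: "ok = 1 \<and> verdict p \<kappa> \<mu> fin k j (Suc i) (r'(i := x)) v2 (drop pos' bs)
      \<longleftrightarrow> accepts fin bs"
      unfolding v'[folded pos, symmetric] ver using True by (auto simp: ok_def simp del: verdict.simps)
    have inv: "rounds_inv fin bs k (s\<lparr>arrs := (arrs s)(''r'' := (arrs s ''r'')(i := x)),
        regs := (regs s)(''ok'' := ok, ''ii'' := Suc i, ''v'' := v2, ''g'' := k)\<rparr>)"
      unfolding rounds_inv_def
      using env idx k(2) pw[folded pos'_def] ok(1) v2p True st'(4,5)
        r'' x\<kappa> vi
      by (simp add: defs pos'_def[symmetric]) (intro exI[of _ "r'(i := x)"] conjI allI impI; auto)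
    show ?thesis
      using inv True ri jY aY xY vY okY kY ok
      by (simp add: round_check_code_def defs pp ok_def[symmetric] v2_def[symmetric] k)
  next
    case False
    then have ij: "i = j" using st' by simp
    define ok where "ok = regs s ''ok'' * of_bool ((v + a * (a + b + c)) mod p = Suc 0)"
    have ok: "ok \<le> 1" "ok < Y" using st(1) Y_ge by (auto simp: ok_def)
    have kk: "k = rounds (m - Suc j) (Suc j)" using st'(5) rec ij by linarith
    have vj: "ok = 1 \<and> verdict p \<kappa> \<mu> fin k (Suc j) 0 (r'(j := x)) v2 (drop pos' bs)
      \<longleftrightarrow> accepts fin bs"
      unfolding v'[folded pos, symmetric] ver using ij by (auto simp: ok_def simp del: verdict.simps)
    have inv: "rounds_inv fin bs k (s\<lparr>arrs := (arrs s)(''r'' := (arrs s ''r'')(j := x)),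
        regs := (regs s)(''ok'' := ok, ''ii'' := 0, ''jj'' := Suc j, ''v'' := v2, ''g'' := k)\<rparr>)"
      unfolding rounds_inv_def
      using env idx k(2) pw[folded pos'_def] ok(1) v2p jm kk[symmetric]
        r'' x\<kappa> vj
      by (simp add: defs pos'_def[symmetric])
        (intro exI[of _ "r'(j := x)"] conjI allI impI; auto simp: less_Suc_eq)
    show ?thesis
      using inv False jY aY xY vY okY kY ok ij
      by (simp add: round_check_code_def defs pp ok_def[symmetric] v2_def[symmetric] k)
  qed
qed


lemma runs_rounds_code:
  assumes env: "env s" and idx: "regs s ''idx'' = num bs" and len: "length bs = t"
  shows "runs M rounds_code s (\<lambda>\<tau> s'. \<tau> \<le> rounds m 0 * (\<mu> * 90 + \<kappa> * 30 + 180) + \<mu> * 30 + 60 \<and> rounds_post fin bs s')"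
proof -
  let ?R = "rounds m 0" and ?c = "6 * \<mu> + 2 * \<kappa>"
  let ?I = "rounds_inv fin bs"
  let ?c4 = "''x'' ::= Const 0 ;; read_code ''x'' ''idx'' ''pw'' ''kap'' 2 ;; round_check_code"
  let ?c3 = "''cc'' ::= Const 1 ;; read_code ''cc'' ''idx'' ''pw'' ''ell'' 1 ;; ?c4"
  let ?c2 = "''b'' ::= Const 1 ;; read_code ''b'' ''idx'' ''pw'' ''ell'' 1 ;; ?c3"
  let ?body = "''a'' ::= Const 1 ;; read_code ''a'' ''idx'' ''pw'' ''ell'' 1 ;; ?c2"
  let ?b = "\<mu> * 90 + \<kappa> * 30 + 160"
  have lenY: "2 ^ length bs < Y" unfolding len by (rule less_Y)
  have two: "(1 + 1) * 2 ^ \<mu> \<le> Y" "(0 + 1) * 2 ^ \<kappa> \<le> Y"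
    using bounds(5) less_Y(7) by (simp_all add: less_imp_le)
  have ld: "1 < Y" "0 < Y" using Y_ge by simp_all
  have body: "runs M ?body s1 (\<lambda>\<tau> s'. \<tau> \<le> ?b \<and> ?I k s')" if I: "?I (Suc k) s1" for k s1
  proof -
    define pos where "pos = (?R - Suc k) * ?c"
    have e1: "env_regs (regs s1)" "env_arrs (arrs s1)" and i1: "regs s1 ''idx'' = num bs"
      and k1: "regs s1 ''g'' = Suc k" "Suc k \<le> ?R"
      and pw1: "regs s1 ''pw'' = 2 ^ (length bs - pos)"
      and ell: "regs s1 ''ell'' = \<mu>" "regs s1 ''kap'' = \<kappa>"
      using I by (simp_all add: rounds_inv_def pos_def len env_regs_def)
    have Rk: "?R - k = Suc (?R - Suc k)" using k1 by simp
    then have pos': "(?R - k) * ?c = pos + ?c" by (simp add: pos_def)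
    have "(?R - k) * ?c \<le> ?R * ?c" by (intro mult_right_mono) auto
    then have pc: "pos + ?c \<le> length bs" unfolding pos' len by linarith
    note rd = runs_read_then[where src = "''idx''" and pw = "''pw''" and i = bs and e = False and n = \<mu>
        and init = 1 and sh = 1 and cnt = "''ell''"]
    show ?thesis
    proof (rule rd[where pos = pos])
      fix \<tau>1 and s2 :: mem
      assume a2: "\<tau>1 \<le> \<mu> * 30 + 20" "regs s2 ''a'' = read_bits False \<mu> 1 (drop pos bs)"
        "regs s2 ''pw'' = 2 ^ (length bs - (pos + 2 * \<mu>))"
        "\<And>y. y \<notin> {''c'', ''pw'', ''a''} \<Longrightarrow> regs s2 y = regs s1 y" "arrs s2 = arrs s1"
      show "runs M ?c2 s2 (\<lambda>\<tau>' s'. \<tau>1 + \<tau>' \<le> ?b \<and> ?I k s')"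
      proof (rule rd[where pos = "pos + 2 * \<mu>"])
        fix \<tau>2 and s3 :: mem
        assume a3: "\<tau>2 \<le> \<mu> * 30 + 20" "regs s3 ''b'' = read_bits False \<mu> 1 (drop (pos + 2 * \<mu>) bs)"
          "regs s3 ''pw'' = 2 ^ (length bs - (pos + 2 * \<mu> + 2 * \<mu>))"
          "\<And>y. y \<notin> {''c'', ''pw'', ''b''} \<Longrightarrow> regs s3 y = regs s2 y" "arrs s3 = arrs s2"
        show "runs M ?c3 s3 (\<lambda>\<tau>' s'. \<tau>1 + (\<tau>2 + \<tau>') \<le> ?b \<and> ?I k s')"
        proof (rule rd[where pos = "pos + 4 * \<mu>"])
          fix \<tau>3 and s4 :: mem
          assume a4: "\<tau>3 \<le> \<mu> * 30 + 20" "regs s4 ''cc'' = read_bits False \<mu> 1 (drop (pos + 4 * \<mu>) bs)"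
            "regs s4 ''pw'' = 2 ^ (length bs - (pos + 4 * \<mu> + 2 * \<mu>))"
            "\<And>y. y \<notin> {''c'', ''pw'', ''cc''} \<Longrightarrow> regs s4 y = regs s3 y" "arrs s4 = arrs s3"
          show "runs M ?c4 s4 (\<lambda>\<tau>' s'. \<tau>1 + (\<tau>2 + (\<tau>3 + \<tau>')) \<le> ?b \<and> ?I k s')"
          proof (rule runs_read_then[where src = "''idx''" and pw = "''pw''" and i = bs and e = True
              and n = \<kappa> and init = 0 and sh = 2 and cnt = "''kap''" and pos = "pos + 6 * \<mu>"])
            fix \<tau>4 and s5 :: mem
            assume a5: "\<tau>4 \<le> \<kappa> * 30 + 20" "regs s5 ''x'' = read_bits True \<kappa> 0 (drop (pos + 6 * \<mu>) bs)"
              "regs s5 ''pw'' = 2 ^ (length bs - (pos + 6 * \<mu> + 2 * \<kappa>))"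
              "\<And>y. y \<notin> {''c'', ''pw'', ''x''} \<Longrightarrow> regs s5 y = regs s4 y" "arrs s5 = arrs s4"
            have fr: "regs s5 y = regs s1 y"
              if "y \<notin> {''c'', ''pw'', ''a'', ''b'', ''cc'', ''x''}" for y
              using that by (simp add: a2 a3 a4 a5)
            have ar: "arrs s5 = arrs s1" by (simp add: a2 a3 a4 a5)
            have e5: "env_regs (regs s5)"
              by (rule env_regs_cong[OF e1(1)]) (auto simp: fr env_names_def)
            obtain r' where r': "\<forall>q < regs s1 ''jj''. arrs s1 ''r'' q = r' q \<and> r' q < 2 ^ \<kappa>"
              "regs s1 ''ok'' = 1 \<and> verdict p \<kappa> \<mu> fin (Suc k) (regs s1 ''jj'') (regs s1 ''ii'') r' (regs s1 ''v'')
                (drop ((?R - Suc k) * ?c) bs)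
              \<longleftrightarrow> accepts fin bs"
              using I unfolding rounds_inv_def by blast
            have pw5: "regs s5 ''pw'' = 2 ^ (t - (?R - k) * ?c)"
              unfolding pos' using a5(3) by (simp add: len add.assoc)
            have st: "regs s1 ''ok'' \<le> 1" "regs s1 ''v'' < p" "regs s1 ''ii'' \<le> regs s1 ''jj''"
              "regs s1 ''jj'' \<le> m" "Suc k + regs s1 ''ii'' = rounds (m - regs s1 ''jj'') (regs s1 ''jj'')"
              using I unfolding rounds_inv_def by blast+
            have "runs M round_check_code s5 (\<lambda>\<tau> s'. \<tau> \<le> 80 \<and> ?I k s')"
            proof (rule runs_round_check_code[where r' = r', OF _ _ len _ k1(2) pw5 _ _ _ _ _ _ _ pos_def])
              show "env_regs (regs s5) \<and> env_arrs (arrs s5)" using e5 e1(2) ar by simp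
              show "regs s5 ''a'' = read_bits False \<mu> 1 (drop pos bs)"
                "regs s5 ''b'' = read_bits False \<mu> 1 (drop (pos + 2 * \<mu>) bs)"
                "regs s5 ''cc'' = read_bits False \<mu> 1 (drop (pos + 4 * \<mu>) bs)"
                "regs s5 ''x'' = read_bits True \<kappa> 0 (drop (pos + 6 * \<mu>) bs)"
                using a2(2) a3(2) a4(2) a5(2) by (simp_all add: a3(4) a4(4) a5(4))
              show "regs s5 ''ok'' = 1 \<and> verdict p \<kappa> \<mu> fin (Suc k) (regs s5 ''jj'') (regs s5 ''ii'') r'
                  (regs s5 ''v'') (drop ((?R - Suc k) * ?c) bs)
                \<longleftrightarrow> accepts fin bs"
                using r'(2) fr[of "''ok''"] fr[of "''jj''"] fr[of "''ii''"] fr[of "''v''"]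
                by (simp del: verdict.simps)
            qed (use r'(1) st i1 k1 in \<open>simp_all add: fr ar\<close>)
            then show "runs M round_check_code s5
                (\<lambda>\<tau>' s'. \<tau>1 + (\<tau>2 + (\<tau>3 + (\<tau>4 + \<tau>'))) \<le> ?b \<and> ?I k s')"
              by (rule runs_mono) (use a2(1) a3(1) a4(1) a5(1) in auto)
          qed (use lenY two ld pc ell i1 a4(3) in \<open>simp_all add: a2(4) a3(4) a4(4)\<close>)
        qed (use lenY two ld pc ell i1 a3(3) in \<open>simp_all add: a2(4) a3(4)\<close>)
      qed (use lenY two ld pc ell i1 a2(3) in \<open>simp_all add: a2(4)\<close>)
    qed (use lenY two ld pc ell i1 pw1 in simp_all)
  qed
  have loop: "runs M (While (Reg ''g'') ?body) s' (\<lambda>\<tau> s'. \<tau> \<le> ?R * (?b + 2) + 2 \<and> ?I 0 s')"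
    if "?I ?R s'" for s'
  proof (rule runs_While[where I = ?I and n = ?R and b = ?b])
    show "?I ?R s'" by fact
  next
    fix k s' assume I: "?I k s'"
    have g: "regs s' ''g'' = k" "k < Y"
      using I less_Y(17) unfolding rounds_inv_def by (blast, linarith)
    show "fits M (Reg ''g'') s' \<and> (val (Reg ''g'') s' \<noteq> 0 \<longrightarrow>
      0 < k \<and> runs M ?body s' (\<lambda>\<tau> s'. \<tau> \<le> ?b \<and> ?I (k - 1) s'))"
      using g I body[of "k - 1" s'] by (cases k) (simp_all del: runs_Seq)
  next
    fix k s' \<tau> assume "?I k s'" "val (Reg ''g'') s' = 0"
      "\<tau> \<le> ?R * (cost (Reg ''g'') + 1 + ?b) + cost (Reg ''g'') + 1"
    then show "\<tau> \<le> ?R * (?b + 2) + 2 \<and> ?I 0 s'"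
      by (auto simp: rounds_inv_def add.commute)
  qed
  let ?s0 = "s\<lparr>regs := (regs s)(''pw'' := 2 ^ t, ''v'' := 1, ''ok'' := 1, ''jj'' := 0, ''ii'' := 0, ''g'' := ?R)\<rparr>"
  have init: "?I ?R ?s0"
    using env idx p(1) by (auto simp: rounds_inv_def)
  have head: "runs M (''pw'' ::= Reg ''D'' ;; ''v'' ::= Const 1 ;; ''ok'' ::= Const 1 ;; ''jj'' ::= Const 0 ;;
     ''ii'' ::= Const 0 ;; ''g'' ::= Reg ''R'' ;; rest) s Q"
    if "runs M rest ?s0 (\<lambda>\<tau>. Q (12 + \<tau>))" for rest Q
    using env[unfolded env_regs_def] by (simp, intro runs_mono[OF that[simplified]]) (simp add: eval_nat_numeral)
  have fin: "runs M (''al'' ::= Const 1 ;; read_code ''al'' ''idx'' ''pw'' ''ell'' 1) s1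
    (\<lambda>\<tau> s'. \<tau> \<le> \<mu> * 30 + 20 \<and> rounds_post fin bs s')"
    if I: "?I 0 s1" for s1
  proof -
    let ?s2 = "s1\<lparr>regs := (regs s1)(''al'' := 1)\<rparr>"
    \<comment> \<open>With no round left the counter equation says that \<open>ii\<close> is
      \<open>rounds (m - jj) jj\<close>, which exceeds \<open>jj\<close>, and hence
      \<open>ii\<close>, unless \<open>jj = m\<close>.\<close>
    have jj: "regs s1 ''jj'' = m"
    proof (rule ccontr)
      assume "regs s1 ''jj'' \<noteq> m"
      then have "m - regs s1 ''jj'' \<noteq> 0" using I by (auto simp: rounds_inv_def)
      then obtain d where "m - regs s1 ''jj'' = Suc d" by (cases "m - regs s1 ''jj''") auto
      then show False using I by (simp add: rounds_inv_def)
    qed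
    obtain r' where r': "\<forall>q < m. arrs s1 ''r'' q = r' q \<and> r' q < 2 ^ \<kappa>"
      "regs s1 ''ok'' = 1 \<and> fin r' (regs s1 ''v'') (read_bits False \<mu> 1 (drop (?R * ?c) bs))
        \<longleftrightarrow> accepts fin bs"
      using I unfolding rounds_inv_def jj by (auto simp del: verdict.simps(2))
    have e1: "regs s1 ''idx'' = num bs" "regs s1 ''pw'' = 2 ^ (length bs - ?R * ?c)"
      "regs s1 ''ell'' = \<mu>" "regs s1 ''ok'' \<le> 1" "regs s1 ''v'' < p"
      using I by (simp_all add: rounds_inv_def env_regs_def len)
    have "runs M (read_code ''al'' ''idx'' ''pw'' ''ell'' 1) ?s2 (\<lambda>\<tau> s'. \<tau> \<le> \<mu> * 30 + 10 \<and>
      regs s' ''al'' = read_bits False \<mu> (regs ?s2 ''al'') (drop (?R * ?c) bs) \<and>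
      regs s' ''pw'' = 2 ^ (length bs - (?R * ?c + 2 * \<mu>)))"
      by (rule runs_read_code) (use e1 lenY two in \<open>simp_all add: len\<close>)
    then have "runs M (read_code ''al'' ''idx'' ''pw'' ''ell'' 1) ?s2
      (\<lambda>\<tau> s'. 2 + \<tau> \<le> \<mu> * 30 + 20 \<and> rounds_post fin bs s')"
    proof (rule runs_frame)
      fix \<tau> and s' :: mem
      assume 1: "\<tau> \<le> \<mu> * 30 + 10 \<and>
          regs s' ''al'' = read_bits False \<mu> (regs ?s2 ''al'') (drop (?R * ?c) bs) \<and>
          regs s' ''pw'' = 2 ^ (length bs - (?R * ?c + 2 * \<mu>))"
        and 2: "\<And>x. x \<notin> assigned (read_code ''al'' ''idx'' ''pw'' ''ell'' 1) \<Longrightarrow> regs s' x = regs ?s2 x"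
        and 3: "\<And>a. a \<notin> written (read_code ''al'' ''idx'' ''pw'' ''ell'' 1) \<Longrightarrow> arrs s' a = arrs ?s2 a"
      have al: "regs s' ''al'' = read_bits False \<mu> 1 (drop (?R * ?c) bs)" using 1 by simp
      have "regs s' ''al'' < Y"
        using read_bits_less[of False \<mu> 1 "drop (?R * ?c) bs"] two(1) unfolding al by linarith
      moreover have "regs s' ''ok'' = regs s1 ''ok''" "regs s' ''v'' = regs s1 ''v''" "arrs s' ''r'' = arrs s1 ''r''"
        by (simp_all add: 2 3)
      ultimately show "2 + \<tau> \<le> \<mu> * 30 + 20 \<and> rounds_post fin bs s'"
        using 1 e1 r' al unfolding rounds_post_def by (intro conjI exI[of _ r']) simp_all
    qed
    then show ?thesis
      by (subst runs_Seq, subst runs_Assign) (simp del: verdict.simps)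
  qed
  show ?thesis
    unfolding rounds_code_def
    by (rule head, subst runs_Seq, rule runs_mono[OF loop[OF init]], elim conjE,
      drule fin, erule runs_mono) (auto simp: algebra_simps)
qed

end

section \<open>Computing one entry and filling the tensors\<close>

context bp_machine
begin

lemma entry_code_frame [simp]:
  "assigned (entry_code a out') =
    {''ok''} \<union> assigned rounds_code \<union> assigned (table_code a) \<union> assigned fold_code"
  "written (entry_code a out') = {''r'', ''F'', out'}"
  by (auto simp: entry_code_def
    simp del: rounds_code_frame(1) table_code_frame(1) fold_code_frame(1))

definition entry_time :: nat where
  "entry_time = rounds m 0 * (\<mu> * 90 + \<kappa> * 30 + 180) + \<mu> * 30 +
     2 ^ m * (K * (L * 30 + 50) + 120) + m * (2 ^ m * 40 + 40) + 150"

lemma runs_entry_code: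
  assumes env: "env s" and idx: "regs s ''idx'' = num bs" and len: "length bs = t"
    and k: "regs s ''k'' = k" "k < length xs"
  shows "runs M (entry_code arr out) s (\<lambda>\<tau> s'. \<tau> \<le> entry_time \<and>
    arrs s' out = (arrs s out)(k * 2 ^ t + num bs := of_bool (bp_tensor p \<kappa> \<mu> P L K side (xs ! k) bs)))"
proof -
  let ?f = "leaf_share P L K side (xs ! k)"
  let ?fin = "final_check p m side ?f"
  let ?T = "bp_tensor p \<kappa> \<mu> P L K side (xs ! k) bs"
  let ?last = "Cond (Reg ''side'')
       (''ok'' ::= Reg ''ok'' \<otimes>
         ((Read ''F'' (Const 0) \<oplus> Reg ''al'') \<odot> Reg ''p'' \<doteq> (Reg ''v'' \<oplus> Const 1) \<odot> Reg ''p''))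
       (''ok'' ::= Reg ''ok'' \<otimes> (Read ''F'' (Const 0) \<doteq> Reg ''al'' \<odot> Reg ''p'')) ;;
     Write out (Reg ''k'' \<otimes> Reg ''D'' \<oplus> Reg ''idx'') (Reg ''ok'')"
  let ?Q = "\<lambda>\<tau> s'. \<tau> \<le> entry_time \<and> arrs s' out = (arrs s out)(k * 2 ^ t + num bs := of_bool ?T)"
  have out: "out \<noteq> ''r''" "out \<noteq> ''F''" using names(2) by auto
  have "runs M (rounds_code ;; table_code arr ;; fold_code ;; ?last) s ?Q"
  proof (subst runs_Seq, rule runs_frame[OF runs_rounds_code[OF env idx len, of ?fin]])
    fix \<tau>1 and s1 :: mem
    assume "\<tau>1 \<le> rounds m 0 * (\<mu> * 90 + \<kappa> * 30 + 180) + \<mu> * 30 + 60 \<and> rounds_post ?fin bs s1"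
      and fr1: "\<And>x. x \<notin> assigned rounds_code \<Longrightarrow> regs s1 x = regs s x"
      and fa1: "\<And>a. a \<notin> written rounds_code \<Longrightarrow> arrs s1 a = arrs s a"
    note 1 = this(1)[unfolded rounds_post_def]
    obtain r' where r': "\<And>q. q < m \<Longrightarrow> arrs s1 ''r'' q = r' q" "\<And>q. q < m \<Longrightarrow> r' q < 2 ^ \<kappa>"
      "regs s1 ''ok'' = 1 \<and> ?fin r' (regs s1 ''v'') (regs s1 ''al'') \<longleftrightarrow> ?T"
      using 1 unfolding bp_tensor_def by blast
    have e1: "env_regs (regs s1)" "env_arrs (arrs s1)"
      using env by (auto intro!: env_regs_cong[of "regs s"] env_arrs_cong[of "arrs s"] fr1 fa1 simp: env_names_def)
    have k1: "regs s1 ''k'' = k" using k by (simp add: fr1)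
    show "runs M (table_code arr ;; fold_code ;; ?last) s1 (\<lambda>\<tau>2. ?Q (\<tau>1 + \<tau>2))"
    proof (subst runs_Seq, rule runs_frame[OF runs_table_code[OF conjI[OF e1] k1 k(2)]])
      fix \<tau>2 and s2 :: mem
      assume 2: "\<tau>2 \<le> 2 ^ m * (K * (L * 30 + 50) + 120) + 10 \<and>
          (\<forall>bs. length bs = m \<longrightarrow> arrs s2 ''F'' (num bs) = ?f bs)"
        and fr2: "\<And>x. x \<notin> assigned (table_code arr) \<Longrightarrow> regs s2 x = regs s1 x"
        and fa2: "\<And>a. a \<notin> written (table_code arr) \<Longrightarrow> arrs s2 a = arrs s1 a"
      have e2: "env_regs (regs s2)" "env_arrs (arrs s2)"
        using e1 by (auto intro!: env_regs_cong[of "regs s1"] env_arrs_cong[of "arrs s1"] fr2 fa2 simp: env_names_def)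
      have "runs M fold_code s2 (\<lambda>\<tau> s'. \<tau> \<le> m * (2 ^ m * 40 + 40) + 10 \<and> arrs s' ''F'' 0 < p \<and>
        [int (arrs s' ''F'' 0) = multilinear_ext m 0 (int_vec r') (\<lambda>bs. int (?f bs))] (mod int p))"
        by (rule runs_fold_code) (use e2 2 r' leaf_share_le_1 in \<open>simp_all add: fa2\<close>)
      then show "runs M (fold_code ;; ?last) s2 (\<lambda>\<tau>3. ?Q (\<tau>1 + (\<tau>2 + \<tau>3)))"
      proof (subst runs_Seq, elim runs_frame)
        fix \<tau>3 and s3 :: mem
        assume 3: "\<tau>3 \<le> m * (2 ^ m * 40 + 40) + 10 \<and> arrs s3 ''F'' 0 < p \<and>
            [int (arrs s3 ''F'' 0) = multilinear_ext m 0 (int_vec r') (\<lambda>bs. int (?f bs))] (mod int p)"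
          and fr3: "\<And>x. x \<notin> assigned fold_code \<Longrightarrow> regs s3 x = regs s2 x"
          and fa3: "\<And>a. a \<notin> written fold_code \<Longrightarrow> arrs s3 a = arrs s2 a"
        define F v al where "F = arrs s3 ''F'' 0" and "v = regs s1 ''v''" and "al = regs s1 ''al''"
        have r3: "regs s3 ''ok'' = regs s1 ''ok''" "regs s3 ''v'' = v" "regs s3 ''al'' = al"
          "regs s3 ''k'' = k" "regs s3 ''idx'' = num bs"
          "regs s3 ''side'' = side" "regs s3 ''p'' = p" "regs s3 ''D'' = 2 ^ t"
          using k1 idx e1(1) by (simp_all add: fr2 fr3 fr1 v_def al_def env_regs_def)
        have a3: "arrs s3 out = arrs s out" using out by (simp add: fa1 fa2 fa3)
        have ml: "[multilinear_ext m 0 (int_vec r') (\<lambda>bs. int (?f bs)) = int F] (mod int p)"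
          using 3 by (auto simp: F_def intro: cong_sym)
        have Fp: "F < p" using 3 by (simp add: F_def)
        \<comment> \<open>The congruences of the last check as comparisons of remainders;
          \<open>F\<close> is already reduced, so side 0 need only reduce the message.\<close>
        have fin: "?fin r' v al \<longleftrightarrow> (if side = 0 then F = al mod p else (F + al) mod p = (v + 1) mod p)"
        proof (cases "side = 0")
          case True
          have "[multilinear_ext m 0 (int_vec r') (\<lambda>bs. int (?f bs)) = int al] (mod int p)
            \<longleftrightarrow> [int F = int al] (mod int p)"
            using ml by (meson cong_sym cong_trans)
          also have "\<dots> \<longleftrightarrow> F = al mod p"
            using Fp unfolding cong_int_iff by (simp add: unique_euclidean_semiring_class.cong_def)
          finally show ?thesis using True by (simp add: final_check_def)
        next
          case False
          have "[multilinear_ext m 0 (int_vec r') (\<lambda>bs. int (?f bs)) + int al = int v + 1] (mod int p)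
            \<longleftrightarrow> [int F + int al = int v + 1] (mod int p)"
            using cong_add[OF ml cong_refl[of "int al"]] by (meson cong_sym cong_trans)
          also have "\<dots> \<longleftrightarrow> [int (F + al) = int (v + 1)] (mod int p)" by (simp add: add.commute)
          also have "\<dots> \<longleftrightarrow> (F + al) mod p = (v + 1) mod p"
            unfolding cong_int_iff by (simp add: unique_euclidean_semiring_class.cong_def)
          finally show ?thesis using False by (simp add: final_check_def)
        qed
        define chk where "chk \<longleftrightarrow> (if side = 0 then F = al mod p else (F + al) mod p = Suc v mod p)"
        define ok where "ok = regs s1 ''ok'' * of_bool chk"
        have T: "?T \<longleftrightarrow> regs s1 ''ok'' = 1 \<and> chk"
          using r'(3) fin unfolding v_def[symmetric] al_def[symmetric] chk_def Suc_eq_plus1 by blast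
        have "regs s1 ''ok'' = 0 \<or> regs s1 ''ok'' = 1" using 1 by linarith
        then have ok: "ok = of_bool ?T" unfolding ok_def T by auto
        have sm: "regs s1 ''ok'' < Y" "v < Y" "al < Y" "F < Y" "ok < Y" "num bs < Y" "k < Y"
        proof -
          show "regs s1 ''ok'' < Y" "v < Y" "al < Y" using 1 Y_ge less_Y(10) unfolding v_def al_def by linarith+
          show "F < Y" using Fp less_Y(10) by linarith
          show "ok < Y" unfolding ok using Y_ge by simp
          show "num bs < Y" using num_less[of bs] less_Y(13) unfolding len by linarith
          show "k < Y" using k(2) less_Y(18) by linarith
        qed
        have time: "\<tau>1 + (\<tau>2 + (\<tau>3 + 50)) \<le> entry_time"
          using 1 2 3 unfolding entry_time_def by linarith
        show "runs M ?last s3 (\<lambda>\<tau>4. ?Q (\<tau>1 + (\<tau>2 + (\<tau>3 + \<tau>4))))"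
        proof (cases "side = 0")
          case True
          have "regs s1 ''ok'' * of_bool (F = al mod p) = ok" using True by (simp add: ok_def chk_def)
          then show ?thesis
            using sm time True unfolding ok[symmetric] by (simp add: r3 a3 F_def[symmetric])
        next
          case False
          have "regs s1 ''ok'' * of_bool ((F + al) mod p = Suc v mod p) = ok" using False by (simp add: ok_def chk_def)
          then show ?thesis
            using sm time False unfolding ok[symmetric] by (simp add: r3 a3 F_def[symmetric])
        qed
      qed
    qed
  qed
  then show ?thesis unfolding entry_code_def .
qed

lemma tensors_code_frame [simp]:
  "assigned (tensors_code a out') = {''k'', ''idx''} \<union> assigned (entry_code a out')"
  "written (tensors_code a out') = {''r'', ''F'', out'}"
  by (auto simp: tensors_code_def simp del: entry_code_frame(1))

lemma runs_tensors_code: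
  assumes env: "env s"
  shows "runs M (tensors_code arr out) s (\<lambda>\<tau> s'.
    \<tau> \<le> length xs * (2 ^ t * (entry_time + 10) + 20) + 10 \<and>
    stores_tensors out t (map (bp_tensor p \<kappa> \<mu> P L K side) xs) s')"
proof -
  let ?D = "2 ^ t :: nat"
  let ?T = "\<lambda>k. bp_tensor p \<kappa> \<mu> P L K side (xs ! k)"
  define S where "S k s' \<longleftrightarrow> env s' \<and> (\<forall>k'<k. \<forall>i. length i = t \<longrightarrow>
    arrs s' out (k' * ?D + num i) = of_bool (?T k' i))" for k and s' :: mem
  define I where "I q s' \<longleftrightarrow> regs s' ''k'' + q = length xs \<and> S (regs s' ''k'') s'" for q and s' :: mem
  define J where "J k q s' \<longleftrightarrow> k < length xs \<and> regs s' ''k'' = k \<and> regs s' ''idx'' + q = ?D \<and> S k s' \<and>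
    (\<forall>i. length i = t \<longrightarrow> num i < regs s' ''idx'' \<longrightarrow> arrs s' out (k * ?D + num i) = of_bool (?T k i))"
    for k q and s' :: mem
  have distinct: "k' * ?D + num i \<noteq> k * ?D + num j" if "k' < k" "length i = t" for k k' i j
  proof -
    have "k' * ?D + num i < Suc k' * ?D" using num_less[of i] that by simp
    also have "\<dots> \<le> k * ?D" using that by (intro mult_right_mono) auto
    finally show ?thesis by linarith
  qed
  have names': "''U'' \<noteq> ''label''" "out \<notin> {''label'', ''edge'', ''A'', ''B''}" using names(2) by auto
  let ?inner = "entry_code arr out ;; ''idx'' ::= Reg ''idx'' \<oplus> Const 1"
  have inner: "runs M (While (Reg ''idx'' \<prec> Reg ''D'') ?inner) s'
      (\<lambda>\<tau> s'. \<tau> \<le> ?D * (entry_time + 8) + 4 \<and> k < length xs \<and> regs s' ''k'' = k \<and> S (Suc k) s')"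
    if "J k ?D s'" for k s'
  proof (rule runs_While[where I = "J k" and n = ?D and b = "entry_time + 4"])
    show "J k ?D s'" by fact
  next
    fix q s' assume J: "J k q s'"
    have D: "regs s' ''D'' = ?D" using J by (simp add: J_def S_def env_regs_def)
    have iq: "regs s' ''idx'' + q = ?D" and k: "k < length xs" "regs s' ''k'' = k"
      and e: "env_regs (regs s')" "env_arrs (arrs s')"
      using J by (auto simp: J_def S_def)
    have iY: "regs s' ''idx'' < Y" using iq less_Y(13) by linarith
    show "fits M (Reg ''idx'' \<prec> Reg ''D'') s' \<and> (val (Reg ''idx'' \<prec> Reg ''D'') s' \<noteq> 0 \<longrightarrow>
      0 < q \<and> runs M ?inner s' (\<lambda>\<tau> s'. \<tau> \<le> entry_time + 4 \<and> J k (q - 1) s'))"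
    proof (intro conjI impI)
      show "fits M (Reg ''idx'' \<prec> Reg ''D'') s'" using iY by (simp add: D)
      assume "val (Reg ''idx'' \<prec> Reg ''D'') s' \<noteq> 0"
      then have lt: "regs s' ''idx'' < ?D" by (simp add: D split: if_splits)
      then show q: "0 < q" using iq by linarith
      obtain bs where bs: "length bs = t" "num bs = regs s' ''idx''" using num_surj[OF lt] by auto
      show "runs M ?inner s' (\<lambda>\<tau> s'. \<tau> \<le> entry_time + 4 \<and> J k (q - 1) s')"
      proof (subst runs_Seq, rule runs_frame[OF runs_entry_code[OF conjI[OF e] bs(2)[symmetric] bs(1) k(2,1)]])
        fix \<tau> and s'' :: mem
        assume 1: "\<tau> \<le> entry_time \<and>
            arrs s'' out = (arrs s' out)(k * ?D + num bs := of_bool (?T k bs))"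
          and fr: "\<And>x. x \<notin> assigned (entry_code arr out) \<Longrightarrow> regs s'' x = regs s' x"
          and fa: "\<And>a. a \<notin> written (entry_code arr out) \<Longrightarrow> arrs s'' a = arrs s' a"
        have e'': "env_regs (regs s'')" "env_arrs (arrs s'')"
          using e names' by (auto intro!: env_regs_cong[of "regs s'"] env_arrs_cong[of "arrs s'"] fr fa
            simp: env_names_def)
        have S: "S k s''"
          using J e'' 1 distinct unfolding J_def S_def by simp
        have row: "arrs s'' out (k * ?D + num i) = of_bool (?T k i)"
          if "length i = t" "num i < Suc (num bs)" for i
        proof (cases "num i = num bs")
          case True
          then show ?thesis using num_inject[of i bs] that bs 1 by simp
        next
          case False
          then show ?thesis using that J bs 1 by (simp add: J_def)
        qed
        have r: "regs s'' ''k'' = k" "regs s'' ''idx'' = num bs" using k bs by (simp_all add: fr)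
        have "J k (q - 1) (s''\<lparr>regs := (regs s'')(''idx'' := Suc (num bs))\<rparr>)"
          using S row r iq q k bs(2) unfolding J_def S_def by simp
        then show "runs M (''idx'' ::= Reg ''idx'' \<oplus> Const 1) s''
            (\<lambda>\<tau>2 s'. \<tau> + \<tau>2 \<le> entry_time + 4 \<and> J k (q - 1) s')"
          using 1 iY bs(2) by (simp add: r)
      qed
    qed
  next
    fix q s' \<tau> assume J: "J k q s'" and v: "val (Reg ''idx'' \<prec> Reg ''D'') s' = 0"
      and \<tau>: "\<tau> \<le> ?D * (cost (Reg ''idx'' \<prec> Reg ''D'') + 1 + (entry_time + 4)) + cost (Reg ''idx'' \<prec> Reg ''D'') + 1"
    have D: "regs s' ''D'' = ?D" using J by (simp add: J_def S_def env_regs_def)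
    have "regs s' ''idx'' = ?D" using J v by (simp add: J_def D split: if_splits)
    then have "arrs s' out (k * ?D + num i) = of_bool (?T k i)" if "length i = t" for i
      using J num_less[of i] that by (simp add: J_def)
    then have "S (Suc k) s'" using J by (auto simp: J_def S_def less_Suc_eq)
    moreover have "\<tau> \<le> ?D * (entry_time + 8) + 4" using \<tau> by (simp add: algebra_simps)
    ultimately show "\<tau> \<le> ?D * (entry_time + 8) + 4 \<and> k < length xs \<and> regs s' ''k'' = k \<and> S (Suc k) s'"
      using J by (simp add: J_def)
  qed
  let ?outer = "''idx'' ::= Const 0 ;; While (Reg ''idx'' \<prec> Reg ''D'') ?inner ;; ''k'' ::= Reg ''k'' \<oplus> Const 1"
  let ?b = "?D * (entry_time + 8) + 10"
  have outer: "runs M (While (Reg ''k'' \<prec> Reg ''N'') ?outer) s'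
      (\<lambda>\<tau> s'. \<tau> \<le> length xs * (?b + 4) + 4 \<and> S (length xs) s')"
    if "I (length xs) s'" for s'
  proof (rule runs_While[where I = I and n = "length xs" and b = ?b])
    show "I (length xs) s'" by fact
  next
    fix q s' assume I: "I q s'"
    define k where "k = regs s' ''k''"
    have N: "regs s' ''N'' = length xs" using I by (simp add: I_def S_def env_regs_def)
    have kq: "k + q = length xs" and S: "S k s'" using I by (simp_all add: I_def k_def)
    have kY: "k < Y" using kq less_Y(18) by linarith
    show "fits M (Reg ''k'' \<prec> Reg ''N'') s' \<and> (val (Reg ''k'' \<prec> Reg ''N'') s' \<noteq> 0 \<longrightarrow>
      0 < q \<and> runs M ?outer s' (\<lambda>\<tau> s'. \<tau> \<le> ?b \<and> I (q - 1) s'))"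
    proof (intro conjI impI)
      show "fits M (Reg ''k'' \<prec> Reg ''N'') s'" using kY by (simp add: N k_def[symmetric])
      assume "val (Reg ''k'' \<prec> Reg ''N'') s' \<noteq> 0"
      then have lt: "k < length xs" by (simp add: N k_def split: if_splits)
      then show q: "0 < q" using kq by linarith
      let ?s1 = "s'\<lparr>regs := (regs s')(''idx'' := 0)\<rparr>"
      have "J k ?D ?s1" using S lt by (simp add: J_def S_def k_def)
      note in' = inner[OF this]
      have "runs M (While (Reg ''idx'' \<prec> Reg ''D'') ?inner ;; ''k'' ::= Reg ''k'' \<oplus> Const 1) ?s1
        (\<lambda>\<tau> s'. 2 + \<tau> \<le> ?b \<and> I (q - 1) s')"
      proof (subst runs_Seq, rule runs_mono[OF in'])
        fix \<tau> and s'' :: mem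
        assume 1: "\<tau> \<le> ?D * (entry_time + 8) + 4 \<and> k < length xs \<and> regs s'' ''k'' = k \<and> S (Suc k) s''"
        have "I (q - 1) (s''\<lparr>regs := (regs s'')(''k'' := Suc k)\<rparr>)"
          using 1 kq q by (simp add: I_def S_def)
        then show "runs M (''k'' ::= Reg ''k'' \<oplus> Const 1) s'' (\<lambda>\<tau>2 s'. 2 + (\<tau> + \<tau>2) \<le> ?b \<and> I (q - 1) s')"
          using 1 kY by simp
      qed
      then show "runs M ?outer s' (\<lambda>\<tau> s'. \<tau> \<le> ?b \<and> I (q - 1) s')"
        by (subst runs_Seq, subst runs_Assign) (simp del: runs_Seq)
    qed
  next
    fix q s' \<tau> assume I: "I q s'" and v: "val (Reg ''k'' \<prec> Reg ''N'') s' = 0"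
      and \<tau>: "\<tau> \<le> length xs * (cost (Reg ''k'' \<prec> Reg ''N'') + 1 + ?b) + cost (Reg ''k'' \<prec> Reg ''N'') + 1"
    have N: "regs s' ''N'' = length xs" using I by (simp add: I_def S_def env_regs_def)
    have "regs s' ''k'' = length xs" using I v by (simp add: I_def N split: if_splits)
    then have "S (length xs) s'" using I by (simp add: I_def)
    moreover have "\<tau> \<le> length xs * (?b + 4) + 4" using \<tau> by (simp add: algebra_simps)
    ultimately show "\<tau> \<le> length xs * (?b + 4) + 4 \<and> S (length xs) s'" by simp
  qed
  let ?s0 = "s\<lparr>regs := (regs s)(''k'' := 0)\<rparr>"
  have init: "I (length xs) ?s0" using env by (simp add: I_def S_def)
  have "runs M (While (Reg ''k'' \<prec> Reg ''N'') ?outer) ?s0 (\<lambda>\<tau> s'.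
    2 + \<tau> \<le> length xs * (?D * (entry_time + 10) + 20) + 10 \<and>
    stores_tensors out t (map (bp_tensor p \<kappa> \<mu> P L K side) xs) s')"
  proof (rule runs_mono[OF outer[OF init]])
    fix \<tau> and s' :: mem
    assume 1: "\<tau> \<le> length xs * (?b + 4) + 4 \<and> S (length xs) s'"
    have "length xs * (?b + 4) \<le> length xs * (?D * (entry_time + 10) + 20)"
      by (intro mult_left_mono) (simp_all add: algebra_simps)
    moreover have "2 + \<tau> \<le> w + 10" if "\<tau> \<le> u + 4" "u \<le> w" for u w using that by linarith
    ultimately have "2 + \<tau> \<le> length xs * (?D * (entry_time + 10) + 20) + 10" using 1 by blast
    with 1 show "2 + \<tau> \<le> length xs * (?D * (entry_time + 10) + 20) + 10 \<and>
      stores_tensors out t (map (bp_tensor p \<kappa> \<mu> P L K side) xs) s'"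
      by (simp add: S_def stores_tensors_def)
  qed
  then show ?thesis
    unfolding tensors_code_def
    by (subst runs_Seq, subst runs_Assign) (simp del: runs_Seq)
qed

end

section \<open>Computing the parameters\<close>

definition clog :: "nat \<Rightarrow> nat" where
  "clog n = (LEAST l. n \<le> 2 ^ l)"

lemma le_clog: "n \<le> 2 ^ clog n"
  unfolding clog_def by (rule LeastI[of _ n]) (simp add: less_imp_le)

lemma less_clog_iff: "l < clog n \<longleftrightarrow> 2 ^ l < n"
proof
  assume "l < clog n"
  then show "2 ^ l < n" unfolding clog_def using not_less_Least not_le by blast
next
  assume "2 ^ l < n"
  show "l < clog n"
  proof (rule ccontr)
    assume "\<not> l < clog n"
    then have "(2::nat) ^ clog n \<le> 2 ^ l" by (intro power_increasing) auto
    with le_clog[of n] \<open>2 ^ l < n\<close> show False by linarith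
  qed
qed

lemma two_power_clog_less: "1 \<le> n \<Longrightarrow> 2 ^ clog n < 2 * n"
  using less_clog_iff[of "clog n - 1" n] by (cases "clog n") auto

text \<open>Besides the logarithm in \<open>dst\<close> it leaves the power of two itself in
  register \<open>x\<close>, from which the search for the prime will start.\<close>

definition clog_code :: "string \<Rightarrow> expr \<Rightarrow> com" where
  "clog_code dst e = (dst ::= Const 0 ;; ''x'' ::= Const 1 ;;
     While (Reg ''x'' \<prec> e) (''x'' ::= Const 2 \<otimes> Reg ''x'' ;; dst ::= Reg dst \<oplus> Const 1))"

definition pow_code :: "string \<Rightarrow> string \<Rightarrow> com" where
  "pow_code dst cnt = (dst ::= Const 1 ;; ''c'' ::= Reg cnt ;;
     While (Reg ''c'') (dst ::= Const 2 \<otimes> Reg dst ;; ''c'' ::= Reg ''c'' \<ominus> Const 1))"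

text \<open>Trial division: as soon as a divisor \<open>d\<close> is found, the next candidate is
  tried from 2 again.\<close>

definition prime_code :: com where
  "prime_code = (''d'' ::= Const 2 ;;
     While (Reg ''d'' \<prec> Reg ''p'')
       (Cond (Reg ''p'' \<odot> Reg ''d'') (''d'' ::= Reg ''d'' \<oplus> Const 1)
          (''p'' ::= Reg ''p'' \<oplus> Const 1 ;; ''d'' ::= Const 2)))"

lemma setup_frames [simp]:
  "assigned (clog_code dst e) = {dst, ''x''}" "written (clog_code dst e) = {}"
  "assigned (pow_code dst cnt) = {dst, ''c''}" "written (pow_code dst cnt) = {}"
  "assigned prime_code = {''p'', ''d''}" "written prime_code = {}"
  by (auto simp: clog_code_def pow_code_def prime_code_def)

fun expr_regs :: "expr \<Rightarrow> string set" where
  "expr_regs (Const k) = {}"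
| "expr_regs (Reg x) = {x}"
| "expr_regs (Read a e) = expr_regs e"
| "expr_regs (Op f e1 e2) = expr_regs e1 \<union> expr_regs e2"

lemma val_cong:
  "(\<And>x. x \<in> expr_regs e \<Longrightarrow> regs s' x = regs s x) \<Longrightarrow> arrs s' = arrs s \<Longrightarrow> val e s' = val e s"
  by (induction e) auto

lemma small_cong:
  "(\<And>x. x \<in> expr_regs e \<Longrightarrow> regs s' x = regs s x) \<Longrightarrow> arrs s' = arrs s \<Longrightarrow> small Y e s' = small Y e s"
proof (induction e)
  case (Read a e)
  then have "val e s' = val e s" by (intro val_cong) auto
  with Read show ?case by simp
qed simp_all

lemma runs_frame_regs:
  assumes "runs M c s Q" "written c = {}"
    and "\<And>\<tau> s'. Q \<tau> s' \<Longrightarrow> (\<And>x. x \<notin> assigned c \<Longrightarrow> regs s' x = regs s x) \<Longrightarrow>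
      arrs s' = arrs s \<Longrightarrow> Q' \<tau> s'"
  shows "runs M c s Q'"
  by (rule runs_frame[OF assms(1)]) (rule assms(3), auto simp: assms(2))

context word_ram
begin

lemma runs_clog_code:
  assumes e: "expr_regs e \<inter> {dst, ''x''} = {}" "small Y e s" "cost e \<le> 20"
    and n: "val e s = n" and bnd: "2 ^ clog n < Y" and dst: "dst \<noteq> ''x''"
  shows "runs M (clog_code dst e) s (\<lambda>\<tau> s'. \<tau> \<le> clog n * 40 + 40 \<and>
    regs s' dst = clog n \<and> regs s' ''x'' = 2 ^ clog n)"
proof -
  define I where "I q s' \<longleftrightarrow> regs s' dst + q = clog n \<and> regs s' ''x'' = 2 ^ regs s' dst \<and>
    (\<forall>y. y \<notin> {dst, ''x''} \<longrightarrow> regs s' y = regs s y) \<and> arrs s' = arrs s" for q and s' :: mem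
  let ?body = "''x'' ::= Const 2 \<otimes> Reg ''x'' ;; dst ::= Reg dst \<oplus> Const 1"
  have loop: "runs M (While (Reg ''x'' \<prec> e) ?body) s' (\<lambda>\<tau> s'. \<tau> \<le> clog n * 33 + 23 \<and>
      regs s' dst = clog n \<and> regs s' ''x'' = 2 ^ clog n)" if "I (clog n) s'" for s'
  proof (rule runs_While[where I = I and n = "clog n" and b = 10])
    show "I (clog n) s'" by fact
  next
    fix q s' assume I: "I q s'"
    define l where "l = regs s' dst"
    have x: "regs s' ''x'' = 2 ^ l" and lq: "l + q = clog n" using I by (auto simp: I_def l_def)
    have xY: "2 ^ l < Y"
      using power_increasing[of l "clog n" "2::nat"] lq bnd by linarith
    have lY: "l < Y" using less_exp[of l] xY by linarith
    have same: "regs s' y = regs s y" if "y \<in> expr_regs e" for y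
      using I e(1) that by (auto simp: I_def)
    have arrs: "arrs s' = arrs s" using I by (simp add: I_def)
    have v: "val e s' = n" "small Y e s'"
      using val_cong[OF same arrs] small_cong[OF same arrs] n e(2) by auto
    show "fits M (Reg ''x'' \<prec> e) s' \<and> (val (Reg ''x'' \<prec> e) s' \<noteq> 0 \<longrightarrow>
      0 < q \<and> runs M ?body s' (\<lambda>\<tau> s'. \<tau> \<le> 10 \<and> I (q - 1) s'))"
    proof (intro conjI impI)
      show "fits M (Reg ''x'' \<prec> e) s'" using xY v e(3) by (simp add: x)
      assume "val (Reg ''x'' \<prec> e) s' \<noteq> 0"
      then have "l < clog n" by (simp add: x v less_clog_iff split: if_splits)
      then show "0 < q" using lq by linarith
      then show "runs M ?body s' (\<lambda>\<tau> s'. \<tau> \<le> 10 \<and> I (q - 1) s')"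
        using I xY lY lq dst by (auto simp: I_def x l_def[symmetric])
    qed
  next
    fix q s' \<tau> assume I: "I q s'" and z: "val (Reg ''x'' \<prec> e) s' = 0"
      and \<tau>: "\<tau> \<le> clog n * (cost (Reg ''x'' \<prec> e) + 1 + 10) + cost (Reg ''x'' \<prec> e) + 1"
    have same: "regs s' y = regs s y" if "y \<in> expr_regs e" for y
      using I e(1) that by (auto simp: I_def)
    have arrs: "arrs s' = arrs s" using I by (simp add: I_def)
    have v: "val e s' = n" using val_cong[OF same arrs] n by auto
    have "\<not> regs s' dst < clog n"
      using I z unfolding less_clog_iff by (simp add: I_def v split: if_splits)
    then have "regs s' dst = clog n" using I unfolding I_def by linarith
    moreover have "\<tau> \<le> clog n * 33 + 23"
    proof -
      have "\<tau> \<le> clog n * (cost e + 13) + (cost e + 3)" using \<tau> by (simp add: add.commute)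
      also have "\<dots> \<le> clog n * 33 + 23" using e(3) by (intro add_mono mult_left_mono) auto
      finally show ?thesis .
    qed
    ultimately show "\<tau> \<le> clog n * 33 + 23 \<and> regs s' dst = clog n \<and> regs s' ''x'' = 2 ^ clog n"
      using I by (simp add: I_def)
  qed
  have init: "I (clog n) (s\<lparr>regs := (regs s)(dst := 0, ''x'' := 1)\<rparr>)" using dst by (simp add: I_def)
  have "runs M (While (Reg ''x'' \<prec> e) ?body) (s\<lparr>regs := (regs s)(dst := 0, ''x'' := 1)\<rparr>)
    (\<lambda>\<tau> s'. 4 + \<tau> \<le> clog n * 40 + 40 \<and> regs s' dst = clog n \<and> regs s' ''x'' = 2 ^ clog n)"
    by (rule runs_mono[OF loop[OF init]]) auto
  note body = this
  have head: "runs M (dst ::= Const 0 ;; ''x'' ::= Const 1 ;; rest) s (\<lambda>\<tau> s'. \<tau> \<le> B \<and> Q s')"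
    if "runs M rest (s\<lparr>regs := (regs s)(dst := 0, ''x'' := 1)\<rparr>) (\<lambda>\<tau> s'. 4 + \<tau> \<le> B \<and> Q s')" for rest B Q
    using that by (auto elim!: runs_mono)
  show ?thesis unfolding clog_code_def by (rule head, rule body)
qed

lemma runs_pow_code:
  assumes n: "regs s cnt = n" "cnt \<noteq> dst" and bnd: "2 ^ n < Y" and dst: "dst \<noteq> ''c''"
  shows "runs M (pow_code dst cnt) s (\<lambda>\<tau> s'. \<tau> \<le> n * 20 + 20 \<and> regs s' dst = 2 ^ n)"
proof -
  define I where "I q s' \<longleftrightarrow> q \<le> n \<and> regs s' ''c'' = q \<and> regs s' dst = 2 ^ (n - q)" for q and s' :: mem
  let ?body = "dst ::= Const 2 \<otimes> Reg dst ;; ''c'' ::= Reg ''c'' \<ominus> Const 1"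
  have nY: "n < Y" using less_exp[of n] bnd by linarith
  have loop: "runs M (While (Reg ''c'') ?body) s' (\<lambda>\<tau> s'. \<tau> \<le> n * 12 + 2 \<and> regs s' dst = 2 ^ n)"
    if "I n s'" for s'
  proof (rule runs_While[where I = I and n = n and b = 10])
    show "I n s'" by fact
  next
    fix q s' assume I: "I q s'"
    have r: "regs s' ''c'' = q" "q \<le> n" "regs s' dst = 2 ^ (n - q)" using I by (auto simp: I_def)
    have Y: "q < Y" "2 ^ (n - q) < Y"
      using r nY power_increasing[of "n - q" n "2::nat"] bnd by linarith+
    have pow: "2 * 2 ^ (n - q) = (2::nat) ^ (n - (q - Suc 0))" if "0 < q"
    proof -
      have "n - (q - Suc 0) = Suc (n - q)" using that r(2) by simp
      then show ?thesis by simp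
    qed
    show "fits M (Reg ''c'') s' \<and> (val (Reg ''c'') s' \<noteq> 0 \<longrightarrow>
      0 < q \<and> runs M ?body s' (\<lambda>\<tau> s'. \<tau> \<le> 10 \<and> I (q - 1) s'))"
      using Y dst r(2) pow by (auto simp: r(1,3) I_def)
  next
    fix q s' \<tau> assume "I q s'" "val (Reg ''c'') s' = 0"
      "\<tau> \<le> n * (cost (Reg ''c'') + 1 + 10) + cost (Reg ''c'') + 1"
    then show "\<tau> \<le> n * 12 + 2 \<and> regs s' dst = 2 ^ n" by (auto simp: I_def)
  qed
  have init: "I n (s\<lparr>regs := (regs s)(dst := 1, ''c'' := n)\<rparr>)" using dst by (simp add: I_def)
  have "runs M (While (Reg ''c'') ?body) (s\<lparr>regs := (regs s)(dst := 1, ''c'' := n)\<rparr>)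
    (\<lambda>\<tau> s'. 4 + \<tau> \<le> n * 20 + 20 \<and> regs s' dst = 2 ^ n)"
    by (rule runs_mono[OF loop[OF init]]) auto
  note body = this
  have head: "runs M (dst ::= Const 1 ;; ''c'' ::= Reg cnt ;; rest) s (\<lambda>\<tau> s'. \<tau> \<le> B \<and> Q s')"
    if "runs M rest (s\<lparr>regs := (regs s)(dst := 1, ''c'' := n)\<rparr>) (\<lambda>\<tau> s'. 4 + \<tau> \<le> B \<and> Q s')" for rest B Q
    using that n nY by (auto elim!: runs_mono)
  show ?thesis unfolding pow_code_def by (rule head, rule body)
qed

text \<open>Any prime \<open>q\<close> not below the start bounds the search, though a smaller prime
  may be found. At most \<open>q + 1\<close> candidates with at most \<open>q + 1\<close> divisors
  each give the quadratic time.\<close>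

lemma runs_prime_code:
  assumes p: "regs s ''p'' = p0" "2 \<le> p0" "p0 \<le> q" and q: "prime q" "q < Y"
  shows "runs M prime_code s (\<lambda>\<tau> s'. \<tau> \<le> (q + 1) * (q + 1) * 20 + 10 \<and>
    prime (regs s' ''p'') \<and> p0 \<le> regs s' ''p'' \<and> regs s' ''p'' \<le> q)"
proof -
  \<comment> \<open>The measure is lexicographic: stepping to the next candidate gains
    \<open>q + 1\<close>, which outweighs the reset of \<open>d\<close>.\<close>
  define I where "I k s' \<longleftrightarrow> (let p = regs s' ''p''; d = regs s' ''d'' in
    p0 \<le> p \<and> p \<le> q \<and> 2 \<le> d \<and> d \<le> p \<and> (\<forall>e. 2 \<le> e \<longrightarrow> e < d \<longrightarrow> \<not> e dvd p) \<and>
    k = (q - p) * (q + 1) + (p - d))" for k and s' :: mem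
  let ?body = "Cond (Reg ''p'' \<odot> Reg ''d'') (''d'' ::= Reg ''d'' \<oplus> Const 1)
          (''p'' ::= Reg ''p'' \<oplus> Const 1 ;; ''d'' ::= Const 2)"
  let ?n = "(q - p0) * (q + 1) + (p0 - 2)"
  have loop: "runs M (While (Reg ''d'' \<prec> Reg ''p'') ?body) s' (\<lambda>\<tau> s'. \<tau> \<le> ?n * 18 + 4 \<and>
      prime (regs s' ''p'') \<and> p0 \<le> regs s' ''p'' \<and> regs s' ''p'' \<le> q)" if "I ?n s'" for s'
  \<comment> \<open>The measure can drop by more than one at a new candidate, while the loop rule
    counts single steps; closing the invariant upwards in \<open>k\<close> reconciles them.\<close>
  proof (rule runs_While[where I = "\<lambda>k s. \<exists>k' \<le> k. I k' s" and n = ?n and b = 14])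
    show "\<exists>k' \<le> ?n. I k' s'" using that by blast
  next
    fix k s' assume "\<exists>k' \<le> k. I k' s'"
    then obtain k' where I: "I k' s'" "k' \<le> k" by blast
    define p d where "p = regs s' ''p''" and "d = regs s' ''d''"
    have r: "p0 \<le> p" "p \<le> q" "2 \<le> d" "d \<le> p" "\<And>e. 2 \<le> e \<Longrightarrow> e < d \<Longrightarrow> \<not> e dvd p"
      "k' = (q - p) * (q + 1) + (p - d)"
      using I(1) by (auto simp: I_def Let_def p_def d_def)
    have Y: "p < Y" "d < Y" using r q by linarith+
    show "fits M (Reg ''d'' \<prec> Reg ''p'') s' \<and> (val (Reg ''d'' \<prec> Reg ''p'') s' \<noteq> 0 \<longrightarrow>
      0 < k \<and> runs M ?body s' (\<lambda>\<tau> s'. \<tau> \<le> 14 \<and> (\<exists>k' \<le> k - 1. I k' s')))"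
    proof (intro conjI impI)
      show "fits M (Reg ''d'' \<prec> Reg ''p'') s'" using Y by (simp add: p_def d_def)
      assume "val (Reg ''d'' \<prec> Reg ''p'') s' \<noteq> 0"
      then have dp: "d < p" by (simp add: p_def d_def split: if_splits)
      then have k'0: "0 < k'" by (simp add: r(6))
      then show "0 < k" using I(2) by linarith
      show "runs M ?body s' (\<lambda>\<tau> s'. \<tau> \<le> 14 \<and> (\<exists>k' \<le> k - 1. I k' s'))"
      proof (cases "p mod d = 0")
        case True
        then have "\<not> prime p" using dp r(3) by (auto simp: prime_nat_iff mod_eq_0_iff_dvd)
        then have "p < q" using r(2) q(1) by (cases "p = q") auto
        then obtain a where a: "q - p = Suc a" "q - Suc p = a" by (cases "q - p") auto
        let ?s = "s'\<lparr>regs := (regs s')(''p'' := Suc p, ''d'' := 2)\<rparr>"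
        have "I (a * (q + 1) + (Suc p - 2)) ?s"
          using r(1-4) \<open>p < q\<close> by (simp add: I_def a)
        moreover have "k' = a * (q + 1) + (q + 1) + (p - d)" unfolding r(6) a(1) by simp
        then have "a * (q + 1) + (Suc p - 2) \<le> k - 1"
          using r(2,3,4) I(2) dp \<open>p < q\<close> by linarith
        ultimately have "\<exists>k' \<le> k - 1. I k' ?s" by blast
        then show ?thesis
          using Y True by (simp add: p_def[symmetric] d_def[symmetric])
      next
        case False
        let ?s = "s'\<lparr>regs := (regs s')(''d'' := Suc d)\<rparr>"
        have "\<not> d dvd p" using False by (simp add: mod_eq_0_iff_dvd)
        then have "I ((q - p) * (q + 1) + (p - Suc d)) ?s"
          using r(1-5) dp by (auto simp: I_def Let_def p_def[symmetric] less_Suc_eq)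
        moreover have "(q - p) * (q + 1) + (p - Suc d) \<le> k - 1"
          using r(6) I(2) dp by linarith
        ultimately have "\<exists>k' \<le> k - 1. I k' ?s" by blast
        then show ?thesis
          using Y False by (simp add: p_def[symmetric] d_def[symmetric])
      qed
    qed
  next
    fix k s' \<tau> assume "\<exists>k' \<le> k. I k' s'" and z: "val (Reg ''d'' \<prec> Reg ''p'') s' = 0"
      and \<tau>: "\<tau> \<le> ?n * (cost (Reg ''d'' \<prec> Reg ''p'') + 1 + 14) + cost (Reg ''d'' \<prec> Reg ''p'') + 1"
    then obtain k' where I: "I k' s'" by blast
    define p where "p = regs s' ''p''"
    have r: "p0 \<le> p" "p \<le> q" "\<And>e. 2 \<le> e \<Longrightarrow> e < p \<Longrightarrow> \<not> e dvd p"
      using I z by (auto simp: I_def Let_def p_def split: if_splits)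
    have "prime p"
      unfolding prime_nat_iff
    proof (intro conjI allI impI)
      show p1: "1 < p" using r p by linarith
      fix e assume e: "e dvd p"
      then have "e \<le> p" "e \<noteq> 0" using p1 by (auto dest: dvd_imp_le intro!: Nat.gr0I)
      then show "e = 1 \<or> e = p" using r(3)[of e] e by (cases "e < 2"; cases "e < p") auto
    qed
    then show "\<tau> \<le> ?n * 18 + 4 \<and> prime (regs s' ''p'') \<and> p0 \<le> regs s' ''p'' \<and> regs s' ''p'' \<le> q"
      using r \<tau> by (simp add: p_def)
  qed
  have init: "I ?n (s\<lparr>regs := (regs s)(''d'' := 2)\<rparr>)" using p by (simp add: I_def)
  have n: "?n \<le> (q + 1) * (q + 1)"
  proof -
    have "(q - p0) * (q + 1) + (p0 - 2) \<le> (q - p0) * (q + 1) + p0 * (q + 1)" by simp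
    also have "\<dots> = q * (q + 1)" using p(3) by (simp flip: distrib_right)
    also have "\<dots> \<le> (q + 1) * (q + 1)" by (intro mult_right_mono) auto
    finally show ?thesis .
  qed
  have "runs M (While (Reg ''d'' \<prec> Reg ''p'') ?body) (s\<lparr>regs := (regs s)(''d'' := 2)\<rparr>)
    (\<lambda>\<tau> s'. 2 + \<tau> \<le> (q + 1) * (q + 1) * 20 + 10 \<and>
    prime (regs s' ''p'') \<and> p0 \<le> regs s' ''p'' \<and> regs s' ''p'' \<le> q)"
  proof (rule runs_mono[OF loop[OF init]])
    fix \<tau> and s' :: mem
    assume 1: "\<tau> \<le> ?n * 18 + 4 \<and> prime (regs s' ''p'') \<and> p0 \<le> regs s' ''p'' \<and> regs s' ''p'' \<le> q"
    have "2 + \<tau> \<le> w * 20 + 10" if "\<tau> \<le> u * 18 + 4" "u \<le> w" for u w using that by linarith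
    from this[OF _ n] 1 show "2 + \<tau> \<le> (q + 1) * (q + 1) * 20 + 10 \<and>
      prime (regs s' ''p'') \<and> p0 \<le> regs s' ''p'' \<and> regs s' ''p'' \<le> q" by blast
  qed
  then show ?thesis
    unfolding prime_code_def by (subst runs_Seq, subst runs_Assign) simp
qed


lemma runs_Seq_time:
  assumes "runs M c1 s (\<lambda>\<tau> s'. \<tau> \<le> a \<and> A s')"
    and "\<And>s'. A s' \<Longrightarrow> runs M c2 s' (\<lambda>\<tau> s''. \<tau> \<le> b \<and> B s'')"
  shows "runs M (c1 ;; c2) s (\<lambda>\<tau> s''. \<tau> \<le> a + b \<and> B s'')"
  by (subst runs_Seq, rule runs_mono[OF assms(1)], elim conjE, drule assms(2), erule runs_mono) auto

end

text \<open>The initial candidate is \<open>2 ^ \<kappa>\<close>, still in \<open>x\<close>, except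
  that for \<open>\<kappa> = 0\<close> the comparison with 1 raises it to 2. Messages get
  \<open>2 * \<kappa>\<close> bits since a prime exists up to \<open>2 ^ (2 * \<kappa>)\<close> when
  \<open>3 \<le> \<kappa>\<close>.\<close>

definition setup_code :: com where
  "setup_code =
    ((''n2'' ::= Reg ''n'' \<oslash> Const 2 ;;
      Cond (Reg ''T'' \<prec> Const 3) (''L'' ::= Const 0) (clog_code ''L'' (Reg ''W''))) ;;
     clog_code ''K'' (Reg ''T'' \<ominus> Const 1) ;;
     ''m'' ::= Const 2 \<otimes> Reg ''L'' \<otimes> Reg ''K'' ;;
     clog_code ''kap'' (Reg ''m'' \<otimes> (Reg ''m'' \<oplus> Const 1) \<otimes> Reg ''inveps'' \<oplus> Const 1) ;;
     (''p'' ::= Reg ''x'' \<oplus> (Reg ''x'' \<doteq> Const 1) ;;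
      ''ell'' ::= Const 2 \<otimes> Reg ''kap'' ;;
      ''R'' ::= Reg ''m'' \<otimes> (Reg ''m'' \<oplus> Const 1) \<oslash> Const 2 ;;
      ''t'' ::= Reg ''R'' \<otimes> (Const 6 \<otimes> Reg ''ell'' \<oplus> Const 2 \<otimes> Reg ''kap'') \<oplus> Const 2 \<otimes> Reg ''ell'') ;;
     pow_code ''H'' ''K'' ;; pow_code ''Q'' ''m'' ;; pow_code ''D'' ''t'' ;; prime_code)"

lemma (in word_ram) runs_setup_code:
  fixes n T W iv q :: nat and s :: mem
  defines "L \<equiv> if T < 3 then 0 else clog W" and "K \<equiv> clog (T - 1)"
  defines "m \<equiv> 2 * L * K"
  defines "\<kappa> \<equiv> clog (m * (m + 1) * iv + 1)"
  defines "t \<equiv> rounds m 0 * (6 * (2 * \<kappa>) + 2 * \<kappa>) + 2 * (2 * \<kappa>)"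
  assumes regs: "regs s ''n'' = n" "regs s ''T'' = T" "regs s ''W'' = W" "regs s ''inveps'' = iv"
    and Y: "n < Y" "T < Y" "W < Y" "iv < Y" "2 ^ L < Y" "2 ^ K < Y" "2 ^ m < Y" "2 ^ \<kappa> < Y"
      "2 * \<kappa> < Y" "2 ^ t < Y" "rounds m 0 < Y"
    and q: "prime q" "q < Y" "2 ^ \<kappa> + of_bool (\<kappa> = 0) \<le> q"
  shows "runs M setup_code s (\<lambda>\<tau> s'.
    \<tau> \<le> L * 40 + K * 60 + \<kappa> * 40 + m * 20 + t * 20 + (q + 1) * (q + 1) * 20 + 400 \<and>
    regs s' ''L'' = L \<and> regs s' ''K'' = K \<and> regs s' ''m'' = m \<and> regs s' ''kap'' = \<kappa> \<and>
    regs s' ''ell'' = 2 * \<kappa> \<and> regs s' ''R'' = rounds m 0 \<and> regs s' ''t'' = t \<and>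
    regs s' ''H'' = 2 ^ K \<and> regs s' ''Q'' = 2 ^ m \<and> regs s' ''D'' = 2 ^ t \<and> regs s' ''n2'' = n div 2 \<and>
    prime (regs s' ''p'') \<and> 2 ^ \<kappa> \<le> regs s' ''p'' \<and> regs s' ''p'' \<le> q \<and>
    regs s' ''N'' = regs s ''N'' \<and> regs s' ''T'' = T \<and> regs s' ''W'' = W \<and> arrs s' = arrs s)"
    (is "runs _ _ _ (\<lambda>\<tau> s'. _ \<and> ?post s')")
proof -
  define B where "B s' \<longleftrightarrow> regs s' ''N'' = regs s ''N'' \<and> regs s' ''T'' = T \<and> regs s' ''W'' = W \<and>
    regs s' ''inveps'' = iv \<and> regs s' ''n2'' = n div 2 \<and> regs s' ''L'' = L \<and> arrs s' = arrs s" for s' :: mem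
  define B2 where "B2 s' \<longleftrightarrow> B s' \<and> regs s' ''K'' = K" for s' :: mem
  define B3 where "B3 s' \<longleftrightarrow> B2 s' \<and> regs s' ''m'' = m" for s' :: mem
  define B4 where "B4 s' \<longleftrightarrow> B3 s' \<and> regs s' ''kap'' = \<kappa>" for s' :: mem
  define B5 where "B5 s' \<longleftrightarrow> B4 s' \<and> regs s' ''ell'' = 2 * \<kappa> \<and> regs s' ''R'' = rounds m 0 \<and>
    regs s' ''t'' = t \<and> regs s' ''p'' = 2 ^ \<kappa> + of_bool (\<kappa> = 0)" for s' :: mem
  define B6 where "B6 s' \<longleftrightarrow> B5 s' \<and> regs s' ''H'' = 2 ^ K" for s' :: mem
  define B7 where "B7 s' \<longleftrightarrow> B6 s' \<and> regs s' ''Q'' = 2 ^ m" for s' :: mem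
  define B8 where "B8 s' \<longleftrightarrow> B7 s' \<and> regs s' ''D'' = 2 ^ t" for s' :: mem
  note Bs = B_def B2_def B3_def B4_def B5_def B6_def B7_def B8_def
  have lessY: "K < Y" "m < Y" "L < Y" "\<kappa> < Y" "t < Y"
    using Y less_exp[of K] less_exp[of m] less_exp[of L] less_exp[of t] by linarith+
  have 1: "runs M (''n2'' ::= Reg ''n'' \<oslash> Const 2 ;;
      Cond (Reg ''T'' \<prec> Const 3) (''L'' ::= Const 0) (clog_code ''L'' (Reg ''W''))) s
    (\<lambda>\<tau> s'. \<tau> \<le> L * 40 + 60 \<and> B s')"
  proof (cases "T < 3")
    case True
    then show ?thesis using regs Y by (simp add: B_def L_def)
  next
    case False
    let ?s1 = "s\<lparr>regs := (regs s)(''n2'' := n div 2)\<rparr>"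
    have L: "L = clog W" using False by (simp add: L_def)
    have "runs M (clog_code ''L'' (Reg ''W'')) ?s1 (\<lambda>\<tau> s'. \<tau> \<le> clog W * 40 + 40 \<and>
      regs s' ''L'' = clog W \<and> regs s' ''x'' = 2 ^ clog W)"
      by (rule runs_clog_code) (use regs Y L in auto)
    then have "runs M (clog_code ''L'' (Reg ''W'')) ?s1 (\<lambda>\<tau> s'. \<tau> \<le> L * 40 + 40 \<and> B s')"
      by (rule runs_frame_regs) (use regs L in \<open>simp_all add: B_def\<close>)
    then have "runs M (clog_code ''L'' (Reg ''W'')) ?s1 (\<lambda>\<tau> s'. 10 + \<tau> \<le> L * 40 + 60 \<and> B s')"
      by (rule runs_mono) auto
    then show ?thesis using regs Y False by (auto elim!: runs_mono)
  qed
  have 2: "runs M (clog_code ''K'' (Reg ''T'' \<ominus> Const 1)) s' (\<lambda>\<tau> s'. \<tau> \<le> K * 40 + 40 \<and> B2 s')" if "B s'" for s'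
  proof (rule runs_frame_regs[OF runs_clog_code[where n = "T - 1"]])
    show "small Y (Reg ''T'' \<ominus> Const 1) s'" "val (Reg ''T'' \<ominus> Const 1) s' = T - 1"
      using that Y by (simp_all add: B_def)
  qed (use that Y in \<open>simp_all add: Bs K_def\<close>)
  have 3: "runs M (''m'' ::= Const 2 \<otimes> Reg ''L'' \<otimes> Reg ''K'') s' (\<lambda>\<tau> s'. \<tau> \<le> 10 \<and> B3 s')" if "B2 s'" for s'
    using that lessY by (simp add: B_def B2_def B3_def m_def)
  have 4: "runs M (clog_code ''kap'' (Reg ''m'' \<otimes> (Reg ''m'' \<oplus> Const 1) \<otimes> Reg ''inveps'' \<oplus> Const 1)) s'
    (\<lambda>\<tau> s'. \<tau> \<le> \<kappa> * 40 + 40 \<and> B4 s' \<and> regs s' ''x'' = 2 ^ \<kappa>)" if "B3 s'" for s'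
  proof (rule runs_frame_regs[OF runs_clog_code[where n = "m * (m + 1) * iv + 1"]])
    show "small Y (Reg ''m'' \<otimes> (Reg ''m'' \<oplus> Const 1) \<otimes> Reg ''inveps'' \<oplus> Const 1) s'"
      "val (Reg ''m'' \<otimes> (Reg ''m'' \<oplus> Const 1) \<otimes> Reg ''inveps'' \<oplus> Const 1) s' = m * (m + 1) * iv + 1"
      using that Y lessY by (simp_all add: B_def B2_def B3_def)
    show "2 ^ clog (m * (m + 1) * iv + 1) < Y" using Y(8) by (simp add: \<kappa>_def)
  next
    fix \<tau> and s'' :: mem
    assume "\<tau> \<le> clog (m * (m + 1) * iv + 1) * 40 + 40 \<and> regs s'' ''kap'' = clog (m * (m + 1) * iv + 1) \<and>
        regs s'' ''x'' = 2 ^ clog (m * (m + 1) * iv + 1)"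
      and fr: "\<And>x. x \<notin> assigned (clog_code ''kap'' (Reg ''m'' \<otimes> (Reg ''m'' \<oplus> Const 1) \<otimes> Reg ''inveps'' \<oplus> Const 1))
         \<Longrightarrow> regs s'' x = regs s' x"
      and fa: "arrs s'' = arrs s'"
    then show "\<tau> \<le> \<kappa> * 40 + 40 \<and> B4 s'' \<and> regs s'' ''x'' = 2 ^ \<kappa>"
      using that unfolding \<kappa>_def[symmetric] by (simp add: B_def B2_def B3_def B4_def)
  qed simp_all
  have R: "m * (m + 1) div 2 = rounds m 0" using twice_rounds[of m 0] by simp
  have 5: "runs M (''p'' ::= Reg ''x'' \<oplus> (Reg ''x'' \<doteq> Const 1) ;;
      ''ell'' ::= Const 2 \<otimes> Reg ''kap'' ;;
      ''R'' ::= Reg ''m'' \<otimes> (Reg ''m'' \<oplus> Const 1) \<oslash> Const 2 ;;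
      ''t'' ::= Reg ''R'' \<otimes> (Const 6 \<otimes> Reg ''ell'' \<oplus> Const 2 \<otimes> Reg ''kap'') \<oplus> Const 2 \<otimes> Reg ''ell'') s'
    (\<lambda>\<tau> s'. \<tau> \<le> 60 \<and> B5 s')" if "B4 s' \<and> regs s' ''x'' = 2 ^ \<kappa>" for s'
  proof -
    have x1: "(2 ^ \<kappa> = Suc 0) = (\<kappa> = 0)" by simp
    have R': "(m + m * m) div 2 = rounds m 0" using R by simp
    show ?thesis
      using that Y lessY by (simp add: B_def B2_def B3_def B4_def B5_def x1 R' t_def)
  qed
  have 6: "runs M (pow_code ''H'' ''K'') s' (\<lambda>\<tau> s'. \<tau> \<le> K * 20 + 20 \<and> B6 s')" if "B5 s'" for s'
    by (rule runs_frame_regs[OF runs_pow_code[where n = K]]) (use that Y in \<open>simp_all add: Bs\<close>)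
  have 7: "runs M (pow_code ''Q'' ''m'') s' (\<lambda>\<tau> s'. \<tau> \<le> m * 20 + 20 \<and> B7 s')" if "B6 s'" for s'
    by (rule runs_frame_regs[OF runs_pow_code[where n = m]]) (use that Y in \<open>simp_all add: Bs\<close>)
  have 8: "runs M (pow_code ''D'' ''t'') s' (\<lambda>\<tau> s'. \<tau> \<le> t * 20 + 20 \<and> B8 s')" if "B7 s'" for s'
    by (rule runs_frame_regs[OF runs_pow_code[where n = t]]) (use that Y in \<open>simp_all add: Bs\<close>)
  have two: "2 \<le> 2 ^ \<kappa> + (of_bool (\<kappa> = 0) :: nat)"
    by (cases \<kappa>) simp_all
  have 9: "runs M prime_code s' (\<lambda>\<tau> s'. \<tau> \<le> (q + 1) * (q + 1) * 20 + 10 \<and> ?post s')" if "B8 s'" for s'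
  proof (rule runs_frame_regs[OF runs_prime_code[OF _ two q(3,1,2)]])
    show "regs s' ''p'' = 2 ^ \<kappa> + of_bool (\<kappa> = 0)" using that by (simp add: Bs)
  qed (use that in \<open>simp_all add: Bs\<close>)
  show ?thesis
    unfolding setup_code_def
    by (rule runs_mono[OF runs_Seq_time[OF 1 runs_Seq_time[OF 2 runs_Seq_time[OF 3 runs_Seq_time[OF 4
      runs_Seq_time[OF 5 runs_Seq_time[OF 6 runs_Seq_time[OF 7 runs_Seq_time[OF 8 9]]]]]]]]]) auto
qed

section \<open>Size of the tensors\<close>

text \<open>
  For programs of length 2 the number of node bits is irrelevant; computing the logarithm of the
  width would exceed the time bound, which is then independent of the width.
\<close>

definition node_bits :: "nat \<Rightarrow> nat \<Rightarrow> nat" where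
  "node_bits T W = (if T < 3 then 0 else clog W)"

definition tree_depth :: "nat \<Rightarrow> nat \<Rightarrow> nat" where
  "tree_depth T W = 2 * node_bits T W * clog (T - 1)"

text \<open>The error \<open>m * (m + 1) / 2 ^ \<kappa>\<close> has to be below
  \<open>\<epsilon>\<close>; the summand 1 makes this inequality strict.\<close>

definition coin_bits :: "nat \<Rightarrow> nat \<Rightarrow> nat \<Rightarrow> nat" where
  "coin_bits T W iv = clog (tree_depth T W * (tree_depth T W + 1) * iv + 1)"

definition tensor_order :: "nat \<Rightarrow> nat \<Rightarrow> nat \<Rightarrow> nat" where
  "tensor_order T W iv =
     rounds (tree_depth T W) 0 * (6 * (2 * coin_bits T W iv) + 2 * coin_bits T W iv)
     + 2 * (2 * coin_bits T W iv)"

text \<open>A round takes 12 \<open>\<kappa>\<close> indices for three coefficients and 2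
  \<open>\<kappa>\<close> for the point; there are \<open>m * (m + 1) / 2\<close> rounds and a last
  message of 4 \<open>\<kappa>\<close> indices.\<close>

lemma tensor_order_eq:
  "tensor_order T W iv = coin_bits T W iv * (7 * (tree_depth T W * (tree_depth T W + 1)) + 4)"
proof -
  have "tensor_order T W iv = coin_bits T W iv * (7 * (2 * rounds (tree_depth T W) 0) + 4)"
    by (simp add: tensor_order_def algebra_simps)
  then show ?thesis unfolding twice_rounds by simp
qed

lemma clog_1 [simp]: "clog (Suc 0) = 0"
  using less_clog_iff[of 0 1] by simp

text \<open>A single layer of edges needs no game. The order has to be exactly 0 here because the
  bound to be proved is 0 when moreover \<open>W = 2\<close> and
  \<open>\<epsilon> = 1\<close>.\<close>

lemma parameters_length_two: "tree_depth 2 W = 0" "coin_bits 2 W iv = 0" "tensor_order 2 W iv = 0"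
  by (simp_all add: tree_depth_def coin_bits_def tensor_order_def node_bits_def numeral_2_eq_2)

text \<open>Already \<open>m = 2\<close> gives \<open>m * (m + 1) * iv + 1 > 4\<close>, so
  \<open>\<kappa>\<close> reaches the value 3 from which \<open>ex_prime_between\<close>
  works.\<close>

lemma parameters_pos:
  assumes "3 \<le> T" "2 \<le> W" "1 \<le> iv"
  shows "0 < node_bits T W" "0 < clog (T - 1)" "2 \<le> tree_depth T W" "3 \<le> coin_bits T W iv"
proof -
  show L: "0 < node_bits T W" using assms less_clog_iff[of 0 W] by (simp add: node_bits_def)
  show K: "0 < clog (T - 1)" using assms less_clog_iff[of 0 "T - 1"] by simp
  have "1 \<le> node_bits T W * clog (T - 1)" using L K by (simp add: Suc_le_eq)
  then show m: "2 \<le> tree_depth T W" unfolding tree_depth_def by simp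
  have "2 * 3 * 1 \<le> tree_depth T W * (tree_depth T W + 1) * iv"
    using m assms(3) by (intro mult_mono) auto
  then have "2 ^ 2 < tree_depth T W * (tree_depth T W + 1) * iv + 1" by simp
  then have "2 < coin_bits T W iv" unfolding coin_bits_def less_clog_iff .
  then show "3 \<le> coin_bits T W iv" by simp
qed

text \<open>Everything computed or tabulated in the reduction is measured against \<open>D\<close>,
  since the time bound has no other parameter of the program. All exponents are at most
  \<open>t\<close>, and \<open>t \<le> 2 ^ t\<close>.\<close>

lemma parameters_le:
  assumes "2 \<le> T" "2 \<le> W" "1 \<le> iv"
  defines "D \<equiv> 2 ^ tensor_order T W iv"
  shows "node_bits T W \<le> D" "clog (T - 1) \<le> D" "tree_depth T W \<le> D" "2 ^ tree_depth T W \<le> D"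
    "coin_bits T W iv \<le> D" "2 * coin_bits T W iv \<le> D" "2 ^ coin_bits T W iv \<le> D"
    "2 ^ (2 * coin_bits T W iv) \<le> D" "rounds (tree_depth T W) 0 \<le> D" "tensor_order T W iv \<le> D"
proof -
  let ?m = "tree_depth T W" and ?k = "coin_bits T W iv" and ?t = "tensor_order T W iv"
  have tD: "?t \<le> D" by (simp add: D_def less_imp_le)
  have pow: "2 ^ q \<le> D" if "q \<le> ?t" for q
    unfolding D_def using that by (intro power_increasing) auto
  have *: "node_bits T W \<le> ?t \<and> clog (T - 1) \<le> ?t \<and> ?m \<le> ?t \<and> rounds ?m 0 \<le> ?t"
  proof (cases "T = 2")
    case True
    then show ?thesis using parameters_length_two by (simp add: node_bits_def numeral_2_eq_2)
  next
    case False
    then have T: "3 \<le> T" using assms(1) by simp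
    note pos = parameters_pos[OF T assms(2,3)]
    have "1 * (?m * (?m + 1)) \<le> ?k * (7 * (?m * (?m + 1)) + 4)"
      using pos(4) by (intro mult_mono) auto
    then have mt: "?m * (?m + 1) \<le> ?t" by (simp add: tensor_order_eq)
    have m: "?m \<le> ?t" using mt by simp
    have "node_bits T W * 1 \<le> node_bits T W * clog (T - 1)" "1 * clog (T - 1) \<le> node_bits T W * clog (T - 1)"
      using pos(1,2) by (intro mult_mono; simp)+
    then have "node_bits T W \<le> ?m" "clog (T - 1) \<le> ?m" unfolding tree_depth_def by linarith+
    moreover have "rounds ?m 0 \<le> ?m * (?m + 1)" using twice_rounds[of ?m 0] by simp
    ultimately show ?thesis using m mt by linarith
  qed
  have k: "2 * ?k \<le> ?t" unfolding tensor_order_def by simp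
  show "node_bits T W \<le> D" "clog (T - 1) \<le> D" "?m \<le> D" "?k \<le> D" "2 * ?k \<le> D" "rounds ?m 0 \<le> D" "?t \<le> D"
    using * k tD by linarith+
  show "2 ^ ?m \<le> D" "2 ^ ?k \<le> D" "2 ^ (2 * ?k) \<le> D" using * k by (auto intro: pow)
qed

text \<open>The rounding in \<open>L\<close>, \<open>K\<close> and
  \<open>\<lceil>1 / \<epsilon>\<rceil>\<close> costs a factor 2 each, so \<open>m\<close> is at
  most 8 \<open>lw * lt\<close> and \<open>m * (m + 1)\<close> at most 128 times the square of
  \<open>lw * lt\<close>. The constant is the product of 22 (from \<open>\<kappa>\<close>), 9 and
  128, which is 25344.\<close>

lemma tensor_order_bound:
  fixes \<epsilon> :: real
  assumes "2 \<le> T" "2 \<le> W" "0 < \<epsilon>" "\<epsilon> \<le> 1"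
  shows "real (tensor_order T W (nat \<lceil>1 / \<epsilon>\<rceil>)) \<le> 30000 * ((log 2 (real W))\<^sup>2 * (log 2 (real T))\<^sup>2 *
    (log 2 (log 2 (real W)) + log 2 (log 2 (real T)) + log 2 (1 / \<epsilon>)))"
proof -
  define iv where "iv = nat \<lceil>1 / \<epsilon>\<rceil>"
  define lw lt where "lw = log 2 (real W)" and "lt = log 2 (real T)"
  define S where "S = log 2 lw + log 2 lt + log 2 (1 / \<epsilon>)"
  have lw: "1 \<le> lw" and lt: "1 \<le> lt" using assms by (simp_all add: lw_def lt_def)
  have le: "0 \<le> log 2 (1 / \<epsilon>)" and llw: "0 \<le> log 2 lw" and llt: "0 \<le> log 2 lt"
    using assms lw lt by simp_all
  have "real (tensor_order T W iv) \<le> 30000 * (lw\<^sup>2 * lt\<^sup>2 * S)"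
  proof (cases "T = 2")
    case True
    then show ?thesis
      using le llw llt by (simp add: parameters_length_two S_def)
  next
    case False
    then have T: "3 \<le> T" using assms(1) by simp
    have inv1: "1 \<le> 1 / \<epsilon>" using assms by simp
    have iv: "1 \<le> iv" "real iv \<le> 2 / \<epsilon>"
    proof -
      define c where "c = \<lceil>1 / \<epsilon>\<rceil>"
      have c: "1 \<le> c" using inv1 unfolding c_def by linarith
      then show "1 \<le> iv" by (simp add: iv_def c_def[symmetric])
      have "real iv = real_of_int c" using c by (simp add: iv_def c_def[symmetric])
      also have "\<dots> \<le> 1 / \<epsilon> + 1" unfolding c_def by linarith
      also have "\<dots> \<le> 1 / \<epsilon> + 1 / \<epsilon>" using inv1 by simp
      finally show "real iv \<le> 2 / \<epsilon>" by simp
    qed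
    note pos = parameters_pos[OF T assms(2) iv(1)]
    define m k where "m = tree_depth T W" and "k = coin_bits T W iv"
    have clog_le: "real (clog n) \<le> 1 + log 2 (real n)" if "1 \<le> n" for n
    proof -
      have "real (2 ^ clog n) \<le> real (2 * n)" using two_power_clog_less[OF that] by (simp only: of_nat_le_iff)
      then have "log 2 (2 ^ clog n) \<le> log 2 (2 * real n)"
        using that by (subst log_le_cancel_iff) auto
      then show ?thesis using that by (simp add: log_nat_power log_mult)
    qed
    have L: "real (node_bits T W) \<le> 2 * lw"
    proof -
      have "real (clog W) \<le> 1 + lw" unfolding lw_def using assms(2) by (intro clog_le) simp
      then show ?thesis using T lw by (simp add: node_bits_def)
    qed
    have K: "real (clog (T - 1)) \<le> 2 * lt"
    proof -
      have "real (clog (T - 1)) \<le> 1 + log 2 (real (T - 1))" using T by (intro clog_le) simp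
      also have "log 2 (real (T - 1)) \<le> lt" using T by (simp add: lt_def)
      finally show ?thesis using lt by simp
    qed
    have m: "real m \<le> 8 * (lw * lt)"
    proof -
      have "real (node_bits T W) * real (clog (T - 1)) \<le> (2 * lw) * (2 * lt)"
        using L K lw by (intro mult_mono) auto
      then show ?thesis by (simp add: m_def tree_depth_def mult.commute)
    qed
    have m2: "2 \<le> m" using pos(3) by (simp add: m_def)
    have mm: "real (m * (m + 1)) \<le> 128 * (lw\<^sup>2 * lt\<^sup>2)"
    proof -
      have "real (m * (m + 1)) \<le> 2 * (real m * real m)"
        using m2 by (simp add: algebra_simps)
      also have "\<dots> \<le> 2 * ((8 * (lw * lt)) * (8 * (lw * lt)))"
        using m by (intro mult_left_mono mult_mono) auto
      finally show ?thesis by (simp add: power2_eq_square algebra_simps)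
    qed
    \<comment> \<open>For \<open>3 \<le> T\<close> this keeps \<open>S\<close> away from 0, so that
      additive constants can be absorbed; it rests on \<open>log 2 3 \<ge> 3 / 2\<close>. For
      \<open>T = 2\<close> it fails.\<close>
    have lt_half: "1 / 2 \<le> log 2 lt"
    proof -
      have "(2::real) powr (3 / 2) \<le> real T"
      proof -
        have "((2::real) powr (3 / 2))\<^sup>2 = 8"
          by (simp add: power2_eq_square flip: powr_add)
        also have "\<dots> \<le> 3\<^sup>2" by simp
        finally have "(2::real) powr (3 / 2) \<le> 3" by (rule power2_le_imp_le) simp
        then show ?thesis using T by linarith
      qed
      then have 1: "3 / 2 \<le> lt" unfolding lt_def using T by (subst le_log_iff) auto
      have "(2::real) powr (1 / 2) \<le> 3 / 2"
      proof -
        have "((2::real) powr (1 / 2))\<^sup>2 = 2"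
          by (simp add: power2_eq_square flip: powr_add)
        also have "\<dots> \<le> (3 / 2)\<^sup>2" by (simp add: power2_eq_square)
        finally show ?thesis by (rule power2_le_imp_le) simp
      qed
      then show ?thesis using 1 by (subst le_log_iff) auto
    qed
    then have S: "1 / 2 \<le> S" using le llw by (simp add: S_def)
    have k: "real k \<le> 22 * S"
    proof -
      let ?n = "m * (m + 1) * iv + 1"
      have kn: "real k \<le> 1 + log 2 (real ?n)"
        unfolding k_def coin_bits_def m_def[symmetric] by (rule clog_le) simp
      have nle: "real ?n \<le> 512 * (lw\<^sup>2 * lt\<^sup>2 * (1 / \<epsilon>))"
      proof -
        have "1 \<le> m * (m + 1) * iv" using m2 iv(1) by (simp add: Suc_le_eq)
        then have "real ?n \<le> 2 * (real (m * (m + 1)) * real iv)"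
          by (simp only: of_nat_add of_nat_mult of_nat_1 flip: of_nat_mult)
        also have "\<dots> \<le> 2 * ((128 * (lw\<^sup>2 * lt\<^sup>2)) * (2 / \<epsilon>))"
          using mm iv(2) by (intro mult_left_mono mult_mono) auto
        finally show ?thesis by (simp add: algebra_simps)
      qed
      have "0 < real ?n" by (simp only: of_nat_0_less_iff)
      with nle have "log 2 (real ?n) \<le> log 2 (512 * (lw\<^sup>2 * lt\<^sup>2 * (1 / \<epsilon>)))"
        by (subst log_le_cancel_iff) linarith+
      also have "\<dots> = 9 + (2 * log 2 lw + 2 * log 2 lt + log 2 (1 / \<epsilon>))"
      proof -
        have "log 2 (512::real) = 9" using log_pow_cancel[of "2::real" 9] by simp
        moreover have "log 2 (lw\<^sup>2 * lt\<^sup>2 * (1 / \<epsilon>)) = 2 * log 2 lw + 2 * log 2 lt + log 2 (1 / \<epsilon>)"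
          using lw lt assms(3) by (simp add: log_mult log_divide log_nat_power)
        moreover have "log 2 (512 * (lw\<^sup>2 * lt\<^sup>2 * (1 / \<epsilon>))) = log 2 512 + log 2 (lw\<^sup>2 * lt\<^sup>2 * (1 / \<epsilon>))"
          using lw lt assms(3) by (intro log_mult_pos) auto
        ultimately show ?thesis by simp
      qed
      also have "\<dots> \<le> 9 + 2 * S" using le by (simp add: S_def)
      \<comment> \<open>\<open>\<kappa>\<close> is at most \<open>10 + 2 * S\<close>, and
        \<open>10 \<le> 20 * S\<close>.\<close>
      finally show ?thesis using S kn by linarith
    qed
    have "real (tensor_order T W iv) \<le> real k * (9 * real (m * (m + 1)))"
    proof -
      have "2 * 2 \<le> m * (m + 1)" using m2 by (intro mult_mono) auto
      then have "k * (7 * (m * (m + 1)) + 4) \<le> k * (9 * (m * (m + 1)))" by (intro mult_left_mono) linarith+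
      then have "real (k * (7 * (m * (m + 1)) + 4)) \<le> real (k * (9 * (m * (m + 1))))" by (simp only: of_nat_le_iff)
      then show ?thesis unfolding tensor_order_eq k_def m_def by (simp only: of_nat_mult of_nat_numeral)
    qed
    also have "\<dots> \<le> (22 * S) * (9 * (128 * (lw\<^sup>2 * lt\<^sup>2)))"
      using k mm S by (intro mult_mono) auto
    also have "\<dots> \<le> 30000 * (lw\<^sup>2 * lt\<^sup>2 * S)"
      using S by (simp add: algebra_simps)
    finally show ?thesis .
  qed
  then show ?thesis by (simp only: iv_def lw_def lt_def S_def)
qed

section \<open>The reduction\<close>

definition reduction_code :: com where
  "reduction_code =
    (setup_code ;; ''side'' ::= Const 0 ;; tensors_code ''A'' ''U'' ;;
     ''side'' ::= Const 1 ;; tensors_code ''B'' ''V'')"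

text \<open>The cubic term is the table of leaves: \<open>2 ^ m\<close> leaves, \<open>K\<close>
  steps each, \<open>L\<close> bits per step, all three at most \<open>D\<close>.\<close>

lemma entry_time_bound:
  fixes D :: nat
  assumes "R \<le> D" "\<mu> \<le> D" "\<kappa> \<le> D" "Q \<le> D" "K \<le> D" "L \<le> D" "m \<le> D" "1 \<le> D"
  shows "R * (\<mu> * 90 + \<kappa> * 30 + 180) + \<mu> * 30 + Q * (K * (L * 30 + 50) + 120) + m * (Q * 40 + 40) + 150
    \<le> 760 * (D * D * D)"
proof -
  define D2 D3 where "D2 = D * D" and "D3 = D * D * D"
  have "1 * D \<le> D * D" "1 * (D * D) \<le> D * (D * D)" using assms(8) by (intro mult_right_mono; simp)+
  then have D: "1 \<le> D" "D \<le> D2" "D2 \<le> D3" using assms(8) by (simp_all add: D2_def D3_def mult.assoc)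
  have "R * (\<mu> * 90 + \<kappa> * 30 + 180) \<le> D * (300 * D)"
    using assms by (intro mult_mono) auto
  moreover have "D * (300 * D) = 300 * D2" by (simp add: D2_def)
  moreover have "Q * (K * (L * 30 + 50) + 120) \<le> D * (200 * D2)"
  proof (intro mult_mono)
    have "K * (L * 30 + 50) \<le> D * (80 * D)" using assms by (intro mult_mono) auto
    moreover have "D * (80 * D) = 80 * D2" by (simp add: D2_def)
    ultimately show "K * (L * 30 + 50) + 120 \<le> 200 * D2" using D by linarith
  qed (use assms in auto)
  moreover have "D * (200 * D2) = 200 * D3" by (simp add: D2_def D3_def)
  moreover have "m * (Q * 40 + 40) \<le> D * (80 * D)"
    using assms by (intro mult_mono) auto
  moreover have "D * (80 * D) = 80 * D2" by (simp add: D2_def)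
  ultimately show ?thesis unfolding D3_def[symmetric] using assms(2) D by linarith
qed

lemma tensors_time_bound:
  fixes D N :: nat
  assumes "e \<le> 760 * (D * D * D)" "1 \<le> D" "1 \<le> N"
  shows "N * (D * (e + 10) + 20) + 10 \<le> 800 * (N * D ^ 4)"
proof -
  have D4: "1 \<le> D ^ 4" "1 \<le> D * D * D" "D ^ 4 = D * (D * D * D)"
    using assms(2) by (simp_all add: eval_nat_numeral)
  have "D * (e + 10) \<le> D * (770 * (D * D * D))" using assms(1) D4(2) by (intro mult_left_mono) linarith+
  also have "\<dots> = 770 * D ^ 4" using D4(3) by simp
  finally have "D * (e + 10) + 20 \<le> 790 * D ^ 4" using D4(1) by linarith
  then have "N * (D * (e + 10) + 20) \<le> N * (790 * D ^ 4)" by (intro mult_left_mono) auto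
  moreover have "1 * 1 \<le> N * D ^ 4" using assms(3) D4(1) by (intro mult_mono) auto
  moreover have "N * (790 * D ^ 4) = 790 * (N * D ^ 4)" by simp
  ultimately show ?thesis by linarith
qed

lemma setup_time_bound:
  fixes D q :: nat
  assumes "L \<le> D" "K \<le> D" "\<kappa> \<le> D" "m \<le> D" "t \<le> D" "q \<le> 2 * D" "1 \<le> D" "1 \<le> N"
  shows "L * 40 + K * 60 + \<kappa> * 40 + m * 20 + t * 20 + (q + 1) * (q + 1) * 20 + 400 \<le> 760 * (N * D ^ 4)"
proof -
  define E where "E = N * D ^ 4"
  have "(q + 1) * (q + 1) \<le> (3 * D) * (3 * D)" using assms by (intro mult_mono) auto
  moreover have "(3 * D) * (3 * D) = 9 * D ^ 2" by (simp add: power2_eq_square)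
  moreover have E: "1 * D ^ e \<le> E" if "e \<le> 4" for e
    unfolding E_def using assms(7,8) that by (intro mult_mono power_increasing) simp_all
  have "D ^ 2 \<le> E" "D \<le> E" "1 \<le> E" using E[of 2] E[of 1] E[of 0] by simp_all
  ultimately show ?thesis unfolding E_def[symmetric] using assms(1-5) by linarith
qed

text \<open>One generous constant 4000 serves as factor and exponent of the time bound and as
  exponent of the number of words. The estimates give time at most 2370 times
  \<open>N * D ^ 4\<close>, and words below the 60th power of the sum of the parameters
  suffice.\<close>

theorem reduction_correct:
  fixes \<epsilon> :: real and s :: mem
  assumes T: "2 \<le> bp_length P" and W: "2 \<le> bp_width P" and \<epsilon>: "0 < \<epsilon>" "\<epsilon> \<le> 1" and N: "1 \<le> N"
    and inst: "bp_pair_instance N P A B" and inp: "encodes_input \<epsilon> P A B s"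
  defines "t \<equiv> tensor_order (bp_length P) (bp_width P) (nat \<lceil>1 / \<epsilon>\<rceil>)"
  shows "\<exists>\<tau> s' U V. exec (word_bound 4000 \<epsilon> N P (2 ^ t)) reduction_code s \<tau> s' \<and>
    \<tau> \<le> 4000 * N * (2 ^ t) ^ 4000 \<and> length U = N \<and> length V = N \<and> encodes_output t U V s' \<and>
    (bp_satisfying_pair P A B \<longrightarrow> tropsim_complete t U V) \<and>
    (\<not> bp_satisfying_pair P A B \<longrightarrow> tropsim_sound \<epsilon> t U V)"
proof -
  define iv where "iv = nat \<lceil>1 / \<epsilon>\<rceil>"
  define T W where "T = bp_length P" and "W = bp_width P"
  define L K m \<kappa> where "L = node_bits T W" and "K = clog (T - 1)" and "m = tree_depth T W"
    and "\<kappa> = coin_bits T W iv"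
  define D :: nat where "D = 2 ^ t"
  define X where "X = bp_inputs P + N + T + W + iv + D"
  \<comment> \<open>The square absorbs constant factors such as those in \<open>2 * D\<close> and
    \<open>4 * T\<close>, because \<open>X\<close> is at least 8.\<close>
  define Y where "Y = X ^ 2"
  define M where "M = X ^ 4000"
  have t: "t = tensor_order T W iv" by (simp add: t_def T_def W_def iv_def)
  have TW: "2 \<le> T" "2 \<le> W" using T W by (simp_all add: T_def W_def)
  have iv: "1 \<le> iv" "1 / \<epsilon> \<le> real iv"
  proof -
    define c where "c = \<lceil>1 / \<epsilon>\<rceil>"
    have "1 \<le> 1 / \<epsilon>" using \<epsilon> by simp
    then have c: "1 \<le> c" unfolding c_def by linarith
    then show "1 \<le> iv" by (simp add: iv_def c_def[symmetric])
    have "real iv = real_of_int c" using c by (simp add: iv_def c_def[symmetric])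
    then show "1 / \<epsilon> \<le> real iv" unfolding c_def by linarith
  qed
  have m_eq: "m = 2 * L * K" by (simp add: m_def L_def K_def tree_depth_def)
  have \<kappa>_eq: "\<kappa> = clog (m * (m + 1) * iv + 1)" by (simp add: \<kappa>_def coin_bits_def m_def)
  have t_eq: "t = rounds m 0 * (6 * (2 * \<kappa>) + 2 * \<kappa>) + 2 * (2 * \<kappa>)"
    by (simp add: t tensor_order_def m_def \<kappa>_def)
  note le = parameters_le[OF TW iv(1), folded L_def K_def m_def \<kappa>_def t, folded D_def]
  have P: "branching_program P" "even (bp_inputs P)" "length A = N" "length B = N"
    and len: "\<And>x. x \<in> set A \<union> set B \<Longrightarrow> length x = bp_inputs P div 2"
    using inst by (auto simp: bp_pair_instance_def)
  have "bp_label P 0 < bp_inputs P" using P(1) T by (simp add: branching_program_def)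
  \<comment> \<open>There is an input variable at all because layer 0 carries a label; this supplies
    one of the 8 units needed for \<open>X\<close>.\<close>
  then have n1: "1 \<le> bp_inputs P" by simp
  have D1: "1 \<le> D" by (simp add: D_def)
  have X8: "8 \<le> X" using n1 N TW iv(1) D1 by (simp add: X_def)
  have XX: "8 * X \<le> Y" unfolding Y_def power2_eq_square using X8 by (intro mult_right_mono) auto
  have less: "bp_inputs P < Y" "N < Y" "T < Y" "W < Y" "iv < Y" "2 * D < Y" "4 * T < Y" "2 * W < Y"
  proof -
    have X: "bp_inputs P \<le> X" "N \<le> X" "T \<le> X" "W \<le> X" "iv \<le> X" "D \<le> X" by (simp_all add: X_def)
    show "bp_inputs P < Y" "N < Y" "T < Y" "W < Y" "iv < Y" "2 * D < Y" "4 * T < Y" "2 * W < Y"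
      using XX X8 X by linarith+
  qed
  interpret word_ram M Y
  proof
    show "10 \<le> Y" using XX X8 by linarith
    have "Y ^ 30 = X ^ 60" by (simp add: Y_def flip: power_mult)
    also have "\<dots> \<le> M" unfolding M_def using X8 by (intro power_increasing) auto
    finally show "Y ^ 30 \<le> M" .
  qed
  \<comment> \<open>For \<open>T = 2\<close> the tensors have a single entry and the prime is 2,
    which explains the bound \<open>2 * D\<close> instead of \<open>D\<close>.\<close>
  obtain q where q: "prime q" "q \<le> 2 * D" "2 ^ \<kappa> + of_bool (\<kappa> = 0) \<le> q" "q \<le> 2 ^ (2 * \<kappa>) \<or> K = 0 \<and> \<kappa> = 0"
  proof (cases "T = 2")
    case True
    then have "\<kappa> = 0" by (simp add: \<kappa>_def parameters_length_two)
    moreover have "K = 0" using True by (simp add: K_def numeral_2_eq_2)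
    ultimately show ?thesis using D1 by (intro that[of 2]) auto
  next
    case False
    then have "3 \<le> T" using TW by simp
    note k3 = parameters_pos(4)[OF this TW(2) iv(1), folded \<kappa>_def]
    obtain q :: nat where q: "prime q" "2 ^ \<kappa> \<le> q" "q \<le> 2 ^ (2 * \<kappa>)" using ex_prime_between[OF k3] by blast
    show ?thesis by (rule that[of q]) (use q k3 le(8) in auto)
  qed
  have L2: "2 ^ L < Y"
  proof (cases "T < 3")
    case True
    then show ?thesis by (simp add: L_def node_bits_def)
  next
    case False
    then show ?thesis using two_power_clog_less[of W] TW less(8) by (simp add: L_def node_bits_def)
  qed
  have K2: "2 * 2 ^ K < Y"
  proof -
    have "2 ^ K < 2 * (T - 1)" unfolding K_def using TW by (intro two_power_clog_less) simp
    then show ?thesis using less(7) by linarith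
  qed
  have LK: "0 < L \<or> K = 0"
  proof (cases "T = 2")
    case True
    then show ?thesis by (simp add: K_def numeral_2_eq_2)
  next
    case False
    then show ?thesis using parameters_pos(1)[of T W iv] TW iv(1) by (simp add: L_def)
  qed
  have WL: "W \<le> 2 ^ L \<or> K = 0"
  proof (cases "T = 2")
    case True
    then show ?thesis by (simp add: K_def numeral_2_eq_2)
  next
    case False
    then show ?thesis using le_clog[of W] TW by (simp add: L_def node_bits_def)
  qed
  have less2: "2 ^ m < Y" "2 ^ \<kappa> < Y" "2 * \<kappa> < Y" "2 ^ t < Y" "rounds m 0 < Y" "2 * 2 ^ (2 * \<kappa>) < Y" "q < Y"
    using le less(6) q(2) unfolding D_def[symmetric] by linarith+
  let ?good = "\<lambda>s'. \<exists>U V. length U = N \<and> length V = N \<and> encodes_output t U V s' \<and>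
    (bp_satisfying_pair P A B \<longrightarrow> tropsim_complete t U V) \<and>
    (\<not> bp_satisfying_pair P A B \<longrightarrow> tropsim_sound \<epsilon> t U V)"
  let ?done = "\<lambda>s1. regs s1 ''L'' = L \<and> regs s1 ''K'' = K \<and> regs s1 ''m'' = m \<and> regs s1 ''kap'' = \<kappa> \<and>
    regs s1 ''ell'' = 2 * \<kappa> \<and> regs s1 ''R'' = rounds m 0 \<and> regs s1 ''t'' = t \<and>
    regs s1 ''H'' = 2 ^ K \<and> regs s1 ''Q'' = 2 ^ m \<and> regs s1 ''D'' = 2 ^ t \<and>
    regs s1 ''n2'' = bp_inputs P div 2 \<and>
    prime (regs s1 ''p'') \<and> 2 ^ \<kappa> \<le> regs s1 ''p'' \<and> regs s1 ''p'' \<le> q \<and>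
    regs s1 ''N'' = N \<and> regs s1 ''T'' = T \<and> regs s1 ''W'' = W \<and> arrs s1 = arrs s"
  have prep: "runs M setup_code s (\<lambda>\<tau> s1. \<tau> \<le> 760 * (N * D ^ 4) \<and> ?done s1)"
  proof -
    have Ld: "L = (if T < 3 then 0 else clog W)" by (simp add: L_def node_bits_def)
    have regs: "regs s ''n'' = bp_inputs P" "regs s ''T'' = T" "regs s ''W'' = W" "regs s ''inveps'' = iv"
      "regs s ''N'' = N"
      using inp P(3) by (simp_all add: encodes_input_def T_def W_def iv_def)
    have "2 ^ K < Y" using K2 by linarith
    note run = runs_setup_code[OF regs(1-4), folded Ld K_def, folded m_eq, folded \<kappa>_eq, folded t_eq,
        OF less(1,3,4,5) L2 this less2(1-5) q(1) less2(7) q(3)]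
    have "L * 40 + K * 60 + \<kappa> * 40 + m * 20 + t * 20 + (q + 1) * (q + 1) * 20 + 400 \<le> 760 * (N * D ^ 4)"
      by (rule setup_time_bound) (use le q(2) D1 N in auto)
    with run show ?thesis unfolding regs(5) by (elim runs_mono) auto
  qed
  have goal: "runs M (''side'' ::= Const 0 ;; tensors_code ''A'' ''U'' ;;
      ''side'' ::= Const 1 ;; tensors_code ''B'' ''V'') s1 (\<lambda>\<tau> s'. \<tau> \<le> 1610 * (N * D ^ 4) \<and>
    ?good s')" if s1: "?done s1" for s1
  proof -
    define p where "p = regs s1 ''p''"
    have p: "prime p" "2 ^ \<kappa> \<le> p" "p \<le> q" using s1 by (simp_all add: p_def)
    have p1: "1 < p" using p(1) by (rule prime_gt_1_nat)
    have pY: "p < Y" using p(3) less2(7) by linarith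
    have t_eq': "rounds (2 * L * K) 0 * (6 * (2 * \<kappa>) + 2 * \<kappa>) + 2 * (2 * \<kappa>) = t"
      by (simp only: t_eq m_eq)
    have bnds: "2 ^ (2 * L * K) < Y" "2 ^ (rounds (2 * L * K) 0 * (6 * (2 * \<kappa>) + 2 * \<kappa>) + 2 * (2 * \<kappa>)) < Y"
      "rounds (2 * L * K) 0 < Y" "bp_length P < Y" "bp_width P < Y" "length A < Y" "length B < Y"
      unfolding m_eq[symmetric] t_eq[symmetric] using less2 less P(3,4) by (simp_all add: T_def W_def)
    \<comment> \<open>Both parties use the same prime \<open>p\<close> found by the setup, so that
      their tensors judge the same transcripts over the same field.\<close>
    interpret A: bp_machine M Y P L K p \<kappa> "2 * \<kappa>" 0 A "''A''" "''U''"
      by unfold_locales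
        (use P(1,2) p1 p(2) LK L2 K2 bnds pY less2(6) less(1) in \<open>assumption | simp\<close>)+
    interpret B: bp_machine M Y P L K p \<kappa> "2 * \<kappa>" 1 B "''B''" "''V''"
      by unfold_locales
        (use P(1,2) p1 p(2) LK L2 K2 bnds pY less2(6) less(1) in \<open>assumption | simp\<close>)+
    let ?U = "map (bp_tensor p \<kappa> (2 * \<kappa>) P L K 0) A" and ?V = "map (bp_tensor p \<kappa> (2 * \<kappa>) P L K 1) B"
    have time: "x * (D * (A.entry_time + 10) + 20) + 10 \<le> 800 * (N * D ^ 4)" if "x = N" for x
      unfolding that
    proof (rule tensors_time_bound)
      show "A.entry_time \<le> 760 * (D * D * D)"
        unfolding A.entry_time_def m_eq[symmetric] by (rule entry_time_bound) (use le D1 in auto)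
    qed (use D1 N in auto)
    have envA: "A.env (s1\<lparr>regs := (regs s1)(''side'' := 0)\<rparr>)"
      using s1 P(3) inp unfolding A.env_regs_def A.env_arrs_def encodes_input_def m_eq[symmetric] t_eq[symmetric]
      by (simp add: p_def T_def W_def)
    have runA: "runs M (tensors_code ''A'' ''U'') (s1\<lparr>regs := (regs s1)(''side'' := 0)\<rparr>)
      (\<lambda>\<tau> s2. \<tau> \<le> 800 * (N * D ^ 4) \<and> stores_tensors ''U'' t ?U s2)"
      using A.runs_tensors_code[OF envA] unfolding t_eq' D_def[symmetric]
      by (rule runs_mono) (use time[OF P(3)] in auto)
    have runB: "runs M (''side'' ::= Const 1 ;; tensors_code ''B'' ''V'') s2
      (\<lambda>\<tau> s3. \<tau> \<le> 800 * (N * D ^ 4) + 2 \<and> regs s3 ''t'' = t \<and> stores_tensors ''U'' t ?U s3 \<and>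
        stores_tensors ''V'' t ?V s3)"
      if U: "stores_tensors ''U'' t ?U s2"
        and fr: "\<And>x. x \<notin> assigned (tensors_code ''A'' ''U'') \<Longrightarrow>
          regs s2 x = regs (s1\<lparr>regs := (regs s1)(''side'' := 0)\<rparr>) x"
        and fa: "\<And>a. a \<notin> written (tensors_code ''A'' ''U'') \<Longrightarrow>
          arrs s2 a = arrs (s1\<lparr>regs := (regs s1)(''side'' := 0)\<rparr>) a" for s2
    proof -
      let ?s = "s2\<lparr>regs := (regs s2)(''side'' := 1)\<rparr>"
      have envB: "B.env ?s"
        using s1 P(4) inp unfolding B.env_regs_def B.env_arrs_def encodes_input_def m_eq[symmetric] t_eq[symmetric]
        by (simp add: fr fa p_def T_def W_def P(3))
      have "runs M (tensors_code ''B'' ''V'') ?s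
        (\<lambda>\<tau> s3. \<tau> + 2 \<le> 800 * (N * D ^ 4) + 2 \<and> regs s3 ''t'' = t \<and> stores_tensors ''U'' t ?U s3 \<and>
        stores_tensors ''V'' t ?V s3)"
      proof (rule runs_frame[OF B.runs_tensors_code[OF envB], unfolded t_eq'])
        fix \<tau> and s3 :: mem
        assume 1: "\<tau> \<le> length B * (2 ^ t * (B.entry_time + 10) + 20) + 10 \<and> stores_tensors ''V'' t ?V s3"
          and fr3: "\<And>x. x \<notin> assigned (tensors_code ''B'' ''V'') \<Longrightarrow> regs s3 x = regs ?s x"
          and fa3: "\<And>a. a \<notin> written (tensors_code ''B'' ''V'') \<Longrightarrow> arrs s3 a = arrs ?s a"
        have "\<tau> \<le> 800 * (N * D ^ 4)"
          using 1 time[OF P(4)] unfolding D_def[symmetric] by (blast intro: order_trans)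
        then have "\<tau> + 2 \<le> 800 * (N * D ^ 4) + 2" by (rule add_right_mono)
        moreover have "regs s3 ''t'' = t" using s1 by (simp add: fr3 fr)
        moreover have "stores_tensors ''U'' t ?U s3" using U by (simp add: stores_tensors_def fa3)
        ultimately show "\<tau> + 2 \<le> 800 * (N * D ^ 4) + 2 \<and> regs s3 ''t'' = t \<and> stores_tensors ''U'' t ?U s3 \<and>
          stores_tensors ''V'' t ?V s3" using 1 by blast
      qed
      then show ?thesis
        by (subst runs_Seq, subst runs_Assign) (auto elim!: runs_mono)
    qed
    have pairs: "(bp_accepts P (a @ b) \<longrightarrow>
        trop_sim t (bp_tensor p \<kappa> (2 * \<kappa>) P L K 0 a) (bp_tensor p \<kappa> (2 * \<kappa>) P L K 1 b) = 1) \<and>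
      (\<not> bp_accepts P (a @ b) \<longrightarrow>
        trop_sim t (bp_tensor p \<kappa> (2 * \<kappa>) P L K 0 a) (bp_tensor p \<kappa> (2 * \<kappa>) P L K 1 b) < \<epsilon>)"
      if "a \<in> set A" for a b
    proof -
      have la: "length a = bp_inputs P div 2" using len that by blast
      have TK: "bp_length P - 1 \<le> 2 ^ K" using le_clog[of "T - 1"] by (simp add: K_def T_def)
      note game = bp_tensor_game[OF P(1,2) la WL[unfolded W_def] TK LK, where \<kappa> = \<kappa> and \<mu> = "2 * \<kappa>" and p = p
          and b = b, unfolded t_eq', folded m_eq]
      \<comment> \<open>The strict inequality demanded in the soundness case comes from the summand
        1 inside the logarithm that defines \<open>\<kappa>\<close>.\<close>
      have small: "real (m * (m + 1)) / 2 ^ \<kappa> < \<epsilon>"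
      proof -
        have "m * (m + 1) * iv < 2 ^ \<kappa>" using le_clog[of "m * (m + 1) * iv + 1"] unfolding \<kappa>_eq by linarith
        then have "real (m * (m + 1)) * real iv < 2 ^ \<kappa>"
          by (metis of_nat_less_iff of_nat_mult of_nat_numeral of_nat_power)
        moreover have "real (m * (m + 1)) * (1 / \<epsilon>) \<le> real (m * (m + 1)) * real iv"
          using iv(2) by (intro mult_left_mono) auto
        ultimately have "real (m * (m + 1)) * (1 / \<epsilon>) < 2 ^ \<kappa>" by linarith
        then show ?thesis using \<epsilon> by (simp add: field_simps)
      qed
      have "p \<le> 2 ^ (2 * \<kappa>) \<or> K = 0 \<and> 2 * \<kappa> = 0" using q(4) p(3) by auto
      then show ?thesis using game(1)[OF p1] game(2)[OF p(1,2)] small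
        by (blast intro: le_less_trans)
    qed
    have result: "?good s3"
      if "regs s3 ''t'' = t" "stores_tensors ''U'' t ?U s3" "stores_tensors ''V'' t ?V s3" for s3
    proof (rule exI[of _ ?U], rule exI[of _ ?V], intro conjI impI)
      show "length ?U = N" "length ?V = N" using P by simp_all
      show "encodes_output t ?U ?V s3" using that by (simp add: encodes_output_def)
      show "tropsim_complete t ?U ?V" if "bp_satisfying_pair P A B"
        using that pairs unfolding bp_satisfying_pair_def tropsim_complete_def by fastforce
      show "tropsim_sound \<epsilon> t ?U ?V" if "\<not> bp_satisfying_pair P A B"
        using that pairs unfolding bp_satisfying_pair_def tropsim_sound_def by fastforce
    qed
    have ND: "1 * 1 \<le> N * D ^ 4" using N D1 by (intro mult_mono) auto
    have "runs M (tensors_code ''A'' ''U'' ;; ''side'' ::= Const 1 ;; tensors_code ''B'' ''V'')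
      (s1\<lparr>regs := (regs s1)(''side'' := 0)\<rparr>) (\<lambda>\<tau> s'. 2 + \<tau> \<le> 1610 * (N * D ^ 4) \<and>
      ?good s')"
    proof (subst runs_Seq, rule runs_frame[OF runA], elim conjE)
      fix \<tau> and s2 :: mem
      assume \<tau>: "\<tau> \<le> 800 * (N * D ^ 4)" and U: "stores_tensors ''U'' t ?U s2"
        and fr: "\<And>x. x \<notin> assigned (tensors_code ''A'' ''U'') \<Longrightarrow>
          regs s2 x = regs (s1\<lparr>regs := (regs s1)(''side'' := 0)\<rparr>) x"
        and fa: "\<And>a. a \<notin> written (tensors_code ''A'' ''U'') \<Longrightarrow>
          arrs s2 a = arrs (s1\<lparr>regs := (regs s1)(''side'' := 0)\<rparr>) a"
      show "runs M (''side'' ::= Const 1 ;; tensors_code ''B'' ''V'') s2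
        (\<lambda>\<tau>2 s'. 2 + (\<tau> + \<tau>2) \<le> 1610 * (N * D ^ 4) \<and>
        ?good s')"
      proof (rule runs_mono, rule runB[OF U], erule fr, erule fa, elim conjE, intro conjI)
        fix \<tau>2 and s3 :: mem
        assume "\<tau>2 \<le> 800 * (N * D ^ 4) + 2"
        then show "2 + (\<tau> + \<tau>2) \<le> 1610 * (N * D ^ 4)" using \<tau> ND by linarith
      qed (rule result)
    qed
    then show ?thesis by (subst runs_Seq, subst runs_Assign) (auto elim!: runs_mono)
  qed
  have "runs M reduction_code s (\<lambda>\<tau> s'. \<tau> \<le> 760 * (N * D ^ 4) + 1610 * (N * D ^ 4) \<and>
    ?good s')"
    unfolding reduction_code_def by (rule runs_Seq_time[OF prep goal])
  then obtain \<tau> s' U V where res: "exec M reduction_code s \<tau> s'" "\<tau> \<le> 760 * (N * D ^ 4) + 1610 * (N * D ^ 4)"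
    "length U = N" "length V = N" "encodes_output t U V s'"
    "bp_satisfying_pair P A B \<longrightarrow> tropsim_complete t U V"
    "\<not> bp_satisfying_pair P A B \<longrightarrow> tropsim_sound \<epsilon> t U V"
    unfolding runs_def by blast
  have "M = word_bound 4000 \<epsilon> N P (2 ^ t)"
    by (simp add: M_def X_def word_bound_def T_def W_def iv_def D_def)
  moreover have "\<tau> \<le> 4000 * N * (2 ^ t) ^ 4000"
  proof -
    have "\<tau> \<le> 4000 * (N * D ^ 4)" using res(2) by linarith
    also have "\<dots> \<le> 4000 * (N * D ^ 4000)"
      using D1 by (intro mult_left_mono power_increasing) auto
    finally show ?thesis by (simp only: D_def mult.assoc)
  qed
  ultimately show ?thesis using res by blast
qed

theorem theorem5p6:
  shows "\<exists>(R :: com) (C :: real) (c :: nat) (t :: nat \<Rightarrow> nat \<Rightarrow> real \<Rightarrow> nat).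
    \<forall>(T :: nat) (W :: nat) (\<epsilon> :: real). 2 \<le> T \<longrightarrow> 2 \<le> W \<longrightarrow> 0 < \<epsilon> \<longrightarrow> \<epsilon> \<le> 1 \<longrightarrow>
      even (t T W \<epsilon>) \<and>
      real (t T W \<epsilon>) \<le> C * ((log 2 (real W))\<^sup>2 * (log 2 (real T))\<^sup>2 *
        (log 2 (log 2 (real W)) + log 2 (log 2 (real T)) + log 2 (1 / \<epsilon>))) \<and>
      (\<forall>(N :: nat) (P :: bp) (A :: bool list list) (B :: bool list list) (s :: mem).
         1 \<le> N \<longrightarrow> bp_pair_instance N P A B \<longrightarrow> bp_length P = T \<longrightarrow> bp_width P = W \<longrightarrow>
         encodes_input \<epsilon> P A B s \<longrightarrow>
         (\<exists>(\<tau> :: nat) (s' :: mem) (U :: tensor list) (V :: tensor list).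
            exec (word_bound c \<epsilon> N P (2 ^ t T W \<epsilon>)) R s \<tau> s' \<and>
            \<tau> \<le> c * N * (2 ^ t T W \<epsilon>) ^ c \<and>
            length U = N \<and> length V = N \<and>
            encodes_output (t T W \<epsilon>) U V s' \<and>
            (bp_satisfying_pair P A B \<longrightarrow> tropsim_complete (t T W \<epsilon>) U V) \<and>
            (\<not> bp_satisfying_pair P A B \<longrightarrow> tropsim_sound \<epsilon> (t T W \<epsilon>) U V)))"
proof (rule exI[of _ reduction_code], rule exI[of _ "30000 :: real"], rule exI[of _ "4000 :: nat"],
    rule exI[of _ "\<lambda>T W \<epsilon>. tensor_order T W (nat \<lceil>1 / \<epsilon>\<rceil>)"], intro allI impI conjI)
  fix T W :: nat and \<epsilon> :: real
  show "even (tensor_order T W (nat \<lceil>1 / \<epsilon>\<rceil>))" by (simp add: tensor_order_def)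
next
  fix T W :: nat and \<epsilon> :: real
  assume "2 \<le> T" "2 \<le> W" "0 < \<epsilon>" "\<epsilon> \<le> 1"
  then show "real (tensor_order T W (nat \<lceil>1 / \<epsilon>\<rceil>)) \<le> 30000 * ((log 2 (real W))\<^sup>2 * (log 2 (real T))\<^sup>2 *
    (log 2 (log 2 (real W)) + log 2 (log 2 (real T)) + log 2 (1 / \<epsilon>)))"
    by (rule tensor_order_bound)
qed (use reduction_correct in blast)

end
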